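(* Let $n\geq 5$ and let $H=\langle (12),(34)\rangle\cong\mathbb Z_2\times\mathbb Z_2\subseteq\mathbb S_n$. Let $\omega$ be a 2-cocycle on $\widehat H$ whose cohomology class is nontrivial, and let $J=\sum_{\alpha,\beta\in\widehat H}\omega(\alpha,\beta)e_\alpha\otimes e_\beta$. Then the Hopf algebra $(k\mathbb S_n)^J$ is simple.
   Context: $k$ is an algebraically closed field of characteristic zero. For a twist $J$ in a Hopf algebra $A$, $A^J$ is the Hopf algebra with the same algebra and counit, comultiplication $\Delta^J(h)=J^{-1}\Delta(h)J$ and antipode $S^J(h)=v^{-1}S(h)v$, $v=m(S\otimes\mathrm{id})(J)$. For an abelian subgroup $H$ of a finite group $G$, $\widehat H$ is its character group and $e_\chi=\frac{1}{|H|}\sum_{h\in H}\chi(h^{-1})h$; for a 2-cocycle $\omega$ on $\widehat H$, $J=\sum\omega(\alpha,\beta)e_\alpha\otimes e_\beta$ is a twist in $kG$. A Hopf subalgebra is normal if stable under the adjoint action ${}^hx=\sum h_1xS(h_2)$; a Hopf algebra is simple if it has no normal Hopf subalgebras other than $k$ and itself. *)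

theory Defs
  imports "HOL-Combinatorics.Combinatorics" "HOL-Computational_Algebra.Polynomial"
begin

type_synonym perm = "nat \<Rightarrow> nat"

definition SG :: "nat \<Rightarrow> perm set" where
  "SG n = {p. p permutes {1..n}}"

definition galg :: "'g set \<Rightarrow> ('g \<Rightarrow> 'k::field) set" where
  "galg X = {a. \<forall>g. g \<notin> X \<longrightarrow> a g = 0}"

definition conv :: "'g set \<Rightarrow> ('g \<Rightarrow> 'g \<Rightarrow> 'g) \<Rightarrow> ('g \<Rightarrow> 'k::field) \<Rightarrow> ('g \<Rightarrow> 'k) \<Rightarrow> ('g \<Rightarrow> 'k)" where
  "conv X m a b = (\<lambda>g. \<Sum>p\<in>{(x,y). x \<in> X \<and> y \<in> X \<and> m x y = g}. a (fst p) * b (snd p))"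

definition delta :: "'g \<Rightarrow> ('g \<Rightarrow> 'k::field)" where
  "delta g = (\<lambda>x. if x = g then 1 else 0)"

definition sc :: "'k::field \<Rightarrow> ('g \<Rightarrow> 'k) \<Rightarrow> ('g \<Rightarrow> 'k)" where
  "sc c a = (\<lambda>g. c * a g)"

definition ainv :: "'g set \<Rightarrow> ('g \<Rightarrow> 'g \<Rightarrow> 'g) \<Rightarrow> ('g \<Rightarrow> 'k::field) \<Rightarrow> ('g \<Rightarrow> 'k) \<Rightarrow> ('g \<Rightarrow> 'k)" where
  "ainv X m e x = (THE y. y \<in> galg X \<and> conv X m y x = e \<and> conv X m x y = e)"

text \<open>kS_n and kS_n \<otimes> kS_n = k[S_n x S_n].\<close>
definition pmul :: "perm \<times> perm \<Rightarrow> perm \<times> perm \<Rightarrow> perm \<times> perm" where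
  "pmul p q = (fst p \<circ> fst q, snd p \<circ> snd q)"

definition KG :: "nat \<Rightarrow> (perm \<Rightarrow> 'k::field) set" where
  "KG n = galg (SG n)"

definition mulG :: "nat \<Rightarrow> (perm \<Rightarrow> 'k::field) \<Rightarrow> (perm \<Rightarrow> 'k) \<Rightarrow> (perm \<Rightarrow> 'k)" where
  "mulG n = conv (SG n) (\<circ>)"

definition mulGG :: "nat \<Rightarrow> (perm \<times> perm \<Rightarrow> 'k::field) \<Rightarrow> (perm \<times> perm \<Rightarrow> 'k) \<Rightarrow> (perm \<times> perm \<Rightarrow> 'k)" where
  "mulGG n = conv (SG n \<times> SG n) pmul"

definition invG :: "nat \<Rightarrow> (perm \<Rightarrow> 'k::field) \<Rightarrow> (perm \<Rightarrow> 'k)" where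
  "invG n = ainv (SG n) (\<circ>) (delta id)"

definition invGG :: "nat \<Rightarrow> (perm \<times> perm \<Rightarrow> 'k::field) \<Rightarrow> (perm \<times> perm \<Rightarrow> 'k)" where
  "invGG n = ainv (SG n \<times> SG n) pmul (delta (id, id))"

definition tens :: "('g \<Rightarrow> 'k::field) \<Rightarrow> ('g \<Rightarrow> 'k) \<Rightarrow> ('g \<times> 'g \<Rightarrow> 'k)" where
  "tens a b = (\<lambda>p. a (fst p) * b (snd p))"

text \<open>Standard Hopf structure of kS_n: \<Delta>(g) = g \<otimes> g, S(g) = g^{-1}.\<close>
definition comultG :: "nat \<Rightarrow> (perm \<Rightarrow> 'k::field) \<Rightarrow> (perm \<times> perm \<Rightarrow> 'k)" where
  "comultG n a = (\<lambda>p. if fst p \<in> SG n \<and> fst p = snd p then a (fst p) else 0)"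

definition antipG :: "nat \<Rightarrow> (perm \<Rightarrow> 'k::field) \<Rightarrow> (perm \<Rightarrow> 'k)" where
  "antipG n a = (\<lambda>g. if g \<in> SG n then a (inv g) else 0)"

text \<open>m (S \<otimes> id) : kG \<otimes> kG -> kG, g \<otimes> h |-> g^{-1} h.\<close>
definition mSid :: "nat \<Rightarrow> (perm \<times> perm \<Rightarrow> 'k::field) \<Rightarrow> (perm \<Rightarrow> 'k)" where
  "mSid n J = (\<lambda>x. \<Sum>p\<in>{(g,h). g \<in> SG n \<and> h \<in> SG n \<and> inv g \<circ> h = x}. J p)"

definition comultJ :: "nat \<Rightarrow> (perm \<times> perm \<Rightarrow> 'k::field) \<Rightarrow> (perm \<Rightarrow> 'k) \<Rightarrow> (perm \<times> perm \<Rightarrow> 'k)" where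
  "comultJ n J a = mulGG n (mulGG n (invGG n J) (comultG n a)) J"

definition antipJ :: "nat \<Rightarrow> (perm \<times> perm \<Rightarrow> 'k::field) \<Rightarrow> (perm \<Rightarrow> 'k) \<Rightarrow> (perm \<Rightarrow> 'k)" where
  "antipJ n J a = mulG n (mulG n (invG n (mSid n J)) (antipG n a)) (mSid n J)"

definition tensor_span :: "('g \<Rightarrow> 'k::field) set \<Rightarrow> ('g \<times> 'g \<Rightarrow> 'k) set" where
  "tensor_span B = {(\<lambda>p. \<Sum>i<m. tens (b i) (c i) p) | (m::nat) b c. \<forall>i<m. b i \<in> B \<and> c i \<in> B}"

definition hopf_subalg :: "nat \<Rightarrow> (perm \<times> perm \<Rightarrow> 'k::field) \<Rightarrow> (perm \<Rightarrow> 'k) set \<Rightarrow> bool" where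
  "hopf_subalg n J B \<longleftrightarrow>
     B \<subseteq> KG n \<and>
     (\<forall>x\<in>B. \<forall>y\<in>B. (\<lambda>g. x g + y g) \<in> B) \<and>
     (\<forall>c. \<forall>x\<in>B. sc c x \<in> B) \<and>
     delta id \<in> B \<and>
     (\<forall>x\<in>B. \<forall>y\<in>B. mulG n x y \<in> B) \<and>
     (\<forall>x\<in>B. comultJ n J x \<in> tensor_span B) \<and>
     (\<forall>x\<in>B. antipJ n J x \<in> B)"

text \<open>Adjoint action of (kS_n)^J: ad(h)(x) = \<Sum> h_1 x S^J(h_2), with \<Delta>^J(h) = \<Sum> h_1 \<otimes> h_2.\<close>
definition adjJ :: "nat \<Rightarrow> (perm \<times> perm \<Rightarrow> 'k::field) \<Rightarrow> (perm \<Rightarrow> 'k) \<Rightarrow> (perm \<Rightarrow> 'k) \<Rightarrow> (perm \<Rightarrow> 'k)" where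
  "adjJ n J h x = (\<lambda>y. \<Sum>p\<in>SG n \<times> SG n.
       comultJ n J h p * mulG n (mulG n (delta (fst p)) x) (antipJ n J (delta (snd p))) y)"

definition normal_hopf_subalg :: "nat \<Rightarrow> (perm \<times> perm \<Rightarrow> 'k::field) \<Rightarrow> (perm \<Rightarrow> 'k) set \<Rightarrow> bool" where
  "normal_hopf_subalg n J B \<longleftrightarrow> hopf_subalg n J B \<and> (\<forall>h\<in>KG n. \<forall>x\<in>B. adjJ n J h x \<in> B)"

definition simple_twisted :: "nat \<Rightarrow> (perm \<times> perm \<Rightarrow> 'k::field) \<Rightarrow> bool" where
  "simple_twisted n J \<longleftrightarrow>
     (\<forall>B. normal_hopf_subalg n J B \<longrightarrow> B = {sc c (delta id) | c. True} \<or> B = KG n)"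

definition HH :: "perm set" where
  "HH = {id, Transposition.transpose 1 2, Transposition.transpose 3 4,
         Transposition.transpose 1 2 \<circ> Transposition.transpose 3 4}"

definition chars :: "perm set \<Rightarrow> (perm \<Rightarrow> 'k::field) set" where
  "chars H = {\<chi>. (\<forall>x\<in>H. \<forall>y\<in>H. \<chi> (x \<circ> y) = \<chi> x * \<chi> y) \<and> (\<forall>x\<in>H. \<chi> x \<noteq> 0) \<and>
                 (\<forall>x. x \<notin> H \<longrightarrow> \<chi> x = 0)}"

definition chmul :: "(perm \<Rightarrow> 'k::field) \<Rightarrow> (perm \<Rightarrow> 'k) \<Rightarrow> (perm \<Rightarrow> 'k)" where
  "chmul \<alpha> \<beta> = (\<lambda>h. \<alpha> h * \<beta> h)"

definition idem :: "perm set \<Rightarrow> (perm \<Rightarrow> 'k::field) \<Rightarrow> (perm \<Rightarrow> 'k)" where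
  "idem H \<chi> = (\<lambda>g. if g \<in> H then \<chi> (inv g) / of_nat (card H) else 0)"

definition cocycle2 :: "(perm \<Rightarrow> 'k::field) set \<Rightarrow> ((perm \<Rightarrow> 'k) \<Rightarrow> (perm \<Rightarrow> 'k) \<Rightarrow> 'k) \<Rightarrow> bool" where
  "cocycle2 X \<omega> \<longleftrightarrow> (\<forall>\<alpha>\<in>X. \<forall>\<beta>\<in>X. \<omega> \<alpha> \<beta> \<noteq> 0) \<and>
     (\<forall>\<alpha>\<in>X. \<forall>\<beta>\<in>X. \<forall>\<gamma>\<in>X. \<omega> \<alpha> \<beta> * \<omega> (chmul \<alpha> \<beta>) \<gamma> = \<omega> \<beta> \<gamma> * \<omega> \<alpha> (chmul \<beta> \<gamma>))"

definition coboundary2 :: "(perm \<Rightarrow> 'k::field) set \<Rightarrow> ((perm \<Rightarrow> 'k) \<Rightarrow> (perm \<Rightarrow> 'k) \<Rightarrow> 'k) \<Rightarrow> bool" where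
  "coboundary2 X \<omega> \<longleftrightarrow> (\<exists>f. (\<forall>\<alpha>\<in>X. f \<alpha> \<noteq> 0) \<and>
     (\<forall>\<alpha>\<in>X. \<forall>\<beta>\<in>X. \<omega> \<alpha> \<beta> = f \<alpha> * f \<beta> / f (chmul \<alpha> \<beta>)))"

definition twistJ :: "perm set \<Rightarrow> ((perm \<Rightarrow> 'k::field) \<Rightarrow> (perm \<Rightarrow> 'k) \<Rightarrow> 'k) \<Rightarrow> (perm \<times> perm \<Rightarrow> 'k)" where
  "twistJ H \<omega> = (\<lambda>p. \<Sum>\<alpha>\<in>chars H. \<Sum>\<beta>\<in>chars H. \<omega> \<alpha> \<beta> * tens (idem H \<alpha>) (idem H \<beta>) p)"

end

theory Submission
  imports Defs "HOL-Library.Function_Algebras"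
begin

text \<open>Let \<open>B\<close> be a normal Hopf subalgebra of \<open>A\<^sup>J\<close>, \<open>A = k S\<^sub>n\<close>. The square of \<open>S\<^sup>J\<close> is the
  identity, so the trace formula gives an integral \<open>L\<close> of \<open>B\<close> with counit \<open>1\<close>. By normality the right
  ideal \<open>I = B\<^sup>+ A = {x. L x = 0}\<close> is two-sided, and then \<open>\<Delta>(I) = J \<Delta>\<^sup>J(I) J\<^sup>-\<^sup>1\<close> shows that it is also a
  coideal for the untwisted coproduct. Hence either \<open>I = 0\<close>, and \<open>B = k\<close>, or \<open>I\<close> contains \<open>g - 1\<close> for
  all \<open>g\<close> in a nontrivial normal subgroup, so for all even \<open>g\<close>, and \<open>L\<close> depends only on the sign.
  If the sign character does not vanish on \<open>I\<close>, then \<open>L\<close> is the integral of \<open>A\<close>, and \<open>\<Delta>\<^sup>J(L)\<close> has full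
  rank, so \<open>B = A\<close>. Otherwise the sign character \<open>s\<close> yields an element \<open>t = \<Sum> \<omega>(s,\<alpha>) \<omega>(\<alpha>,s)\<^sup>-\<^sup>1 e\<^sub>\<alpha>\<close>
  commuting with all even permutations. It has to be a scalar, and this makes \<open>\<omega>\<close> symmetric, hence
  a coboundary.\<close>

section \<open>Subspaces and finite monoid algebras\<close>

text \<open>Every computation with the twist takes place in kH \<otimes> kH, where J is diagonal in
  the Fourier basis. As H has exponent 2, S fixes every idempotent, so S(v) = v; this is why S^J is
  an involution. Characteristic zero then keeps the counit dim B of the trace integral invertible.
  The two coproducts differ by conjugation with J, which preserves I \<otimes> A + A \<otimes> I
  only if I is a two-sided ideal; hence the work spent on left stability of I. The sign character is
  the real obstacle: without a twist, the group algebra of the even permutations is a normal Hopf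
  subalgebra. Its counterpart is excluded because the sign restricts to a nontrivial character s of
  H. The class of \<omega> is governed by the alternating bicharacter \<omega>(\<alpha>,\<beta>) /
  \<omega>(\<beta>,\<alpha>), which on a Klein four-group is either trivial or nondegenerate. So
  symmetry against the single character s already makes \<omega> a coboundary. The bound n \<ge> 5
  supplies a fifth point twice: to produce 3-cycles in a normal subgroup, and to conjugate elements
  of H out of H by an even permutation.\<close>

lemma sum_fun_apply: "(\<Sum>i\<in>I. f i) x = (\<Sum>i\<in>I. f i x)"
  by (induction I rule: infinite_finite_induct) auto

lemma sc_apply [simp]: "sc c a g = c * a g"
  by (simp add: sc_def)

lemma tens_apply [simp]: "tens a b (x, y) = a x * b y"
  by (simp add: tens_def)

lemma sc_sc [simp]: "sc c (sc d a) = sc (c * d) a"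
  by (rule ext) simp

lemma sc_one [simp]: "sc 1 a = a"
  by (rule ext) simp

lemma sc_zero [simp]: "sc 0 a = 0" "sc c 0 = 0"
  by (rule ext, simp)+

lemma sc_minus_one: "sc (-1) a = - a"
  by (rule ext) simp

lemma sc_sum_right: "sc c (\<Sum>i\<in>I. a i) = (\<Sum>i\<in>I. sc c (a i))"
  by (rule ext) (simp add: sum_fun_apply sum_distrib_left)

lemma sc_sum_left: "sc (\<Sum>i\<in>I. c i) a = (\<Sum>i\<in>I. sc (c i) a)"
  by (rule ext) (simp add: sum_fun_apply sum_distrib_right)

lemma tens_sum_left: "tens (\<Sum>i\<in>I. a i) b = (\<Sum>i\<in>I. tens (a i) b)"
  by (rule ext) (simp add: tens_def sum_fun_apply sum_distrib_right)

lemma tens_sum_right: "tens a (\<Sum>i\<in>I. b i) = (\<Sum>i\<in>I. tens a (b i))"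
  by (rule ext) (simp add: tens_def sum_fun_apply sum_distrib_left)

lemma tens_sc: "tens (sc c a) b = sc c (tens a b)" "tens a (sc c b) = sc c (tens a b)"
  by (rule ext, simp add: tens_def)+

definition subsp :: "('g \<Rightarrow> 'k::field) set \<Rightarrow> bool" where
  "subsp V \<longleftrightarrow> 0 \<in> V \<and> (\<forall>x\<in>V. \<forall>y\<in>V. x + y \<in> V) \<and> (\<forall>c. \<forall>x\<in>V. sc c x \<in> V)"

lemma subspD:
  assumes "subsp V"
  shows "0 \<in> V" "x \<in> V \<Longrightarrow> y \<in> V \<Longrightarrow> x + y \<in> V" "x \<in> V \<Longrightarrow> sc c x \<in> V"
    "x \<in> V \<Longrightarrow> y \<in> V \<Longrightarrow> x - y \<in> V"
proof -
  show *: "0 \<in> V" "x \<in> V \<Longrightarrow> y \<in> V \<Longrightarrow> x + y \<in> V" "x \<in> V \<Longrightarrow> sc c x \<in> V" for x y c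
    using assms by (auto simp: subsp_def)
  show "x - y \<in> V" if "x \<in> V" "y \<in> V"
  proof -
    have "x - y = x + sc (-1) y"
      by (simp add: sc_minus_one)
    with * that show ?thesis by metis
  qed
qed

lemma subsp_sum:
  assumes "subsp V" "\<And>i. i \<in> I \<Longrightarrow> f i \<in> V"
  shows "(\<Sum>i\<in>I. f i) \<in> V"
  using assms(2)
  by (induction I rule: infinite_finite_induct) (auto intro: subspD[OF assms(1)])

lemma subsp_galg: "subsp (galg X)"
  by (auto simp: subsp_def galg_def)

lemma delta_galg: "g \<in> X \<Longrightarrow> delta g \<in> galg X"
  by (auto simp: galg_def delta_def)

definition linmap :: "(('a \<Rightarrow> 'k::field) \<Rightarrow> ('b \<Rightarrow> 'k)) \<Rightarrow> bool" where
  "linmap F \<longleftrightarrow> (\<forall>x y. F (x + y) = F x + F y) \<and> (\<forall>c x. F (sc c x) = sc c (F x))"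

lemma linmapI:
  "(\<And>x y. F (x + y) = F x + F y) \<Longrightarrow> (\<And>c x. F (sc c x) = sc c (F x)) \<Longrightarrow> linmap F"
  by (simp add: linmap_def)

lemma linmap_add: "linmap F \<Longrightarrow> F (x + y) = F x + F y"
  and linmap_sc: "linmap F \<Longrightarrow> F (sc c x) = sc c (F x)"
  by (simp_all add: linmap_def)

lemma linmap_zero: "linmap F \<Longrightarrow> F 0 = 0"
  using linmap_sc[of F 0 0] by simp

lemma linmap_diff: "linmap F \<Longrightarrow> F (x - y) = F x - F y"
  using linmap_add[of F x "sc (-1) y"] linmap_sc[of F "-1" y]
  by (simp add: sc_minus_one)

lemma linmap_sum: "linmap F \<Longrightarrow> F (\<Sum>i\<in>I. f i) = (\<Sum>i\<in>I. F (f i))"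
  by (induction I rule: infinite_finite_induct) (simp_all add: linmap_zero[of F] linmap_add[of F])

lemma linmap_comp: "linmap F \<Longrightarrow> linmap G \<Longrightarrow> linmap (\<lambda>x. F (G x))"
  by (simp add: linmap_def)

lemma galg_expand:
  assumes "finite X" "a \<in> galg X"
  shows "a = (\<Sum>g\<in>X. sc (a g) (delta g))"
proof
  fix x
  have "(\<Sum>g\<in>X. sc (a g) (delta g)) x = (\<Sum>g\<in>X. if x = g then a g else 0)"
    by (auto simp: sum_fun_apply delta_def intro!: sum.cong)
  also have "\<dots> = a x"
    using assms by (auto simp: galg_def)
  finally show "a x = (\<Sum>g\<in>X. sc (a g) (delta g)) x" by simp
qed

lemma linmap_expand:
  assumes "finite X" "linmap F" "a \<in> galg X"
  shows "F a = (\<Sum>g\<in>X. sc (a g) (F (delta g)))"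
  by (subst galg_expand[OF assms(1,3)]) (simp add: linmap_sum[OF assms(2)] linmap_sc[OF assms(2)])

lemma linmap_eqI:
  assumes "finite X" "linmap F" "linmap F'" "\<And>g. g \<in> X \<Longrightarrow> F (delta g) = F' (delta g)" "a \<in> galg X"
  shows "F a = F' a"
  using linmap_expand[OF assms(1,2,5)] linmap_expand[OF assms(1,3,5)] assms(4) by simp

lemma linmap_in_subsp:
  assumes "finite X" "linmap F" "subsp V" "\<And>g. g \<in> X \<Longrightarrow> F (delta g) \<in> V" "a \<in> galg X"
  shows "F a \<in> V"
  unfolding linmap_expand[OF assms(1,2,5)]
  by (intro subsp_sum subspD(3) assms)

text \<open>Reduced echelon form: the coordinates with respect to the basis \<open>b\<close> are the values at the
  pivots, so the trace of an endomorphism \<open>T\<close> of \<open>V\<close> is the sum of \<open>T (b s) s\<close> over the pivots.\<close>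

lemma echelon_basis:
  fixes V :: "('g \<Rightarrow> 'k::field) set"
  assumes "finite X" "subsp V" "V \<subseteq> galg X"
  shows "\<exists>S b. S \<subseteq> X \<and> (\<forall>s\<in>S. b s \<in> V) \<and> (\<forall>s\<in>S. \<forall>t\<in>S. b s t = (if s = t then 1 else 0)) \<and>
     (\<forall>x\<in>V. x = (\<Sum>s\<in>S. sc (x s) (b s)))"
  using assms
proof (induction X arbitrary: V rule: finite_induct)
  case empty
  hence "x = 0" if "x \<in> V" for x
    using that by (auto simp: galg_def fun_eq_iff subset_iff)
  thus ?case by (intro exI[of _ "{}"] exI) (auto simp: zero_fun_def)
next
  case (insert a X)
  \<comment> \<open>Members of \<open>V\<close> vanishing at the new coordinate \<open>a\<close>;
    the induction hypothesis applies to them.\<close>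
  define W where "W = V \<inter> galg X"
  have W: "subsp W"
    using insert.prems(1) subsp_galg[of X] by (auto simp: subsp_def W_def)
  have "W \<subseteq> galg X" by (simp add: W_def)
  from insert.IH[OF W this] obtain S b where Sb0: "S \<subseteq> X \<and> (\<forall>s\<in>S. b s \<in> W) \<and>
    (\<forall>s\<in>S. \<forall>t\<in>S. b s t = (if s = t then 1 else 0)) \<and> (\<forall>x\<in>W. x = (\<Sum>s\<in>S. sc (x s) (b s)))"
    by (elim exE)
  have Sb: "S \<subseteq> X" "\<And>s. s \<in> S \<Longrightarrow> b s \<in> W"
    "\<And>s t. s \<in> S \<Longrightarrow> t \<in> S \<Longrightarrow> b s t = (if s = t then 1 else 0)"
    "\<And>x. x \<in> W \<Longrightarrow> x = (\<Sum>s\<in>S. sc (x s) (b s))"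
    using Sb0 by blast+
  have aS: "a \<notin> S" using Sb(1) insert.hyps by auto
  have fS: "finite S" using Sb(1) insert.hyps(1) by (rule finite_subset)
  have ba: "b s a = 0" if "s \<in> S" for s
    using Sb(2)[OF that] insert.hyps by (auto simp: W_def galg_def)
  have VW: "y \<in> W" if "y \<in> V" "y a = 0" for y
  proof -
    have "y g = 0" if "g \<notin> X" for g
      using that \<open>y a = 0\<close> subsetD[OF insert.prems(2) \<open>y \<in> V\<close>] by (cases "g = a") (auto simp: galg_def)
    thus ?thesis using that by (simp add: W_def galg_def)
  qed
  show ?case
  proof (cases "\<exists>v\<in>V. v a \<noteq> 0")
    case False
    have "V \<subseteq> W"
      using False VW by blast
    hence "V = W" by (auto simp: W_def)
    thus ?thesis using Sb by (intro exI[of _ S] exI[of _ b] conjI ballI) blast+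
  next
    case True
    then obtain v where v: "v \<in> V" "v a \<noteq> 0" by auto
    define w where "w = sc (1 / v a) v"
    have w: "w \<in> V" "w a = 1" using v subspD(3)[OF insert.prems(1)] by (auto simp: w_def)
    \<comment> \<open>\<open>u\<close> is cleared at the old pivots, and the old basis vectors
      vanish at \<open>a\<close>, so adding \<open>u\<close> with pivot \<open>a\<close> keeps the
      system reduced.\<close>
    define u where "u = w - (\<Sum>s\<in>S. sc (w s) (b s))"
    have bV: "b s \<in> V" if "s \<in> S" for s using Sb(2)[OF that] by (simp add: W_def)
    have u: "u \<in> V"
      unfolding u_def by (intro subspD(4)[OF insert.prems(1)] w subsp_sum[OF insert.prems(1)]
          subspD(3)[OF insert.prems(1)] bV)
    have ua: "u a = 1" using w ba by (simp add: u_def sum_fun_apply)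
    have us: "u t = 0" if "t \<in> S" for t
    proof -
      have "(\<Sum>s\<in>S. w s * b s t) = (\<Sum>s\<in>S. if t = s then w s else 0)"
        using that Sb(3) by (intro sum.cong) auto
      also have "\<dots> = w t" using fS that by simp
      finally show ?thesis by (simp add: u_def sum_fun_apply)
    qed
    show ?thesis
    proof (intro exI[of _ "insert a S"] exI[of _ "b(a := u)"] conjI ballI)
      show "insert a S \<subseteq> insert a X" using Sb(1) by auto
      show "(b(a := u)) s \<in> V" if "s \<in> insert a S" for s
        using that bV u by auto
      show "(b(a := u)) s t = (if s = t then 1 else 0)" if "s \<in> insert a S" "t \<in> insert a S" for s t
        using that aS ua us ba Sb(3) by auto
      fix x assume x: "x \<in> V"
      let ?y = "x - sc (x a) u"
      have "?y \<in> V" by (intro subspD(4,3)[OF insert.prems(1)] x u)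
      moreover have "?y a = 0" using ua by simp
      ultimately have "?y \<in> W" by (rule VW)
      from Sb(4)[OF this] have "?y = (\<Sum>s\<in>S. sc (?y s) (b s))" .
      also have "\<dots> = (\<Sum>s\<in>S. sc (x s) (b s))" using us by (intro sum.cong) auto
      finally have "x = sc (x a) u + (\<Sum>s\<in>S. sc (x s) (b s))" by (simp add: algebra_simps)
      also have "(\<Sum>s\<in>S. sc (x s) (b s)) = (\<Sum>s\<in>S. sc (x s) ((b(a := u)) s))"
        using aS by (intro sum.cong) auto
      finally show "x = (\<Sum>s\<in>insert a S. sc (x s) ((b(a := u)) s))"
        unfolding sum.insert[OF fS aS] fun_upd_same .
    qed
  qed
qed

text \<open>Coordinates are values at the pivots, so both sides expand to the same double sum of
  products of matrix entries.\<close>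

lemma trace_cyclic:
  assumes T: "linmap T1" "linmap T2"
    and V: "\<And>s. s \<in> S \<Longrightarrow> T1 (b s) \<in> V" "\<And>s. s \<in> S \<Longrightarrow> T2 (b s) \<in> V"
    and b: "\<And>x. x \<in> V \<Longrightarrow> x = (\<Sum>s\<in>S. sc (x s) (b s))"
  shows "(\<Sum>s\<in>S. T1 (T2 (b s)) s) = (\<Sum>s\<in>S. T2 (T1 (b s)) s)"
proof -
  have *: "(\<Sum>s\<in>S. F (F' (b s)) s) = (\<Sum>s\<in>S. \<Sum>t\<in>S. F' (b s) t * F (b t) s)"
    if F: "linmap F" and F': "\<And>s. s \<in> S \<Longrightarrow> F' (b s) \<in> V" for F F'
  proof (rule sum.cong[OF refl])
    fix s assume s: "s \<in> S"
    have "F (F' (b s)) = (\<Sum>t\<in>S. sc (F' (b s) t) (F (b t)))"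
      by (subst b[OF F'[OF s]]) (simp add: linmap_sum[OF F] linmap_sc[OF F])
    thus "F (F' (b s)) s = (\<Sum>t\<in>S. F' (b s) t * F (b t) s)"
      by (simp add: sum_fun_apply)
  qed
  have "(\<Sum>s\<in>S. T1 (T2 (b s)) s) = (\<Sum>s\<in>S. \<Sum>t\<in>S. T2 (b s) t * T1 (b t) s)"
    by (rule *) (use T V in auto)
  also have "\<dots> = (\<Sum>t\<in>S. \<Sum>s\<in>S. T1 (b t) s * T2 (b s) t)"
    by (subst sum.swap) (simp add: mult.commute)
  also have "\<dots> = (\<Sum>s\<in>S. T2 (T1 (b s)) s)"
    by (rule *[symmetric]) (use T V in auto)
  finally show ?thesis .
qed

text \<open>The linear functional on the algebra whose values on group elements are given by
  \<open>f\<close>; functionals are thus represented by plain functions.\<close>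

definition pr :: "'g set \<Rightarrow> ('g \<Rightarrow> 'k::field) \<Rightarrow> ('g \<Rightarrow> 'k) \<Rightarrow> 'k" where
  "pr X f a = (\<Sum>g\<in>X. f g * a g)"

lemma pr_add: "pr X f (a + b) = pr X f a + pr X f b"
  by (simp add: pr_def algebra_simps sum.distrib)

lemma pr_diff: "pr X f (a - b) = pr X f a - pr X f b"
  by (simp add: pr_def algebra_simps sum_subtractf)

lemma pr_sc: "pr X f (sc c a) = c * pr X f a"
  by (simp add: pr_def sum_distrib_left algebra_simps)

lemma pr_zero [simp]: "pr X f 0 = 0"
  by (simp add: pr_def)

lemma pr_sum: "pr X f (\<Sum>i\<in>I. a i) = (\<Sum>i\<in>I. pr X f (a i))"
  unfolding pr_def sum_fun_apply sum_distrib_left by (rule sum.swap)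

lemma sum_delta_mult: "finite X \<Longrightarrow> x \<in> X \<Longrightarrow> (\<Sum>a\<in>X. delta x a * f a) = f x"
  by (subst sum.cong[of X X _ "\<lambda>a. if a = x then f a else 0"]) (auto simp: delta_def)

lemma pr_delta: "finite X \<Longrightarrow> g \<in> X \<Longrightarrow> pr X f (delta g) = f g"
  by (simp add: pr_def sum_delta_mult mult.commute[of "f _"])

lemma pr_delta_left: "finite X \<Longrightarrow> g \<in> X \<Longrightarrow> pr X (delta g) a = a g"
  by (simp add: pr_def sum_delta_mult)

text \<open>Serves both the group algebra and its tensor square, the latter as the algebra of the
  product group.\<close>

locale fin_monoid =
  fixes X :: "'g set" and m :: "'g \<Rightarrow> 'g \<Rightarrow> 'g" and e :: 'g
  assumes fin: "finite X"
    and closed: "x \<in> X \<Longrightarrow> y \<in> X \<Longrightarrow> m x y \<in> X"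
    and assoc: "x \<in> X \<Longrightarrow> y \<in> X \<Longrightarrow> z \<in> X \<Longrightarrow> m (m x y) z = m x (m y z)"
    and unit: "e \<in> X" "x \<in> X \<Longrightarrow> m e x = x" "x \<in> X \<Longrightarrow> m x e = x"
begin

lemma conv_apply:
  "conv X m a b g = (\<Sum>x\<in>X. \<Sum>y\<in>X. a x * b y * (if m x y = g then 1 else 0))"
proof -
  have "{(x, y). x \<in> X \<and> y \<in> X \<and> m x y = g} = {p \<in> X \<times> X. m (fst p) (snd p) = g}" by auto
  hence "conv X m a b g = (\<Sum>p\<in>X \<times> X. if m (fst p) (snd p) = g then a (fst p) * b (snd p) else 0)"
    unfolding conv_def using fin by (simp add: sum.inter_filter)
  also have "\<dots> = (\<Sum>(x, y)\<in>X \<times> X. a x * b y * (if m x y = g then 1 else 0))"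
    by (intro sum.cong) auto
  finally show ?thesis by (simp add: sum.cartesian_product)
qed

text \<open>Applied to an indicator function \<open>f\<close> this yields associativity of the
  convolution; for multiplicative \<open>f\<close> it yields \<open>pr_conv\<close>.\<close>

lemma conv_pair: "(\<Sum>g\<in>X. conv X m a b g * f g) = (\<Sum>x\<in>X. \<Sum>y\<in>X. a x * b y * f (m x y))"
proof -
  have "(\<Sum>g\<in>X. conv X m a b g * f g)
      = (\<Sum>x\<in>X. \<Sum>y\<in>X. \<Sum>g\<in>X. a x * b y * (if m x y = g then 1 else 0) * f g)"
    unfolding conv_apply sum_distrib_right
    by (subst sum.swap, rule sum.cong[OF refl], rule sum.swap)
  also have "\<dots> = (\<Sum>x\<in>X. \<Sum>y\<in>X. a x * b y * f (m x y))"
  proof (intro sum.cong refl)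
    fix x y assume "x \<in> X" "y \<in> X"
    thus "(\<Sum>g\<in>X. a x * b y * (if m x y = g then 1 else 0) * f g) = a x * b y * f (m x y)"
      using fin closed by (simp add: if_distrib if_distribR cong: if_cong)
  qed
  finally show ?thesis .
qed

lemma conv_assoc: "conv X m (conv X m a b) c = conv X m a (conv X m b c)"
proof
  fix g
  have "conv X m (conv X m a b) c g
    = (\<Sum>z\<in>X. conv X m a b z * (\<Sum>w\<in>X. c w * (if m z w = g then 1 else 0)))"
    unfolding conv_apply[of "conv X m a b"] by (simp add: sum_distrib_left algebra_simps)
  also have "\<dots> = (\<Sum>x\<in>X. \<Sum>y\<in>X. a x * b y * (\<Sum>w\<in>X. c w * (if m (m x y) w = g then 1 else 0)))"
    by (rule conv_pair)
  also have "\<dots> = (\<Sum>x\<in>X. a x * (\<Sum>y\<in>X. \<Sum>w\<in>X. b y * c w * (if m x (m y w) = g then 1 else 0)))"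
    by (auto simp: sum_distrib_left algebra_simps assoc intro!: sum.cong)
  also have "\<dots> = (\<Sum>x\<in>X. a x * (\<Sum>z\<in>X. conv X m b c z * (if m x z = g then 1 else 0)))"
    by (subst conv_pair) simp
  also have "\<dots> = conv X m a (conv X m b c) g"
    unfolding conv_apply[of a] by (simp add: sum_distrib_left algebra_simps)
  finally show "conv X m (conv X m a b) c g = conv X m a (conv X m b c) g" .
qed

lemma conv_galg [simp, intro]: "conv X m a b \<in> galg X"
  unfolding galg_def conv_apply using closed by (auto intro!: sum.neutral)

lemma linmap_conv_left: "linmap (\<lambda>a. conv X m a b)"
  by (rule linmapI; rule ext)
     (simp_all add: conv_apply sum_distrib_left ring_distribs mult.assoc flip: sum.distrib)

lemma linmap_conv_right: "linmap (conv X m a)"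
  by (rule linmapI; rule ext)
     (simp_all add: conv_apply sum_distrib_left ring_distribs ac_simps flip: sum.distrib)

lemma conv_delta_delta: "x \<in> X \<Longrightarrow> y \<in> X \<Longrightarrow> conv X m (delta x) (delta y) = delta (m x y)"
  by (rule ext) (simp add: conv_apply mult.assoc sum_delta_mult fin flip: sum_distrib_left,
        simp add: delta_def)

lemma conv_unit_left: "a \<in> galg X \<Longrightarrow> conv X m (delta e) a = a"
  by (rule linmap_eqI[OF fin linmap_conv_right, of "\<lambda>x. x"])
     (auto simp: linmap_def conv_delta_delta unit)

lemma conv_unit_right: "a \<in> galg X \<Longrightarrow> conv X m a (delta e) = a"
  by (rule linmap_eqI[OF fin linmap_conv_left, of "\<lambda>x. x"])
     (auto simp: linmap_def conv_delta_delta unit)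

lemma pr_conv:
  assumes "\<And>x y. x \<in> X \<Longrightarrow> y \<in> X \<Longrightarrow> f (m x y) = f x * f y"
  shows "pr X f (conv X m a b) = pr X f a * pr X f b"
proof -
  have "pr X f (conv X m a b) = (\<Sum>x\<in>X. \<Sum>y\<in>X. a x * b y * f (m x y))"
    using conv_pair[of a b f] by (simp add: pr_def mult.commute)
  also have "\<dots> = pr X f a * pr X f b"
    unfolding pr_def sum_product by (intro sum.cong refl) (simp add: assms)
  finally show ?thesis .
qed

text \<open>Uniqueness of two-sided inverses is what the definite description in \<open>ainv\<close>
  requires.\<close>

lemma ainv_eqI:
  assumes "y \<in> galg X" "conv X m y x = delta e" "conv X m x y = delta e"
  shows "ainv X m (delta e) x = y"
  unfolding ainv_def
proof (rule the_equality)
  fix z assume z: "z \<in> galg X \<and> conv X m z x = delta e \<and> conv X m x z = delta e"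
  have "z = conv X m z (conv X m x y)" using z assms by (simp add: conv_unit_right)
  also have "\<dots> = conv X m (conv X m z x) y" by (rule conv_assoc[symmetric])
  also have "\<dots> = y" using z assms by (simp add: conv_unit_left)
  finally show "z = y" .
qed (use assms in auto)

end

section \<open>The group algebra of the symmetric group\<close>

lemma finite_SG [simp]: "finite (SG n)"
  by (simp add: SG_def finite_permutations)

lemma id_SG [simp]: "id \<in> SG n"
  by (simp add: SG_def permutes_id)

lemma comp_SG [simp]: "x \<in> SG n \<Longrightarrow> y \<in> SG n \<Longrightarrow> x \<circ> y \<in> SG n"
  by (simp add: SG_def permutes_compose)

lemma inv_SG [simp]: "x \<in> SG n \<Longrightarrow> inv x \<in> SG n"
  by (simp add: SG_def permutes_inv)

lemma comp_inv_SG [simp]: "x \<in> SG n \<Longrightarrow> x \<circ> inv x = id" "x \<in> SG n \<Longrightarrow> inv x \<circ> x = id"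
  by (auto simp: SG_def permutes_inv_o)

lemma inv_inv_SG [simp]: "x \<in> SG n \<Longrightarrow> inv (inv x) = x"
  by (auto simp: SG_def permutes_inv_inv)

lemma inv_comp_SG: "x \<in> SG n \<Longrightarrow> y \<in> SG n \<Longrightarrow> inv (x \<circ> y) = inv y \<circ> inv x"
  by (auto simp: SG_def permutes_bij o_inv_distrib)

interpretation G: fin_monoid "SG n" "(\<circ>)" id for n
  by unfold_locales (auto simp: comp_assoc)

interpretation GG: fin_monoid "SG n \<times> SG n" pmul "(id, id)" for n
  by unfold_locales (auto simp: pmul_def comp_assoc)

lemmas mulG_assoc = G.conv_assoc[folded mulG_def]
lemmas mulGG_assoc = GG.conv_assoc[folded mulGG_def]

lemma mulG_KG [simp]: "mulG n a b \<in> KG n"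
  by (simp add: mulG_def KG_def)

lemma mulGG_galg [simp]: "mulGG n a b \<in> galg (SG n \<times> SG n)"
  by (simp add: mulGG_def)

lemma delta_KG [simp]: "g \<in> SG n \<Longrightarrow> delta g \<in> KG n"
  by (simp add: KG_def delta_galg)

lemma subsp_KG: "subsp (KG n)"
  unfolding KG_def by (rule subsp_galg)

lemmas linmap_mulG_left = G.linmap_conv_left[folded mulG_def]
lemmas linmap_mulG_right = G.linmap_conv_right[folded mulG_def]
lemmas linmap_mulGG_left = GG.linmap_conv_left[folded mulGG_def]
lemmas linmap_mulGG_right = GG.linmap_conv_right[folded mulGG_def]
lemmas mulG_delta_delta [simp] = G.conv_delta_delta[folded mulG_def]
lemmas mulGG_delta_delta [simp] = GG.conv_delta_delta[folded mulGG_def]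
lemmas mulG_unit_left [simp] = G.conv_unit_left[folded mulG_def KG_def]
lemmas mulG_unit_right [simp] = G.conv_unit_right[folded mulG_def KG_def]
lemmas mulGG_unit_left [simp] = GG.conv_unit_left[folded mulGG_def]
lemmas mulGG_unit_right [simp] = GG.conv_unit_right[folded mulGG_def]

lemmas mulG_sc_left = linmap_sc[OF linmap_mulG_left]
lemmas mulG_sc_right = linmap_sc[OF linmap_mulG_right]
lemmas mulGG_sc_left = linmap_sc[OF linmap_mulGG_left]
lemmas mulGG_sc_right = linmap_sc[OF linmap_mulGG_right]
lemmas mulG_sum_left = linmap_sum[OF linmap_mulG_left]
lemmas mulG_sum_right = linmap_sum[OF linmap_mulG_right]
lemmas mulGG_sum_left = linmap_sum[OF linmap_mulGG_left]
lemmas mulGG_sum_right = linmap_sum[OF linmap_mulGG_right]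

lemma mulG_delta_left:
  assumes "g \<in> SG n" "x \<in> SG n"
  shows "mulG n (delta g) a x = a (inv g \<circ> x)"
proof -
  have "mulG n (delta g) a x = (\<Sum>z\<in>SG n. a z * (if g \<circ> z = x then 1 else 0))"
    unfolding mulG_def G.conv_apply
    by (simp add: mult.assoc sum_delta_mult assms flip: sum_distrib_left)
  also have "\<dots> = (\<Sum>z\<in>SG n. if z = inv g \<circ> x then a z else 0)"
  proof (intro sum.cong refl)
    fix z assume "z \<in> SG n"
    have "g \<circ> z = x \<longleftrightarrow> z = inv g \<circ> x"
      using assms by (metis comp_inv_SG comp_assoc id_comp)
    thus "a z * (if g \<circ> z = x then 1 else 0) = (if z = inv g \<circ> x then a z else 0)" by simp
  qed
  also have "\<dots> = a (inv g \<circ> x)" using assms by simp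
  finally show ?thesis .
qed

lemma mulG_delta_right:
  assumes "g \<in> SG n" "x \<in> SG n"
  shows "mulG n a (delta g) x = a (x \<circ> inv g)"
proof -
  have "mulG n a (delta g) x = (\<Sum>z\<in>SG n. a z * (if z \<circ> g = x then 1 else 0))"
    unfolding mulG_def G.conv_apply
    by (simp add: mult.left_commute[of _ "delta g _"] mult.assoc sum_delta_mult assms flip: sum_distrib_left)
  also have "\<dots> = (\<Sum>z\<in>SG n. if z = x \<circ> inv g then a z else 0)"
  proof (intro sum.cong refl)
    fix z assume "z \<in> SG n"
    have "z \<circ> g = x \<longleftrightarrow> z = x \<circ> inv g"
      using assms by (metis comp_inv_SG comp_assoc comp_id)
    thus "a z * (if z \<circ> g = x then 1 else 0) = (if z = x \<circ> inv g then a z else 0)" by simp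
  qed
  also have "\<dots> = a (x \<circ> inv g)" using assms by simp
  finally show ?thesis .
qed

section \<open>Linear extension, and identities checked on group elements\<close>

definition lext :: "'g set \<Rightarrow> ('g \<Rightarrow> 'h \<Rightarrow> 'k::field) \<Rightarrow> ('g \<Rightarrow> 'k) \<Rightarrow> 'h \<Rightarrow> 'k" where
  "lext X f a = (\<Sum>g\<in>X. sc (a g) (f g))"

lemma linmap_lext: "linmap (lext X f)"
  by (rule linmapI; rule ext)
     (simp_all add: lext_def sum_fun_apply ring_distribs sum.distrib sum_distrib_left mult.assoc)

lemma lext_delta: "finite X \<Longrightarrow> x \<in> X \<Longrightarrow> lext X f (delta x) = f x"
  by (rule ext) (simp add: lext_def sum_fun_apply sum_delta_mult)

lemma delta_pair: "delta (g, h) = tens (delta g) (delta h)"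
  by (rule ext) (auto simp: delta_def tens_def)

lemma linmap_tens_left: "linmap (\<lambda>a. tens a b)"
  by (rule linmapI; rule ext) (simp_all add: tens_def algebra_simps)

lemma linmap_tens_right: "linmap (tens a)"
  by (rule linmapI; rule ext) (simp_all add: tens_def algebra_simps)

lemma tens_galg [simp]: "a \<in> KG n \<Longrightarrow> b \<in> KG n \<Longrightarrow> tens a b \<in> galg (SG n \<times> SG n)"
  by (auto simp: KG_def galg_def tens_def)

text \<open>Reduces the Hopf-algebraic identities below to group elements, where they are identities
  between permutations.\<close>

lemma bilin_eqI:
  assumes F: "\<And>b. linmap (\<lambda>a. F a b)" "\<And>a. linmap (F a)"
    and F': "\<And>b. linmap (\<lambda>a. F' a b)" "\<And>a. linmap (F' a)"
    and X: "finite X" "finite Y" "a \<in> galg X" "b \<in> galg Y"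
    and eq: "\<And>g h. g \<in> X \<Longrightarrow> h \<in> Y \<Longrightarrow> F (delta g) (delta h) = F' (delta g) (delta h)"
  shows "F a b = F' a b"
proof (rule linmap_eqI[OF X(1) F(1) F'(1) _ X(3)])
  fix g assume "g \<in> X"
  thus "F (delta g) b = F' (delta g) b"
    by (intro linmap_eqI[OF X(2) F(2) F'(2) _ X(4)] eq)
qed

lemma tens_eqI:
  assumes F: "linmap F"
    and F': "\<And>b. linmap (\<lambda>a. F' a b)" "\<And>a. linmap (F' a)"
    and X: "a \<in> KG n" "b \<in> KG n"
    and eq: "\<And>g h. g \<in> SG n \<Longrightarrow> h \<in> SG n \<Longrightarrow> F (delta (g, h)) = F' (delta g) (delta h)"
  shows "F (tens a b) = F' a b"
  by (rule bilin_eqI[of "\<lambda>a b. F (tens a b)" F' "SG n" "SG n"])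
     (use X[unfolded KG_def] eq in \<open>auto simp: delta_pair
        intro!: F' linmap_comp[OF F linmap_tens_left] linmap_comp[OF F linmap_tens_right]\<close>)

lemma mulGG_tens:
  assumes "a \<in> KG n" "b \<in> KG n" "c \<in> KG n" "d \<in> KG n"
  shows "mulGG n (tens a b) (tens c d) = tens (mulG n a c) (mulG n b d)"
proof (rule tens_eqI[OF _ _ _ assms(1,2)])
  fix g h assume gh: "g \<in> SG n" "h \<in> SG n"
  show "mulGG n (delta (g, h)) (tens c d) = tens (mulG n (delta g) c) (mulG n (delta h) d)"
    by (rule tens_eqI[OF _ _ _ assms(3,4)])
       (use gh in \<open>auto simp: pmul_def delta_pair[symmetric] intro!: linmap_mulGG_right
         linmap_comp[OF linmap_tens_left linmap_mulG_right]
         linmap_comp[OF linmap_tens_right linmap_mulG_right]\<close>)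
qed (intro linmap_mulGG_left linmap_comp[OF linmap_tens_left linmap_mulG_left]
         linmap_comp[OF linmap_tens_right linmap_mulG_left])+

section \<open>The untwisted Hopf structure\<close>

lemma linmap_comultG: "linmap (comultG n)"
  by (rule linmapI; rule ext) (auto simp: comultG_def)

lemma comultG_delta [simp]: "g \<in> SG n \<Longrightarrow> comultG n (delta g) = tens (delta g) (delta g)"
  by (rule ext) (auto simp: comultG_def tens_def delta_def)

lemma comultG_galg [simp]: "comultG n a \<in> galg (SG n \<times> SG n)"
  by (auto simp: comultG_def galg_def)

lemma comultG_mulG:
  assumes "a \<in> KG n" "b \<in> KG n"
  shows "comultG n (mulG n a b) = mulGG n (comultG n a) (comultG n b)"
  by (rule bilin_eqI[of "\<lambda>a b. comultG n (mulG n a b)" "\<lambda>a b. mulGG n (comultG n a) (comultG n b)" "SG n" "SG n"])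
     (use assms[unfolded KG_def] in \<open>auto simp: mulGG_tens intro!: linmap_comp[OF linmap_comultG linmap_mulG_left]
      linmap_comp[OF linmap_comultG linmap_mulG_right] linmap_comp[OF linmap_mulGG_left linmap_comultG]
      linmap_comp[OF linmap_mulGG_right linmap_comultG]\<close>)

lemma linmap_antipG: "linmap (antipG n)"
  by (rule linmapI; rule ext) (simp_all add: antipG_def)

lemma antipG_KG [simp]: "antipG n a \<in> KG n"
  by (simp add: KG_def galg_def antipG_def)

lemma antipG_delta [simp]:
  assumes "g \<in> SG n"
  shows "antipG n (delta g) = delta (inv g)"
  using assms inv_inv_SG by (fastforce simp: antipG_def delta_def)

lemma linmap_mSid: "linmap (mSid n)"
  by (rule linmapI; rule ext) (simp_all add: mSid_def sum.distrib sum_distrib_left)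

lemma mSid_delta:
  assumes "g \<in> SG n" "h \<in> SG n"
  shows "mSid n (delta (g, h)) = delta (inv g \<circ> h)"
proof
  fix x
  have fin: "finite {(g, h). g \<in> SG n \<and> h \<in> SG n \<and> inv g \<circ> h = x}"
    by (rule finite_subset[of _ "SG n \<times> SG n"]) auto
  show "mSid n (delta (g, h)) x = delta (inv g \<circ> h) x"
    unfolding mSid_def delta_def sum.delta'[OF fin] sum.delta[OF fin] using assms by auto
qed

lemma mSid_tens:
  assumes "a \<in> KG n" "b \<in> KG n"
  shows "mSid n (tens a b) = mulG n (antipG n a) b"
  by (rule tens_eqI[OF linmap_mSid _ _ assms])
     (auto simp: mSid_delta intro!: linmap_mulG_right linmap_comp[OF linmap_mulG_left linmap_antipG])

text \<open>The slice maps \<open>id \<otimes> f\<close> and \<open>f \<otimes> id\<close>.\<close>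

definition slr :: "nat \<Rightarrow> (perm \<Rightarrow> 'k::field) \<Rightarrow> (perm \<times> perm \<Rightarrow> 'k) \<Rightarrow> perm \<Rightarrow> 'k" where
  "slr n f T = (\<lambda>p. \<Sum>q\<in>SG n. f q * T (p, q))"

definition sll :: "nat \<Rightarrow> (perm \<Rightarrow> 'k::field) \<Rightarrow> (perm \<times> perm \<Rightarrow> 'k) \<Rightarrow> perm \<Rightarrow> 'k" where
  "sll n f T = (\<lambda>q. \<Sum>p\<in>SG n. f p * T (p, q))"

lemma linmap_slr: "linmap (slr n f)"
  by (rule linmapI; rule ext) (simp_all add: slr_def ring_distribs sum.distrib sum_distrib_left mult.left_commute)

lemma linmap_sll: "linmap (sll n f)"
  by (rule linmapI; rule ext) (simp_all add: sll_def ring_distribs sum.distrib sum_distrib_left mult.left_commute)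

lemma slr_tens: "slr n f (tens a b) = sc (pr (SG n) f b) a"
  by (rule ext) (simp add: slr_def pr_def sum_distrib_right mult.assoc mult.commute[of "a _"])

lemma sll_tens: "sll n f (tens a b) = sc (pr (SG n) f a) b"
  by (rule ext) (simp add: sll_def pr_def sum_distrib_right mult.assoc)

lemma slr_KG [simp]: "T \<in> galg (SG n \<times> SG n) \<Longrightarrow> slr n f T \<in> KG n"
  by (auto simp: KG_def galg_def slr_def)

lemma sll_KG [simp]: "T \<in> galg (SG n \<times> SG n) \<Longrightarrow> sll n f T \<in> KG n"
  by (auto simp: KG_def galg_def sll_def)

text \<open>Since \<Delta>(g) = g \<otimes> g, slicing is a pointwise product. Through this the
  coideal property of an ideal becomes stability under multiplication by functions.\<close>

lemma slr_comultG: "a \<in> KG n \<Longrightarrow> slr n f (comultG n a) = (\<lambda>g. f g * a g)"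
proof
  fix p assume a: "a \<in> KG n"
  have "slr n f (comultG n a) p = (\<Sum>q\<in>SG n. if q = p then f q * a q else 0)"
    unfolding slr_def comultG_def by (intro sum.cong refl) auto
  also have "\<dots> = f p * a p" using a by (auto simp: KG_def galg_def)
  finally show "slr n f (comultG n a) p = f p * a p" .
qed

lemma sll_comultG: "a \<in> KG n \<Longrightarrow> sll n f (comultG n a) = (\<lambda>g. f g * a g)"
proof
  fix q assume a: "a \<in> KG n"
  have "sll n f (comultG n a) q = (\<Sum>p\<in>SG n. if p = q then f p * a p else 0)"
    unfolding sll_def comultG_def by (intro sum.cong refl) auto
  also have "\<dots> = f q * a q" using a by (auto simp: KG_def galg_def)
  finally show "sll n f (comultG n a) q = f q * a q" .
qed

text \<open>A multiplicative \<open>f\<close> extends to an algebra map, and so does id \<otimes>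
  f.\<close>

lemma slr_mulGG:
  assumes f: "\<And>x y. x \<in> SG n \<Longrightarrow> y \<in> SG n \<Longrightarrow> f (x \<circ> y) = f x * f y"
    and "S \<in> galg (SG n \<times> SG n)" "T \<in> galg (SG n \<times> SG n)"
  shows "slr n f (mulGG n S T) = mulG n (slr n f S) (slr n f T)"
  by (rule bilin_eqI[of "\<lambda>S T. slr n f (mulGG n S T)" "\<lambda>S T. mulG n (slr n f S) (slr n f T)"
      "SG n \<times> SG n" "SG n \<times> SG n"])
     (use assms in \<open>auto simp: pmul_def delta_pair slr_tens pr_delta mulG_sc_left mulG_sc_right mult.commute
      intro!: linmap_comp[OF linmap_slr linmap_mulGG_left]
      linmap_comp[OF linmap_slr linmap_mulGG_right] linmap_comp[OF linmap_mulG_left linmap_slr]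
      linmap_comp[OF linmap_mulG_right linmap_slr]\<close>)

lemma sll_mulGG:
  assumes f: "\<And>x y. x \<in> SG n \<Longrightarrow> y \<in> SG n \<Longrightarrow> f (x \<circ> y) = f x * f y"
    and "S \<in> galg (SG n \<times> SG n)" "T \<in> galg (SG n \<times> SG n)"
  shows "sll n f (mulGG n S T) = mulG n (sll n f S) (sll n f T)"
  by (rule bilin_eqI[of "\<lambda>S T. sll n f (mulGG n S T)" "\<lambda>S T. mulG n (sll n f S) (sll n f T)"
      "SG n \<times> SG n" "SG n \<times> SG n"])
     (use assms in \<open>auto simp: pmul_def delta_pair sll_tens pr_delta mulG_sc_left mulG_sc_right mult.commute
      intro!: linmap_comp[OF linmap_sll linmap_mulGG_left]
      linmap_comp[OF linmap_sll linmap_mulGG_right] linmap_comp[OF linmap_mulG_left linmap_sll]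
      linmap_comp[OF linmap_mulG_right linmap_sll]\<close>)

lemma slr_mulGG_tens_right:
  assumes "T \<in> galg (SG n \<times> SG n)" "a \<in> KG n"
  shows "slr n f (mulGG n T (tens a (delta id))) = mulG n (slr n f T) a"
proof (rule linmap_eqI[OF _ _ _ _ assms(1)])
  fix g assume "g \<in> SG n \<times> SG n"
  thus "slr n f (mulGG n (delta g) (tens a (delta id))) = mulG n (slr n f (delta g)) a"
    using assms(2) by (cases g) (simp add: delta_pair mulGG_tens slr_tens mulG_sc_left)
qed (auto intro!: linmap_comp[OF linmap_slr linmap_mulGG_left] linmap_comp[OF linmap_mulG_left linmap_slr])

lemma sll_mulGG_tens_right:
  assumes "T \<in> galg (SG n \<times> SG n)" "a \<in> KG n"
  shows "sll n f (mulGG n T (tens (delta id) a)) = mulG n (sll n f T) a"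
proof (rule linmap_eqI[OF _ _ _ _ assms(1)])
  fix g assume "g \<in> SG n \<times> SG n"
  thus "sll n f (mulGG n (delta g) (tens (delta id) a)) = mulG n (sll n f (delta g)) a"
    using assms(2) by (cases g) (simp add: delta_pair mulGG_tens sll_tens mulG_sc_left)
qed (auto intro!: linmap_comp[OF linmap_sll linmap_mulGG_left] linmap_comp[OF linmap_mulG_left linmap_sll])

text \<open>Three actions of the tensor square; on \<open>a \<otimes> b\<close> they are \<open>y \<mapsto> a y S(b)\<close>,
  \<open>M \<mapsto> \<Delta>(a) M (1 \<otimes> S(b))\<close>, and the right action \<open>y \<mapsto> S(b) y a\<close>.\<close>

definition act :: "nat \<Rightarrow> (perm \<times> perm \<Rightarrow> 'k::field) \<Rightarrow> (perm \<Rightarrow> 'k) \<Rightarrow> perm \<Rightarrow> 'k" where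
  "act n T y = lext (SG n \<times> SG n) (\<lambda>p. mulG n (mulG n (delta (fst p)) y) (delta (inv (snd p)))) T"

definition act2 :: "nat \<Rightarrow> (perm \<times> perm \<Rightarrow> 'k::field) \<Rightarrow> (perm \<times> perm \<Rightarrow> 'k) \<Rightarrow> perm \<times> perm \<Rightarrow> 'k" where
  "act2 n T M = lext (SG n \<times> SG n) (\<lambda>p. mulGG n (mulGG n (tens (delta (fst p)) (delta (fst p))) M)
      (tens (delta id) (delta (inv (snd p))))) T"

definition ract :: "nat \<Rightarrow> (perm \<times> perm \<Rightarrow> 'k::field) \<Rightarrow> (perm \<Rightarrow> 'k) \<Rightarrow> perm \<Rightarrow> 'k" where
  "ract n T y = lext (SG n \<times> SG n) (\<lambda>p. mulG n (mulG n (delta (inv (snd p))) y) (delta (fst p))) T"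

lemma linmap_lextD:
  assumes "\<And>p. linmap (\<lambda>y. f p y)"
  shows "linmap (\<lambda>y. lext X (\<lambda>p. f p y) T)"
proof (rule linmapI; rule ext)
  fix x y c z
  show "lext X (\<lambda>p. f p (x + y)) T z = (lext X (\<lambda>p. f p x) T + lext X (\<lambda>p. f p y) T) z"
    by (simp add: lext_def linmap_add[OF assms] sum_fun_apply ring_distribs sum.distrib)
  show "lext X (\<lambda>p. f p (sc c x)) T z = sc c (lext X (\<lambda>p. f p x) T) z"
    by (simp add: lext_def linmap_sc[OF assms] sum_fun_apply sum_distrib_left ac_simps)
qed

lemma linmap_act: "linmap (\<lambda>T. act n T y)" "linmap (act n T)"
  unfolding act_def
  by (rule linmap_lext, intro linmap_lextD linmap_comp[OF linmap_mulG_left linmap_mulG_right])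

lemma linmap_act2: "linmap (\<lambda>T. act2 n T M)" "linmap (act2 n T)"
  unfolding act2_def
  by (rule linmap_lext, intro linmap_lextD linmap_comp[OF linmap_mulGG_left linmap_mulGG_right])

lemma linmap_ract: "linmap (\<lambda>T. ract n T y)" "linmap (ract n T)"
  unfolding ract_def
  by (rule linmap_lext, intro linmap_lextD linmap_comp[OF linmap_mulG_left linmap_mulG_right])

lemma act_tens:
  assumes "a \<in> KG n" "b \<in> KG n"
  shows "act n (tens a b) y = mulG n (mulG n a y) (antipG n b)"
  by (rule tens_eqI[of "\<lambda>T. act n T y" "\<lambda>a b. mulG n (mulG n a y) (antipG n b)"])
     (use assms in \<open>auto simp: act_def lext_delta intro!: linmap_act[unfolded act_def] linmap_lext
      linmap_comp[OF linmap_mulG_left linmap_mulG_left] linmap_comp[OF linmap_mulG_right linmap_antipG]\<close>)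

lemma ract_tens:
  assumes "a \<in> KG n" "b \<in> KG n"
  shows "ract n (tens a b) y = mulG n (mulG n (antipG n b) y) a"
  by (rule tens_eqI[of "\<lambda>T. ract n T y" "\<lambda>a b. mulG n (mulG n (antipG n b) y) a"])
     (use assms in \<open>auto simp: ract_def lext_delta intro!: linmap_lext linmap_mulG_right
      linmap_comp[OF linmap_mulG_left linmap_comp[OF linmap_mulG_left linmap_antipG]]\<close>)

lemma act2_tens:
  assumes "a \<in> KG n" "b \<in> KG n"
  shows "act2 n (tens a b) M = mulGG n (mulGG n (comultG n a) M) (tens (delta id) (antipG n b))"
  by (rule tens_eqI[of "\<lambda>T. act2 n T M" "\<lambda>a b. mulGG n (mulGG n (comultG n a) M) (tens (delta id) (antipG n b))"])
     (use assms in \<open>auto simp: act2_def lext_delta intro!: linmap_lext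
      linmap_comp[OF linmap_mulGG_left linmap_comp[OF linmap_mulGG_left linmap_comultG]]
      linmap_comp[OF linmap_mulGG_right linmap_comp[OF linmap_tens_right linmap_antipG]]\<close>)

text \<open>An action because S reverses products. Hence \<Delta>^J(g) = J^-1 (g \<otimes> g) J can
  be applied one factor at a time; the same holds for \<open>act2\<close> and, in the opposite
  order, for \<open>ract\<close>.\<close>

lemma act_mulGG:
  assumes "S \<in> galg (SG n \<times> SG n)" "T \<in> galg (SG n \<times> SG n)"
  shows "act n (mulGG n S T) y = act n S (act n T y)"
  by (rule bilin_eqI[of "\<lambda>S T. act n (mulGG n S T) y" "\<lambda>S T. act n S (act n T y)"
      "SG n \<times> SG n" "SG n \<times> SG n"])
     (use assms in \<open>auto simp: pmul_def act_def[of _ "delta _"] lext_delta inv_comp_SG mulG_assoc mulG_delta_delta[where n = n, symmetric]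
      simp del: mulG_delta_delta
      intro!: linmap_comp[OF linmap_act(1) linmap_mulGG_left]
      linmap_comp[OF linmap_act(1) linmap_mulGG_right] linmap_act linmap_comp[OF linmap_act(2) linmap_act(1)]\<close>)

lemma ract_mulGG:
  assumes "S \<in> galg (SG n \<times> SG n)" "T \<in> galg (SG n \<times> SG n)"
  shows "ract n (mulGG n S T) y = ract n T (ract n S y)"
  by (rule bilin_eqI[of "\<lambda>S T. ract n (mulGG n S T) y" "\<lambda>S T. ract n T (ract n S y)"
      "SG n \<times> SG n" "SG n \<times> SG n"])
     (use assms in \<open>auto simp: pmul_def ract_def[of _ "delta _"] lext_delta inv_comp_SG mulG_assoc mulG_delta_delta[where n = n, symmetric]
      simp del: mulG_delta_delta
      intro!: linmap_comp[OF linmap_ract(1) linmap_mulGG_left]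
      linmap_comp[OF linmap_ract(1) linmap_mulGG_right] linmap_ract linmap_comp[OF linmap_ract(2) linmap_ract(1)]\<close>)

lemma act2_mulGG:
  fixes S :: "perm \<times> perm \<Rightarrow> 'k::field"
  assumes "S \<in> galg (SG n \<times> SG n)" "T \<in> galg (SG n \<times> SG n)"
  shows "act2 n (mulGG n S T) M = act2 n S (act2 n T M)"
proof (rule bilin_eqI[of "\<lambda>S T. act2 n (mulGG n S T) M" "\<lambda>S T. act2 n S (act2 n T M)"
      "SG n \<times> SG n" "SG n \<times> SG n"])
  fix p q assume pq: "p \<in> SG n \<times> SG n" "q \<in> SG n \<times> SG n"
  have 1: "tens (delta (fst p \<circ> fst q) :: perm \<Rightarrow> 'k) (delta (fst p \<circ> fst q)) =
      mulGG n (tens (delta (fst p)) (delta (fst p))) (tens (delta (fst q)) (delta (fst q)))"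
    using pq by (auto simp: mulGG_tens)
  have 2: "tens (delta id :: perm \<Rightarrow> 'k) (delta (inv (snd p \<circ> snd q))) =
      mulGG n (tens (delta id) (delta (inv (snd q)))) (tens (delta id) (delta (inv (snd p))))"
    using pq by (auto simp: mulGG_tens inv_comp_SG)
  show "act2 n (mulGG n (delta p) (delta q)) M = act2 n (delta p) (act2 n (delta q) M)"
    using pq 1 2 by (simp add: act2_def lext_delta pmul_def mulGG_assoc mem_Times_iff)
qed (use assms in \<open>auto intro!: linmap_comp[OF linmap_act2(1) linmap_mulGG_left]
      linmap_comp[OF linmap_act2(1) linmap_mulGG_right] linmap_act2 linmap_comp[OF linmap_act2(2) linmap_act2(1)]\<close>)

section \<open>The Fourier basis of the group algebra of H\<close>

definition t12 :: perm where "t12 = transpose 1 2"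
definition t34 :: perm where "t34 = transpose 3 4"

lemma HH_eq: "HH = {id, t12, t34, t12 \<circ> t34}"
  by (simp add: HH_def t12_def t34_def)

lemma t12_t34_comp:
  "t12 \<circ> t12 = id" "t34 \<circ> t34 = id" "t34 \<circ> t12 = t12 \<circ> t34"
  "t12 \<circ> (t12 \<circ> z) = z" "t34 \<circ> (t34 \<circ> z) = z" "t34 \<circ> (t12 \<circ> z) = t12 \<circ> (t34 \<circ> z)"
  by (auto simp: fun_eq_iff transpose_def t12_def t34_def)

lemma HH_comp: "x \<in> HH \<Longrightarrow> y \<in> HH \<Longrightarrow> x \<circ> y \<in> HH"
  unfolding HH_eq by (elim insertE emptyE) (simp_all add: t12_t34_comp comp_assoc)

lemma HH_self_inverse: "x \<in> HH \<Longrightarrow> x \<circ> x = id"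
  unfolding HH_eq by (elim insertE emptyE) (simp_all add: t12_t34_comp comp_assoc)

lemma HH_inv: "x \<in> HH \<Longrightarrow> inv x = x"
  by (rule inv_unique_comp) (simp_all add: HH_self_inverse)

lemma HH_mem [simp]: "id \<in> HH" "t12 \<in> HH" "t34 \<in> HH"
  by (simp_all add: HH_eq)

lemma HH_fixes: "x \<in> HH \<Longrightarrow> k \<notin> {1, 2, 3, 4} \<Longrightarrow> x k = k"
  by (auto simp: HH_def transpose_def)

lemma HH_SG: "n \<ge> 4 \<Longrightarrow> x \<in> HH \<Longrightarrow> x \<in> SG n"
proof -
  assume n: "n \<ge> 4" and "x \<in> HH"
  have "t12 \<in> SG n" "t34 \<in> SG n"
    using n by (auto simp: SG_def t12_def t34_def intro!: permutes_swap_id)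
  with \<open>x \<in> HH\<close> show ?thesis by (auto simp: HH_eq)
qed

lemma HH_distinct [simp]:
  "t12 \<noteq> id" "t34 \<noteq> id" "t12 \<noteq> t34" "t12 \<circ> t34 \<noteq> id" "t12 \<circ> t34 \<noteq> t12" "t12 \<circ> t34 \<noteq> t34"
proof -
  have v: "t12 1 = 2" "t12 3 = 3" "t34 1 = 1" "t34 3 = 4" "(t12 \<circ> t34) 1 = 2" "(t12 \<circ> t34) 3 = 4"
    by (auto simp: t12_def t34_def transpose_def)
  have "p \<noteq> q" if "p 1 \<noteq> q 1 \<or> p 3 \<noteq> q 3" for p q :: perm
    using that by auto
  thus "t12 \<noteq> id" "t34 \<noteq> id" "t12 \<noteq> t34" "t12 \<circ> t34 \<noteq> id" "t12 \<circ> t34 \<noteq> t12" "t12 \<circ> t34 \<noteq> t34"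
    using v by auto
qed

lemmas HH_distinct' [simp] = HH_distinct[symmetric]

lemma finite_HH [simp]: "finite HH"
  by (simp add: HH_def)

lemma sum_HH:
  "(\<Sum>h\<in>HH. f h) = f id + f (t12) + f (t34) + f (t12 \<circ> t34)"
  by (simp add: HH_eq add.assoc)

lemma card_HH [simp]: "card HH = 4"
  by (simp add: HH_eq)

lemma charsD:
  assumes "\<alpha> \<in> chars HH"
  shows "x \<in> HH \<Longrightarrow> y \<in> HH \<Longrightarrow> \<alpha> (x \<circ> y) = \<alpha> x * \<alpha> y" "x \<in> HH \<Longrightarrow> \<alpha> x \<noteq> 0" "x \<notin> HH \<Longrightarrow> \<alpha> x = 0"
  using assms by (auto simp: chars_def)

lemma char_id: "\<alpha> \<in> chars HH \<Longrightarrow> \<alpha> id = 1"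
  using charsD(1)[of \<alpha> id id] charsD(2)[of \<alpha> id] by simp

lemma char_square: "\<alpha> \<in> chars HH \<Longrightarrow> x \<in> HH \<Longrightarrow> \<alpha> x * \<alpha> x = 1"
  using charsD(1)[of \<alpha> x x] by (simp add: HH_self_inverse char_id)

lemma char_values: "\<alpha> \<in> chars HH \<Longrightarrow> x \<in> HH \<Longrightarrow> \<alpha> x = 1 \<or> \<alpha> x = - 1"
  using char_square[of \<alpha> x] by (simp add: square_eq_1_iff)

text \<open>Characters are indexed by their signs at the two generators; the value 0 off
  \<open>HH\<close> matches the convention in \<open>chars\<close>.\<close>

definition chv :: "'k \<Rightarrow> 'k \<Rightarrow> perm \<Rightarrow> 'k::field" where
  "chv a b = (\<lambda>h. if h = id then 1 else if h = t12 then a else if h = t34 then b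
     else if h = t12 \<circ> t34 then a * b else 0)"

lemma chv_simps [simp]:
  "chv a b id = 1" "chv a b (t12) = a" "chv a b (t34) = b"
  "chv a b (t12 \<circ> t34) = a * b"
  "x \<notin> HH \<Longrightarrow> chv a b x = 0"
  by (auto simp: chv_def HH_eq)

lemma chv_eq_iff: "chv a b = chv c d \<longleftrightarrow> a = c \<and> b = d"
  by (metis chv_simps(2,3))

lemma char_eq_chv:
  assumes "\<alpha> \<in> chars HH"
  shows "\<alpha> = chv (\<alpha> (t12)) (\<alpha> (t34))"
proof
  fix x
  show "\<alpha> x = chv (\<alpha> (t12)) (\<alpha> (t34)) x"
  proof (cases "x \<in> HH")
    case True
    then consider "x = id" | "x = t12" | "x = t34"
      | "x = t12 \<circ> t34" by (auto simp: HH_eq)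
    thus ?thesis
      by cases (simp_all add: char_id[OF assms] charsD(1)[OF assms])
  qed (simp add: charsD(3)[OF assms])
qed

lemma chv_chars:
  fixes a b :: "'k::field"
  assumes "a * a = 1" "b * b = 1"
  shows "chv a b \<in> chars HH"
proof -
  have e: "a \<noteq> 0" "b \<noteq> 0" using assms by auto
  have e': "a * (a * z) = z" "b * (b * z) = z" for z using assms by (simp_all flip: mult.assoc)
  have "chv a b (x \<circ> y) = chv a b x * chv a b y" if "x \<in> HH" "y \<in> HH" for x y
    using that unfolding HH_eq
    by (elim insertE emptyE; hypsubst)
       (simp_all add: t12_t34_comp comp_assoc assms e' ac_simps)
  moreover have "chv a b x \<noteq> 0" if "x \<in> HH" for x
    using that unfolding HH_eq by (elim insertE emptyE; hypsubst) (simp_all add: e)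
  ultimately show ?thesis unfolding chars_def by auto
qed

lemma chars_eq: "chars HH = {chv 1 1, chv 1 (-1), chv (-1) 1, chv (-1) (-1 :: 'k::field)}"
proof
  show "chars HH \<subseteq> {chv 1 1, chv 1 (-1), chv (-1) 1, chv (-1) (-1 :: 'k)}"
  proof
    fix \<alpha> :: "perm \<Rightarrow> 'k" assume a: "\<alpha> \<in> chars HH"
    from char_values[OF a HH_mem(2)] char_values[OF a HH_mem(3)]
    show "\<alpha> \<in> {chv 1 1, chv 1 (-1), chv (-1) 1, chv (-1) (-1)}"
      by (subst char_eq_chv[OF a]) auto
  qed
qed (auto intro: chv_chars)

lemma finite_chars [simp]: "finite (chars HH)"
  by (simp add: chars_eq)

lemma sum_chars:
  fixes f :: "(perm \<Rightarrow> 'k::field_char_0) \<Rightarrow> 'b::comm_monoid_add"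
  shows "(\<Sum>\<alpha>\<in>chars HH. f \<alpha>) = f (chv 1 1) + f (chv 1 (-1)) + f (chv (-1) 1) + f (chv (-1) (-1))"
  unfolding chars_eq by (simp add: chv_eq_iff add.assoc)

lemma chmul_chv: "chmul (chv a b) (chv c d) = chv (a * c) (b * d)"
  by (rule ext) (simp add: chmul_def chv_def)

lemma chmul_chars [simp]: "\<alpha> \<in> chars HH \<Longrightarrow> \<beta> \<in> chars HH \<Longrightarrow> chmul \<alpha> \<beta> \<in> chars HH"
  by (simp add: chars_def chmul_def)

lemma chmul_self: "\<alpha> \<in> chars HH \<Longrightarrow> chmul \<alpha> \<alpha> = chv 1 1"
  unfolding chars_eq by (auto simp: chmul_chv)

lemma one_chars [simp]: "chv 1 1 \<in> chars HH"
  by (simp add: chars_eq)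

lemma chmul_one [simp]: "\<alpha> \<in> chars HH \<Longrightarrow> chmul \<alpha> (chv 1 1) = \<alpha>" "\<alpha> \<in> chars HH \<Longrightarrow> chmul (chv 1 1) \<alpha> = \<alpha>"
  unfolding chars_eq by (auto simp: chmul_chv)

lemma chars_orth:
  fixes \<alpha> :: "perm \<Rightarrow> 'k::field_char_0"
  assumes "\<alpha> \<in> chars HH" "\<beta> \<in> chars HH"
  shows "(\<Sum>h\<in>HH. \<alpha> h * \<beta> h) = (if \<alpha> = \<beta> then 4 else 0)"
  using assms unfolding chars_eq sum_HH
  by (elim insertE emptyE; hypsubst) (simp_all add: chv_eq_iff)

lemma chars_complete:
  assumes "h \<in> HH"
  shows "(\<Sum>\<alpha>\<in>chars HH. \<alpha> h) = (if h = id then 4 else 0 :: 'k::field_char_0)"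
  using assms unfolding sum_chars
  by (subst (asm) HH_eq, elim insertE emptyE; hypsubst) simp_all

section \<open>The idempotents attached to the characters\<close>

lemma idem_expand:
  fixes \<alpha> :: "perm \<Rightarrow> 'k::field_char_0"
  assumes "\<alpha> \<in> chars HH"
  shows "idem HH \<alpha> = (\<Sum>h\<in>HH. sc (\<alpha> h / 4) (delta h))"
proof -
  have "idem HH \<alpha> \<in> galg HH" by (simp add: idem_def galg_def)
  from galg_expand[OF _ this] show ?thesis
    by (simp add: idem_def HH_inv)
qed

lemma idem_KG: "n \<ge> 4 \<Longrightarrow> idem HH \<alpha> \<in> KG n"
  using HH_SG by (auto simp: idem_def KG_def galg_def)

lemma delta_idem:
  fixes \<alpha> :: "perm \<Rightarrow> 'k::field_char_0"
  assumes n: "n \<ge> 4" and a: "\<alpha> \<in> chars HH" and h: "h \<in> HH"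
  shows "mulG n (delta h) (idem HH \<alpha>) = sc (\<alpha> h) (idem HH \<alpha>)"
proof -
  have hh: "h \<circ> (h \<circ> k) = k" for k
    using HH_self_inverse[OF h] by (metis comp_assoc id_comp)
  have "mulG n (delta h) (idem HH \<alpha>) = (\<Sum>k\<in>HH. sc (\<alpha> k / 4) (delta (h \<circ> k)))"
    unfolding idem_expand[OF a] mulG_sum_right mulG_sc_right
    using HH_SG[OF n] h by (intro sum.cong refl) simp
  also have "\<dots> = (\<Sum>k\<in>HH. sc (\<alpha> (h \<circ> k) / 4) (delta k))"
    by (rule sum.reindex_bij_witness[of _ "(\<circ>) h" "(\<circ>) h"]) (auto simp: h hh HH_comp)
  also have "\<dots> = sc (\<alpha> h) (idem HH \<alpha>)"
    unfolding idem_expand[OF a] sc_sum_right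
    by (intro sum.cong refl) (simp add: charsD(1)[OF a] h)
  finally show ?thesis .
qed

lemma idem_mult:
  fixes \<alpha> :: "perm \<Rightarrow> 'k::field_char_0"
  assumes n: "n \<ge> 4" and a: "\<alpha> \<in> chars HH" and b: "\<beta> \<in> chars HH"
  shows "mulG n (idem HH \<alpha>) (idem HH \<beta>) = (if \<alpha> = \<beta> then idem HH \<alpha> else 0)"
proof -
  have "mulG n (idem HH \<alpha>) (idem HH \<beta>) = (\<Sum>h\<in>HH. sc (\<alpha> h / 4) (sc (\<beta> h) (idem HH \<beta>)))"
    unfolding idem_expand[OF a] mulG_sum_left mulG_sc_left
    by (intro sum.cong refl) (simp add: delta_idem n b)
  also have "\<dots> = sc ((\<Sum>h\<in>HH. \<alpha> h * \<beta> h) / 4) (idem HH \<beta>)"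
    by (simp add: sum_divide_distrib sc_sum_left)
  also have "\<dots> = (if \<alpha> = \<beta> then idem HH \<alpha> else 0)"
    by (simp add: chars_orth a b)
  finally show ?thesis .
qed

lemma sum_idem: "(\<Sum>\<alpha>\<in>chars HH. idem HH \<alpha>) = (delta id :: perm \<Rightarrow> 'k::field_char_0)"
proof -
  have "(\<Sum>\<alpha>\<in>chars HH. idem HH \<alpha>) = (\<Sum>\<alpha>\<in>chars HH. \<Sum>h\<in>HH. sc (\<alpha> h / 4) (delta h) :: perm \<Rightarrow> 'k)"
    by (intro sum.cong refl idem_expand)
  also have "\<dots> = (\<Sum>h\<in>HH. sc ((\<Sum>\<alpha>\<in>chars HH. \<alpha> h) / 4) (delta h))"
    by (subst sum.swap) (simp add: sum_divide_distrib sc_sum_left)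
  also have "\<dots> = (\<Sum>h\<in>HH. if h = id then delta h else 0)"
    by (intro sum.cong refl) (simp add: chars_complete)
  also have "\<dots> = delta id" by simp
  finally show ?thesis .
qed

text \<open>S sends an idempotent to that of the inverse character, and every character of H is its
  own inverse.\<close>

lemma antipG_idem:
  fixes \<alpha> :: "perm \<Rightarrow> 'k::field_char_0"
  assumes n: "n \<ge> 4" and a: "\<alpha> \<in> chars HH"
  shows "antipG n (idem HH \<alpha>) = idem HH \<alpha>"
  unfolding idem_expand[OF a] linmap_sum[OF linmap_antipG] linmap_sc[OF linmap_antipG]
  by (intro sum.cong refl) (simp add: HH_SG[OF n] HH_inv)

text \<open>\<open>D1\<close> and \<open>D2\<close> describe elements of kH and kH \<otimes> kH by
  their eigenvalues. Products become pointwise products, so identities about the twist turn into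
  scalar identities in \<omega>.\<close>

definition D1 :: "((perm \<Rightarrow> 'k::field_char_0) \<Rightarrow> 'k) \<Rightarrow> perm \<Rightarrow> 'k" where
  "D1 f = (\<Sum>\<alpha>\<in>chars HH. sc (f \<alpha>) (idem HH \<alpha>))"

definition D2 :: "((perm \<Rightarrow> 'k::field_char_0) \<Rightarrow> (perm \<Rightarrow> 'k) \<Rightarrow> 'k) \<Rightarrow> perm \<times> perm \<Rightarrow> 'k" where
  "D2 F = (\<Sum>\<alpha>\<in>chars HH. \<Sum>\<beta>\<in>chars HH. sc (F \<alpha> \<beta>) (tens (idem HH \<alpha>) (idem HH \<beta>)))"

lemma twistJ_D2: "twistJ HH \<omega> = D2 \<omega>"
  by (rule ext) (simp add: twistJ_def D2_def sum_fun_apply)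

lemma D1_cong: "(\<And>\<alpha>. \<alpha> \<in> chars HH \<Longrightarrow> f \<alpha> = g \<alpha>) \<Longrightarrow> D1 f = D1 g"
  by (simp add: D1_def cong: sum.cong)

lemma D2_cong: "(\<And>\<alpha> \<beta>. \<alpha> \<in> chars HH \<Longrightarrow> \<beta> \<in> chars HH \<Longrightarrow> F \<alpha> \<beta> = F' \<alpha> \<beta>) \<Longrightarrow> D2 F = D2 F'"
  by (simp add: D2_def cong: sum.cong)

lemma D1_KG [simp]: "n \<ge> 4 \<Longrightarrow> D1 f \<in> KG n"
  unfolding D1_def by (intro subsp_sum subspD(3) subsp_KG idem_KG)

lemma D2_galg [simp]: "n \<ge> 4 \<Longrightarrow> D2 F \<in> galg (SG n \<times> SG n)"
  unfolding D2_def by (intro subsp_sum subspD(3) subsp_galg tens_galg idem_KG)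

lemma D1_const: "D1 (\<lambda>_. c) = sc c (delta id)"
  by (simp add: D1_def sum_idem flip: sc_sum_right)

lemma tens_D1: "tens (D1 f) (D1 g) = D2 (\<lambda>\<alpha> \<beta>. f \<alpha> * g \<beta>)"
  unfolding D1_def D2_def tens_sum_left unfolding tens_sum_right by (simp add: tens_sc mult.commute)

lemma D2_const: "D2 (\<lambda>_ _. c) = sc c (delta (id, id))"
  using tens_D1[of "\<lambda>_. c" "\<lambda>_. 1"] by (simp add: D1_const tens_sc delta_pair)

lemma D1_idem_right:
  assumes "n \<ge> 4" "\<alpha> \<in> chars HH"
  shows "mulG n (D1 f) (idem HH \<alpha>) = sc (f \<alpha>) (idem HH \<alpha>)"
proof -
  have "mulG n (D1 f) (idem HH \<alpha>) = (\<Sum>\<beta>\<in>chars HH. if \<beta> = \<alpha> then sc (f \<alpha>) (idem HH \<alpha>) else 0)"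
    unfolding D1_def mulG_sum_left mulG_sc_left
    using assms by (intro sum.cong refl) (auto simp: idem_mult)
  thus ?thesis using assms by simp
qed

lemma D1_mult: "n \<ge> 4 \<Longrightarrow> mulG n (D1 f) (D1 g) = D1 (\<lambda>\<alpha>. f \<alpha> * g \<alpha>)"
  unfolding D1_def[of g] mulG_sum_right mulG_sc_right D1_def[of "\<lambda>\<alpha>. f \<alpha> * g \<alpha>"]
  by (intro sum.cong refl) (simp add: D1_idem_right mult.commute)

lemma D2_mult:
  assumes n: "n \<ge> 4"
  shows "mulGG n (D2 F) (D2 F') = D2 (\<lambda>\<alpha> \<beta>. F \<alpha> \<beta> * F' \<alpha> \<beta>)"
proof -
  have *: "mulGG n (D2 F) (tens (idem HH \<alpha>) (idem HH \<beta>)) = sc (F \<alpha> \<beta>) (tens (idem HH \<alpha>) (idem HH \<beta>))"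
    if "\<alpha> \<in> chars HH" "\<beta> \<in> chars HH" for \<alpha> \<beta>
  proof -
    have "mulGG n (D2 F) (tens (idem HH \<alpha>) (idem HH \<beta>)) =
      (\<Sum>\<gamma>\<in>chars HH. \<Sum>\<delta>\<in>chars HH. sc (F \<gamma> \<delta>) (tens (if \<gamma> = \<alpha> then idem HH \<gamma> else 0) (if \<delta> = \<beta> then idem HH \<delta> else 0)))"
      unfolding D2_def mulGG_sum_left mulGG_sc_left
      using n that by (intro sum.cong refl) (simp add: mulGG_tens idem_KG idem_mult)
    also have "\<dots> = (\<Sum>\<gamma>\<in>chars HH. if \<gamma> = \<alpha> then (\<Sum>\<delta>\<in>chars HH. if \<delta> = \<beta> then sc (F \<gamma> \<delta>) (tens (idem HH \<gamma>) (idem HH \<delta>)) else 0) else 0)"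
      by (rule sum.cong[OF refl])
         (auto simp: linmap_zero[OF linmap_tens_left] linmap_zero[OF linmap_tens_right]
           simp del: sum.delta sum.delta' intro!: sum.cong)
    finally show ?thesis using that by simp
  qed
  show ?thesis
    unfolding D2_def[of F'] mulGG_sum_right mulGG_sc_right D2_def[of "\<lambda>\<alpha> \<beta>. F \<alpha> \<beta> * F' \<alpha> \<beta>"]
    by (intro sum.cong refl) (simp add: * mult.commute)
qed

lemma delta_D1: "h \<in> HH \<Longrightarrow> delta h = D1 (\<lambda>\<alpha>. \<alpha> h :: 'k::field_char_0)"
proof -
  assume h: "h \<in> HH"
  \<comment> \<open>4 is the smallest degree whose symmetric group contains H; the claim itself does
    not depend on a degree.\<close>
  have "delta h = mulG 4 (delta h) (\<Sum>\<alpha>\<in>chars HH. idem HH \<alpha> :: perm \<Rightarrow> 'k)"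
    by (simp add: sum_idem HH_SG[OF _ h])
  also have "\<dots> = D1 (\<lambda>\<alpha>. \<alpha> h)"
    unfolding mulG_sum_right D1_def by (intro sum.cong refl) (simp add: delta_idem h)
  finally show ?thesis .
qed

lemma D2_lincomb: "(\<Sum>i\<in>I. sc (c i) (D2 (F i))) = D2 (\<lambda>\<alpha> \<beta>. \<Sum>i\<in>I. c i * F i \<alpha> \<beta>)"
  unfolding D2_def sc_sum_right sc_sc sc_sum_left
  by (subst sum.swap, rule sum.cong[OF refl], rule sum.swap)

lemma comultG_idem:
  fixes \<gamma> :: "perm \<Rightarrow> 'k::field_char_0"
  assumes n: "n \<ge> 4" and c: "\<gamma> \<in> chars HH"
  shows "comultG n (idem HH \<gamma>) = D2 (\<lambda>\<alpha> \<beta>. if chmul \<alpha> \<beta> = \<gamma> then 1 else 0)"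
proof -
  have "comultG n (idem HH \<gamma>) = (\<Sum>h\<in>HH. sc (\<gamma> h / 4) (D2 (\<lambda>\<alpha> \<beta>. \<alpha> h * \<beta> h)))"
    unfolding idem_expand[OF c] linmap_sum[OF linmap_comultG] linmap_sc[OF linmap_comultG]
    by (intro sum.cong refl) (subst comultG_delta, simp_all add: HH_SG[OF n] delta_D1 tens_D1)
  also have "\<dots> = D2 (\<lambda>\<alpha> \<beta>. \<Sum>h\<in>HH. \<gamma> h / 4 * (\<alpha> h * \<beta> h))" by (rule D2_lincomb)
  also have "\<dots> = D2 (\<lambda>\<alpha> \<beta>. if chmul \<alpha> \<beta> = \<gamma> then 1 else 0)"
  proof (rule D2_cong)
    fix \<alpha> \<beta> :: "perm \<Rightarrow> 'k" assume ab: "\<alpha> \<in> chars HH" "\<beta> \<in> chars HH"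
    have "(\<Sum>h\<in>HH. \<gamma> h / 4 * (\<alpha> h * \<beta> h)) = (\<Sum>h\<in>HH. chmul \<alpha> \<beta> h * \<gamma> h) / 4"
      by (simp add: chmul_def sum_divide_distrib mult.commute)
    also have "\<dots> = (if chmul \<alpha> \<beta> = \<gamma> then 1 else 0)"
      by (subst chars_orth) (auto simp: c ab)
    finally show "(\<Sum>h\<in>HH. \<gamma> h / 4 * (\<alpha> h * \<beta> h)) = (if chmul \<alpha> \<beta> = \<gamma> then 1 else 0)" .
  qed
  finally show ?thesis .
qed

text \<open>The idempotents of \<gamma> and \<delta> act by \<Delta>(e_\<gamma>) on the left and 1
  \<otimes> e_\<delta> on the right, which selects \<open>chmul \<alpha> \<beta>\<close> = \<gamma>
  and \<beta> = \<delta>. The factor g \<otimes> 1 is carried along since it commutes with 1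
  \<otimes> e_\<delta>.\<close>

lemma act2_D2:
  fixes F :: "(perm \<Rightarrow> 'k::field_char_0) \<Rightarrow> (perm \<Rightarrow> 'k) \<Rightarrow> 'k"
  assumes n: "n \<ge> 4" and g: "g \<in> SG n"
  shows "act2 n (D2 F) (mulGG n (D2 F') (tens (delta g) (delta id)))
    = mulGG n (D2 (\<lambda>\<alpha> \<beta>. F (chmul \<alpha> \<beta>) \<beta> * F' \<alpha> \<beta>)) (tens (delta g) (delta id))"
proof -
  let ?g = "tens (delta g) (delta id) :: perm \<times> perm \<Rightarrow> 'k"
  have idb: "tens (delta id) (idem HH \<delta>) = D2 (\<lambda>\<alpha> \<beta>. if \<beta> = \<delta> then 1 else 0)" if "\<delta> \<in> chars HH" for \<delta> :: "perm \<Rightarrow> 'k"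
  proof -
    have "idem HH \<delta> = (\<Sum>\<beta>\<in>chars HH. if \<beta> = \<delta> then idem HH \<beta> else 0)" using that by simp
    also have "\<dots> = D1 (\<lambda>\<beta>. if \<beta> = \<delta> then 1 else 0)"
      unfolding D1_def by (intro sum.cong refl) simp
    finally have "idem HH \<delta> = D1 (\<lambda>\<beta>. if \<beta> = \<delta> then 1 else 0)" .
    thus ?thesis using tens_D1[of "\<lambda>_. 1" "\<lambda>\<beta>. if \<beta> = \<delta> then 1 else 0"] by (simp add: D1_const)
  qed
  have "act2 n (tens (idem HH \<gamma>) (idem HH \<delta>)) (mulGG n (D2 F') ?g) =
    mulGG n (D2 (\<lambda>\<alpha> \<beta>. (if chmul \<alpha> \<beta> = \<gamma> then 1 else 0) * F' \<alpha> \<beta> * (if \<beta> = \<delta> then 1 else 0))) ?g"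
    if cd: "\<gamma> \<in> chars HH" "\<delta> \<in> chars HH" for \<gamma> \<delta>
  proof -
    have comm: "mulGG n ?g (tens (delta id) (idem HH \<delta>)) = mulGG n (tens (delta id) (idem HH \<delta>)) ?g"
      using n g by (simp add: mulGG_tens idem_KG)
    have "act2 n (tens (idem HH \<gamma>) (idem HH \<delta>)) (mulGG n (D2 F') ?g) =
      mulGG n (comultG n (idem HH \<gamma>)) (mulGG n (D2 F') (mulGG n ?g (tens (delta id) (idem HH \<delta>))))"
      by (simp add: act2_tens idem_KG n antipG_idem cd mulGG_assoc)
    also have "\<dots> = mulGG n (mulGG n (mulGG n (comultG n (idem HH \<gamma>)) (D2 F')) (tens (delta id) (idem HH \<delta>))) ?g"
      by (simp add: comm mulGG_assoc)
    finally show ?thesis by (simp add: comultG_idem n cd idb D2_mult)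
  qed
  hence "act2 n (D2 F) (mulGG n (D2 F') ?g) = (\<Sum>\<gamma>\<in>chars HH. \<Sum>\<delta>\<in>chars HH. sc (F \<gamma> \<delta>)
     (mulGG n (D2 (\<lambda>\<alpha> \<beta>. (if chmul \<alpha> \<beta> = \<gamma> then 1 else 0) * F' \<alpha> \<beta> * (if \<beta> = \<delta> then 1 else 0))) ?g))"
    unfolding D2_def[of F] linmap_sum[OF linmap_act2(1)] linmap_sc[OF linmap_act2(1)]
    by (intro sum.cong refl) simp
  also have "\<dots> = mulGG n (\<Sum>\<gamma>\<in>chars HH. sc 1 (D2 (\<lambda>\<alpha> \<beta>. \<Sum>\<delta>\<in>chars HH. F \<gamma> \<delta> * ((if chmul \<alpha> \<beta> = \<gamma> then 1 else 0) * F' \<alpha> \<beta> * (if \<beta> = \<delta> then 1 else 0))))) ?g"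
    by (simp add: mulGG_sum_left mulGG_sc_left flip: D2_lincomb)
  also have "\<dots> = mulGG n (D2 (\<lambda>\<alpha> \<beta>. \<Sum>\<gamma>\<in>chars HH. \<Sum>\<delta>\<in>chars HH. F \<gamma> \<delta> * ((if chmul \<alpha> \<beta> = \<gamma> then 1 else 0) * F' \<alpha> \<beta> * (if \<beta> = \<delta> then 1 else 0)))) ?g"
    unfolding D2_lincomb by simp
  also have "\<dots> = mulGG n (D2 (\<lambda>\<alpha> \<beta>. F (chmul \<alpha> \<beta>) \<beta> * F' \<alpha> \<beta>)) ?g"
  proof (rule arg_cong[where f = "\<lambda>x. mulGG n x ?g"], rule D2_cong)
    fix \<alpha> \<beta> :: "perm \<Rightarrow> 'k" assume ab: "\<alpha> \<in> chars HH" "\<beta> \<in> chars HH"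
    have "(\<Sum>\<gamma>\<in>chars HH. \<Sum>\<delta>\<in>chars HH. F \<gamma> \<delta> * ((if chmul \<alpha> \<beta> = \<gamma> then 1 else 0) * F' \<alpha> \<beta> * (if \<beta> = \<delta> then 1 else 0)))
      = (\<Sum>\<gamma>\<in>chars HH. if chmul \<alpha> \<beta> = \<gamma> then (\<Sum>\<delta>\<in>chars HH. if \<beta> = \<delta> then F \<gamma> \<delta> * F' \<alpha> \<beta> else 0) else 0)"
      by (rule sum.cong[OF refl]) (auto simp del: sum.delta sum.delta' intro!: sum.cong)
    also have "\<dots> = F (chmul \<alpha> \<beta>) \<beta> * F' \<alpha> \<beta>" using ab by simp
    finally show "(\<Sum>\<gamma>\<in>chars HH. \<Sum>\<delta>\<in>chars HH. F \<gamma> \<delta> * ((if chmul \<alpha> \<beta> = \<gamma> then 1 else 0) * F' \<alpha> \<beta> * (if \<beta> = \<delta> then 1 else 0)))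
      = F (chmul \<alpha> \<beta>) \<beta> * F' \<alpha> \<beta>" .
  qed
  finally show ?thesis .
qed

text \<open>For y in kH the product e_\<beta> y e_\<alpha> vanishes unless \<alpha> = \<beta>, so
  only the diagonal of \<open>F\<close> survives.\<close>

lemma ract_D2:
  fixes F :: "(perm \<Rightarrow> 'k::field_char_0) \<Rightarrow> (perm \<Rightarrow> 'k) \<Rightarrow> 'k"
  assumes n: "n \<ge> 4"
  shows "ract n (D2 F) (D1 f) = D1 (\<lambda>\<alpha>. F \<alpha> \<alpha> * f \<alpha>)"
proof -
  have id_D1: "mulG n (idem HH \<beta>) (D1 f) = sc (f \<beta>) (idem HH \<beta>)" if "\<beta> \<in> chars HH" for \<beta>
    unfolding D1_def mulG_sum_right mulG_sc_right
    by (subst sum.cong[of _ "chars HH" _ "\<lambda>\<alpha>. if \<beta> = \<alpha> then sc (f \<alpha>) (idem HH \<alpha>) else 0"])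
       (use that n in \<open>auto simp: idem_mult\<close>)
  have "ract n (D2 F) (D1 f) = (\<Sum>\<alpha>\<in>chars HH. \<Sum>\<beta>\<in>chars HH. if \<beta> = \<alpha> then sc (F \<alpha> \<alpha> * f \<alpha>) (idem HH \<alpha>) else 0)"
    unfolding D2_def linmap_sum[OF linmap_ract(1)] linmap_sc[OF linmap_ract(1)]
    using n by (intro sum.cong refl) (auto simp: ract_tens idem_KG antipG_idem id_D1 mulG_sc_left idem_mult)
  also have "\<dots> = D1 (\<lambda>\<alpha>. F \<alpha> \<alpha> * f \<alpha>)"
    unfolding D1_def by (intro sum.cong refl) simp
  finally show ?thesis .
qed

lemma mSid_D2:
  fixes F :: "(perm \<Rightarrow> 'k::field_char_0) \<Rightarrow> (perm \<Rightarrow> 'k) \<Rightarrow> 'k"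
  assumes n: "n \<ge> 4"
  shows "mSid n (D2 F) = D1 (\<lambda>\<alpha>. F \<alpha> \<alpha>)"
proof -
  have "mSid n (D2 F) = (\<Sum>\<alpha>\<in>chars HH. \<Sum>\<beta>\<in>chars HH. if \<alpha> = \<beta> then sc (F \<alpha> \<beta>) (idem HH \<alpha>) else 0)"
    unfolding D2_def linmap_sum[OF linmap_mSid] linmap_sc[OF linmap_mSid]
    using n by (intro sum.cong refl) (auto simp: mSid_tens idem_KG antipG_idem idem_mult)
  also have "\<dots> = D1 (\<lambda>\<alpha>. F \<alpha> \<alpha>)"
    unfolding D1_def by (intro sum.cong refl) simp
  finally show ?thesis .
qed

text \<open>Cut off outside \<open>HH\<close>, so that the restriction of a character of the
  symmetric group is literally a member of \<open>chars HH\<close>.\<close>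

definition resH :: "(perm \<Rightarrow> 'k::field) \<Rightarrow> perm \<Rightarrow> 'k" where
  "resH f = (\<lambda>h. if h \<in> HH then f h else 0)"

lemma resH_chars:
  assumes n: "n \<ge> 4" and f: "\<And>x y. x \<in> SG n \<Longrightarrow> y \<in> SG n \<Longrightarrow> f (x \<circ> y) = f x * f y" and f1: "f id = 1"
  shows "resH f \<in> chars HH"
proof -
  have "f h \<noteq> 0" if "h \<in> HH" for h
    using f[OF HH_SG[OF n that] HH_SG[OF n that]] f1 by (auto simp: HH_self_inverse that)
  thus ?thesis by (auto simp: chars_def resH_def HH_comp f HH_SG[OF n])
qed

lemma pr_idem:
  fixes \<alpha> :: "perm \<Rightarrow> 'k::field_char_0"
  assumes n: "n \<ge> 4" and f: "resH f \<in> chars HH" and a: "\<alpha> \<in> chars HH"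
  shows "pr (SG n) f (idem HH \<alpha>) = (if \<alpha> = resH f then 1 else 0)"
proof -
  have "pr (SG n) f (idem HH \<alpha>) = (\<Sum>h\<in>HH. \<alpha> h * resH f h) / 4"
    unfolding idem_expand[OF a] pr_sum sum_divide_distrib
    by (intro sum.cong refl) (simp add: pr_sc pr_delta HH_SG[OF n] resH_def)
  also have "\<dots> = (if \<alpha> = resH f then 1 else 0)"
    unfolding chars_orth[OF a f] by simp
  finally show ?thesis .
qed

lemma slr_D2:
  fixes F :: "(perm \<Rightarrow> 'k::field_char_0) \<Rightarrow> (perm \<Rightarrow> 'k) \<Rightarrow> 'k"
  assumes n: "n \<ge> 4" and f: "resH f \<in> chars HH"
  shows "slr n f (D2 F) = D1 (\<lambda>\<alpha>. F \<alpha> (resH f))"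
proof -
  have "slr n f (D2 F) = (\<Sum>\<alpha>\<in>chars HH. \<Sum>\<beta>\<in>chars HH. if \<beta> = resH f then sc (F \<alpha> (resH f)) (idem HH \<alpha>) else 0)"
    unfolding D2_def linmap_sum[OF linmap_slr] linmap_sc[OF linmap_slr] slr_tens
    by (intro sum.cong refl) (auto simp: pr_idem n f)
  thus ?thesis using f by (simp add: D1_def)
qed

lemma sll_D2:
  fixes F :: "(perm \<Rightarrow> 'k::field_char_0) \<Rightarrow> (perm \<Rightarrow> 'k) \<Rightarrow> 'k"
  assumes n: "n \<ge> 4" and f: "resH f \<in> chars HH"
  shows "sll n f (D2 F) = D1 (F (resH f))"
proof -
  have "sll n f (D2 F) = (\<Sum>\<beta>\<in>chars HH. \<Sum>\<alpha>\<in>chars HH. if \<alpha> = resH f then sc (F (resH f) \<beta>) (idem HH \<beta>) else 0)"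
    unfolding D2_def linmap_sum[OF linmap_sll] linmap_sc[OF linmap_sll] sll_tens
    by (subst sum.swap, intro sum.cong refl) (auto simp: pr_idem n f)
  thus ?thesis using f by (simp add: D1_def)
qed

section \<open>The twist and the integral of a Hopf subalgebra\<close>

definition eps :: "nat \<Rightarrow> (perm \<Rightarrow> 'k::field) \<Rightarrow> 'k" where
  "eps n = pr (SG n) (\<lambda>_. 1)"

lemma eps_mulG: "eps n (mulG n a b) = eps n a * eps n b"
  unfolding eps_def mulG_def by (rule G.pr_conv) simp

lemma eps_sc: "eps n (sc c a) = c * eps n a"
  by (simp add: eps_def pr_sc)

lemma eps_diff: "eps n (a - b) = eps n a - eps n b"
  by (simp add: eps_def pr_diff)

lemma eps_sum: "eps n (\<Sum>i\<in>I. a i) = (\<Sum>i\<in>I. eps n (a i))"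
  by (simp add: eps_def pr_sum)

lemma eps_delta [simp]: "g \<in> SG n \<Longrightarrow> eps n (delta g) = 1"
  by (simp add: eps_def pr_delta)

lemma eps_act: "eps n (act n T y) = (\<Sum>p\<in>SG n \<times> SG n. T p) * eps n y"
  unfolding act_def lext_def eps_sum sum_distrib_right
  by (intro sum.cong refl) (auto simp: eps_sc eps_mulG)

lemma pr_slr_sll: "pr (SG n) f (slr n g T) = pr (SG n) g (sll n f T)"
  unfolding pr_def slr_def sll_def sum_distrib_left
  by (subst sum.swap) (simp add: mult.left_commute)

lemma slr_delta: "s \<in> SG n \<Longrightarrow> slr n (delta s) T q = T (q, s)"
  by (simp add: slr_def sum_delta_mult)

lemma sll_delta: "q \<in> SG n \<Longrightarrow> sll n (delta q) T s = T (q, s)"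
  by (simp add: sll_def sum_delta_mult)

lemma resH_one: "resH (\<lambda>_. 1) = chv 1 1"
proof
  fix x
  show "resH (\<lambda>_. 1) x = chv 1 1 x"
    by (cases "x \<in> HH") (auto simp: resH_def HH_eq)
qed

section \<open>The twist and the twisted structure maps\<close>

locale twisted =
  fixes n :: nat and \<omega> :: "(perm \<Rightarrow> 'k::field_char_0) \<Rightarrow> (perm \<Rightarrow> 'k) \<Rightarrow> 'k"
  assumes n5: "n \<ge> 5" and cocyc: "cocycle2 (chars HH) \<omega>"
begin

lemma n4: "4 \<le> n" using n5 by simp

abbreviation mul (infixl "\<star>" 70) where "a \<star> b \<equiv> mulG n a b"
abbreviation mul2 (infixl "\<odot>" 70) where "a \<odot> b \<equiv> mulGG n a b"
abbreviation one :: "perm \<Rightarrow> 'k" where "one \<equiv> delta id"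

definition J where "J = twistJ HH \<omega>"
definition Ji where "Ji = D2 (\<lambda>\<alpha> \<beta>. 1 / \<omega> \<alpha> \<beta>)"
definition v where "v = D1 (\<lambda>\<alpha>. \<omega> \<alpha> \<alpha>)"
definition vi where "vi = D1 (\<lambda>\<alpha>. 1 / \<omega> \<alpha> \<alpha>)"
definition DJ where "DJ = comultJ n J"
definition SJ where "SJ = antipJ n J"

lemma J_D2: "J = D2 \<omega>" by (simp add: J_def twistJ_D2)

lemma omega_nz: "\<alpha> \<in> chars HH \<Longrightarrow> \<beta> \<in> chars HH \<Longrightarrow> \<omega> \<alpha> \<beta> \<noteq> 0"
  using cocyc by (simp add: cocycle2_def)

lemma omega_cocycle: "\<alpha> \<in> chars HH \<Longrightarrow> \<beta> \<in> chars HH \<Longrightarrow> \<gamma> \<in> chars HH \<Longrightarrow>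
   \<omega> \<alpha> \<beta> * \<omega> (chmul \<alpha> \<beta>) \<gamma> = \<omega> \<beta> \<gamma> * \<omega> \<alpha> (chmul \<beta> \<gamma>)"
  using cocyc by (simp add: cocycle2_def)

definition c0 where "c0 = \<omega> (chv 1 1) (chv 1 1)"

text \<open>The cocycle need not be normalised: the identity at (\<alpha>,1,1) and at (1,1,\<alpha>)
  only forces a common value \<open>c0\<close>, a scalar that cancels under conjugation by
  J.\<close>

lemma omega_one: "\<alpha> \<in> chars HH \<Longrightarrow> \<omega> \<alpha> (chv 1 1) = c0" "\<alpha> \<in> chars HH \<Longrightarrow> \<omega> (chv 1 1) \<alpha> = c0"
  using omega_cocycle[of \<alpha> "chv 1 1" "chv 1 1"] omega_cocycle[of "chv 1 1" "chv 1 1" \<alpha>]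
    omega_nz[of \<alpha> "chv 1 1"] omega_nz[of "chv 1 1" \<alpha>]
  by (simp_all add: c0_def)

lemma c0_nz: "c0 \<noteq> 0"
  by (simp add: c0_def omega_nz)

text \<open>The cocycle identity at (\<alpha>,\<beta>,\<beta>), with \<beta> of order at most
  2.\<close>

lemma omega_chmul: "\<alpha> \<in> chars HH \<Longrightarrow> \<beta> \<in> chars HH \<Longrightarrow> \<omega> (chmul \<alpha> \<beta>) \<beta> * \<omega> \<alpha> \<beta> = \<omega> \<beta> \<beta> * c0"
  using omega_cocycle[of \<alpha> \<beta> \<beta>] by (simp add: chmul_self omega_one mult.commute)

lemma in_alg [simp]: "J \<in> galg (SG n \<times> SG n)" "Ji \<in> galg (SG n \<times> SG n)" "v \<in> KG n" "vi \<in> KG n"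
  "one \<in> KG n"
  using n4 by (simp_all add: J_D2 Ji_def v_def vi_def)

lemma J_inverse: "J \<odot> Ji = delta (id, id)" "Ji \<odot> J = delta (id, id)"
proof -
  have "D2 (\<lambda>\<alpha> \<beta>. \<omega> \<alpha> \<beta> * (1 / \<omega> \<alpha> \<beta>)) = D2 (\<lambda>_ _. 1)"
    by (rule D2_cong) (simp add: omega_nz)
  thus "J \<odot> Ji = delta (id, id)" "Ji \<odot> J = delta (id, id)"
    using n4 by (simp_all add: J_D2 Ji_def D2_mult D2_const)
qed

lemma v_inverse: "v \<star> vi = one" "vi \<star> v = one"
proof -
  have "D1 (\<lambda>\<alpha>. \<omega> \<alpha> \<alpha> * (1 / \<omega> \<alpha> \<alpha>)) = D1 (\<lambda>_. 1)"
    by (rule D1_cong) (simp add: omega_nz)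
  thus "v \<star> vi = one" "vi \<star> v = one"
    using n4 by (simp_all add: v_def vi_def D1_mult D1_const)
qed

lemma invGG_J: "invGG n J = Ji"
  unfolding invGG_def
  by (rule GG.ainv_eqI) (simp_all add: J_inverse[unfolded mulGG_def])

lemma mSid_J: "mSid n J = v"
  unfolding J_D2 v_def by (rule mSid_D2[OF n4])

lemma invG_v: "invG n v = vi"
  unfolding invG_def
  by (rule G.ainv_eqI) (simp_all add: v_inverse[unfolded mulG_def] in_alg[unfolded KG_def])

lemma DJ_eq: "DJ a = Ji \<odot> comultG n a \<odot> J"
  by (simp add: DJ_def comultJ_def invGG_J)

lemma SJ_eq: "SJ a = vi \<star> antipG n a \<star> v"
  by (simp add: SJ_def antipJ_def mSid_J invG_v)

lemma linmap_DJ: "linmap DJ"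
  unfolding DJ_eq[abs_def]
  by (intro linmap_comp[OF linmap_mulGG_left] linmap_comp[OF linmap_mulGG_right] linmap_comultG)

lemma DJ_galg [simp]: "DJ a \<in> galg (SG n \<times> SG n)"
  by (simp add: DJ_eq)

lemma SJ_KG [simp]: "SJ a \<in> KG n"
  by (simp add: SJ_eq)

lemma DJ_mul:
  assumes "a \<in> KG n" "b \<in> KG n"
  shows "DJ (a \<star> b) = DJ a \<odot> DJ b"
proof -
  have "DJ a \<odot> DJ b = Ji \<odot> comultG n a \<odot> (J \<odot> Ji) \<odot> comultG n b \<odot> J"
    by (simp add: DJ_eq mulGG_assoc)
  also have "\<dots> = Ji \<odot> (comultG n a \<odot> comultG n b) \<odot> J"
    by (simp add: J_inverse mulGG_assoc)
  finally show ?thesis by (simp add: DJ_eq comultG_mulG assms)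
qed

lemma comultG_DJ: "comultG n a = J \<odot> DJ a \<odot> Ji"
proof -
  have "J \<odot> DJ a \<odot> Ji = (J \<odot> Ji) \<odot> comultG n a \<odot> (J \<odot> Ji)"
    by (simp add: DJ_eq mulGG_assoc)
  thus ?thesis by (simp add: J_inverse)
qed

lemma slr_J:
  assumes "resH f \<in> chars HH"
  shows "slr n f J = D1 (\<lambda>\<alpha>. \<omega> \<alpha> (resH f))" "slr n f Ji = D1 (\<lambda>\<alpha>. 1 / \<omega> \<alpha> (resH f))"
    "sll n f J = D1 (\<lambda>\<alpha>. \<omega> (resH f) \<alpha>)" "sll n f Ji = D1 (\<lambda>\<alpha>. 1 / \<omega> (resH f) \<alpha>)"
  using assms n4 by (simp_all add: J_D2 Ji_def slr_D2 sll_D2)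

lemma slr_DJ_char:
  assumes "a \<in> KG n" "\<And>x y. x \<in> SG n \<Longrightarrow> y \<in> SG n \<Longrightarrow> f (x \<circ> y) = f x * f y"
  shows "slr n f (DJ a) = slr n f Ji \<star> (\<lambda>g. f g * a g) \<star> slr n f J"
    "sll n f (DJ a) = sll n f Ji \<star> (\<lambda>g. f g * a g) \<star> sll n f J"
  using assms by (simp_all add: DJ_eq slr_mulGG slr_comultG sll_mulGG sll_comultG)

lemma counit_DJ:
  assumes "a \<in> KG n"
  shows "slr n (\<lambda>_. 1) (DJ a) = a" "sll n (\<lambda>_. 1) (DJ a) = a"
proof -
  have c: "D1 (\<lambda>\<alpha>. \<omega> \<alpha> (chv 1 1)) = D1 (\<lambda>_. c0)" "D1 (\<lambda>\<alpha>. 1 / \<omega> \<alpha> (chv 1 1)) = D1 (\<lambda>_. 1 / c0)"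
    "D1 (\<lambda>\<alpha>. \<omega> (chv 1 1) \<alpha>) = D1 (\<lambda>_. c0)" "D1 (\<lambda>\<alpha>. 1 / \<omega> (chv 1 1) \<alpha>) = D1 (\<lambda>_. 1 / c0)"
    by (rule D1_cong; simp add: omega_one)+
  show "slr n (\<lambda>_. 1) (DJ a) = a" "sll n (\<lambda>_. 1) (DJ a) = a"
    using assms c0_nz
    by (simp_all add: slr_DJ_char slr_J resH_one c D1_const mulG_sc_left mulG_sc_right)
qed

text \<open>In Sweedler notation, \<open>x\<^sub>1 \<otimes> x\<^sub>2 S\<^sup>J(x\<^sub>3) = x \<otimes> 1\<close>. In the basis \<open>e\<^sub>\<alpha> \<otimes> e\<^sub>\<beta>\<close> this reduces to the
  cocycle identity \<open>omega_chmul\<close>.\<close>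

lemma galois_identity:
  assumes x: "x \<in> KG n" and DJx: "DJ x = (\<Sum>i\<in>I. tens (a i) (b i))"
    and ab: "\<And>i. i \<in> I \<Longrightarrow> a i \<in> KG n" "\<And>i. i \<in> I \<Longrightarrow> b i \<in> KG n"
  shows "(\<Sum>i\<in>I. DJ (a i) \<odot> tens one (SJ (b i))) = tens x one"
proof -
  \<comment> \<open>\<open>M\<close> and \<open>P\<close> are chosen so that P(a \<otimes> b) =
    \<Delta>^J(a) (1 \<otimes> S^J(b)): the v^-1 of S^J sits in \<open>M\<close>, the v in the last
    factor of \<open>P\<close>.\<close>
  define M where "M = J \<odot> tens one vi"
  define P where "P T = Ji \<odot> act2 n T M \<odot> tens one v" for T
  have linP: "linmap P"
    unfolding P_def
    by (intro linmap_comp[OF linmap_mulGG_left] linmap_comp[OF linmap_mulGG_right] linmap_act2)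
  have P_tens: "P (tens a b) = DJ a \<odot> tens one (SJ b)" if "a \<in> KG n" "b \<in> KG n" for a b
  proof -
    have "P (tens a b) = DJ a \<odot> (tens one vi \<odot> tens one (antipG n b) \<odot> tens one v)"
      using that by (simp add: P_def M_def act2_tens DJ_eq mulGG_assoc)
    also have "\<dots> = DJ a \<odot> tens one (SJ b)"
      by (simp add: mulGG_tens SJ_eq)
    finally show ?thesis .
  qed
  have M: "M = D2 (\<lambda>\<alpha> \<beta>. \<omega> \<alpha> \<beta> * (1 / \<omega> \<beta> \<beta>))"
  proof -
    have "tens one vi = D2 (\<lambda>\<alpha> \<beta>. 1 * (1 / \<omega> \<beta> \<beta>))"
      unfolding vi_def tens_D1[symmetric] by (simp add: D1_const)
    thus ?thesis using n4 by (simp add: M_def J_D2 D2_mult)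
  qed
  have tv: "tens one v = D2 (\<lambda>\<alpha> \<beta>. \<omega> \<beta> \<beta>)"
    using tens_D1[of "\<lambda>_. 1" "\<lambda>\<alpha>. \<omega> \<alpha> \<alpha>"] by (simp add: v_def D1_const)
  \<comment> \<open>The first factor of \<Delta>^J(g) already turns \<open>M\<close> into a scalar,
    on which g \<otimes> g and then J^-1 are easy to apply.\<close>
  have 1: "act2 n J M = D2 (\<lambda>_ _. c0)"
  proof -
    have "act2 n J M = D2 (\<lambda>\<alpha> \<beta>. \<omega> (chmul \<alpha> \<beta>) \<beta> * (\<omega> \<alpha> \<beta> * (1 / \<omega> \<beta> \<beta>)))"
      using act2_D2[OF n4, of id \<omega> "\<lambda>\<alpha> \<beta>. \<omega> \<alpha> \<beta> * (1 / \<omega> \<beta> \<beta>)"] n4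
      by (simp add: M J_D2 delta_pair[symmetric])
    also have "\<dots> = D2 (\<lambda>_ _. c0)"
      by (rule D2_cong) (simp add: omega_nz omega_chmul flip: mult.assoc)
    finally show ?thesis .
  qed
  have P_DJ: "P (DJ (delta g)) = tens (delta g) one" if g: "g \<in> SG n" for g
  proof -
    let ?g = "tens (delta g) one :: perm \<times> perm \<Rightarrow> 'k"
    have "act2 n (comultG n (delta g)) (act2 n J M) = sc c0 (tens (delta g) (delta g) \<odot> tens one (delta (inv g)))"
      using g unfolding 1 D2_const
      by (simp add: linmap_sc[OF linmap_act2(2)] act2_tens)
    also have "\<dots> = D2 (\<lambda>_ _. c0) \<odot> ?g"
      using g by (simp add: mulGG_tens D2_const mulGG_sc_left)
    finally have 2: "act2 n (comultG n (delta g)) (act2 n J M) = D2 (\<lambda>_ _. c0) \<odot> ?g" .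
    have "act2 n (DJ (delta g)) M = act2 n Ji (D2 (\<lambda>_ _. c0) \<odot> ?g)"
      using 2 by (simp add: DJ_eq act2_mulGG)
    also have "\<dots> = D2 (\<lambda>\<alpha> \<beta>. 1 / \<omega> (chmul \<alpha> \<beta>) \<beta> * c0) \<odot> ?g"
      unfolding Ji_def by (rule act2_D2[OF n4 g])
    finally have "P (DJ (delta g)) = Ji \<odot> D2 (\<lambda>\<alpha> \<beta>. 1 / \<omega> (chmul \<alpha> \<beta>) \<beta> * c0) \<odot> (?g \<odot> tens one v)"
      by (simp add: P_def mulGG_assoc)
    also have "?g \<odot> tens one v = tens one v \<odot> ?g"
      using g by (simp add: mulGG_tens)
    also have "Ji \<odot> D2 (\<lambda>\<alpha> \<beta>. 1 / \<omega> (chmul \<alpha> \<beta>) \<beta> * c0) \<odot> (tens one v \<odot> ?g)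
      = D2 (\<lambda>\<alpha> \<beta>. 1 / \<omega> \<alpha> \<beta> * (1 / \<omega> (chmul \<alpha> \<beta>) \<beta> * c0) * \<omega> \<beta> \<beta>) \<odot> ?g"
      using n4 by (simp add: Ji_def tv D2_mult flip: mulGG_assoc)
    also have "D2 (\<lambda>\<alpha> \<beta>. 1 / \<omega> \<alpha> \<beta> * (1 / \<omega> (chmul \<alpha> \<beta>) \<beta> * c0) * \<omega> \<beta> \<beta>) = D2 (\<lambda>_ _. 1)"
    proof (rule D2_cong)
      fix \<alpha> \<beta> :: "perm \<Rightarrow> 'k" assume "\<alpha> \<in> chars HH" "\<beta> \<in> chars HH"
      thus "1 / \<omega> \<alpha> \<beta> * (1 / \<omega> (chmul \<alpha> \<beta>) \<beta> * c0) * \<omega> \<beta> \<beta> = 1"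
        using omega_chmul[of \<alpha> \<beta>] by (simp add: omega_nz c0_nz field_simps)
    qed
    also have "D2 (\<lambda>_ _. 1) \<odot> ?g = ?g"
      unfolding D2_const sc_one by (rule mulGG_unit_left) (use g in simp)
    finally show ?thesis .
  qed
  have "P (DJ x) = tens x one"
    by (rule linmap_eqI[OF finite_SG linmap_comp[OF linP linmap_DJ] linmap_tens_left P_DJ x[unfolded KG_def]])
  moreover have "P (DJ x) = (\<Sum>i\<in>I. DJ (a i) \<odot> tens one (SJ (b i)))"
    unfolding DJx linmap_sum[OF linP] by (intro sum.cong refl P_tens ab)
  ultimately show ?thesis by simp
qed

text \<open>In Sweedler notation this is S^J(x_2) x_1 = \<epsilon>(x) 1, the identity of the inverse
  antipode; here the involutivity of S^J enters. Under \<open>ract\<close>, J^-1 sends v to 1, g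
  \<otimes> g fixes 1, J sends 1 to v, and v^-1 cancels the result.\<close>

lemma antipode_identity:
  assumes x: "x \<in> KG n" and DJx: "DJ x = (\<Sum>i\<in>I. tens (a i) (b i))"
    and ab: "\<And>i. i \<in> I \<Longrightarrow> a i \<in> KG n" "\<And>i. i \<in> I \<Longrightarrow> b i \<in> KG n"
  shows "(\<Sum>i\<in>I. SJ (b i) \<star> a i) = sc (eps n x) one"
proof -
  define R where "R T = vi \<star> ract n T v" for T
  have linR: "linmap R"
    unfolding R_def by (intro linmap_comp[OF linmap_mulG_right] linmap_ract)
  have R_tens: "R (tens a b) = SJ b \<star> a" if "a \<in> KG n" "b \<in> KG n" for a b
    using that by (simp add: R_def ract_tens SJ_eq mulG_assoc)
  have R_DJ: "R (DJ (delta g)) = one" if g: "g \<in> SG n" for g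
  proof -
    have "D1 (\<lambda>\<alpha>. 1 / \<omega> \<alpha> \<alpha> * \<omega> \<alpha> \<alpha>) = D1 (\<lambda>_. 1)" by (rule D1_cong) (simp add: omega_nz)
    hence 1: "ract n Ji v = one"
      unfolding Ji_def v_def ract_D2[OF n4] by (simp add: D1_const)
    have 2: "ract n (comultG n (delta g)) one = one"
      using g by (simp add: ract_tens)
    have 3: "ract n J one = v"
      using ract_D2[OF n4, of \<omega> "\<lambda>_. 1"] by (simp add: D1_const J_D2 v_def)
    show ?thesis by (simp add: R_def DJ_eq ract_mulGG 1 2 3 v_inverse)
  qed
  have "linmap (\<lambda>x. sc (eps n x) one)"
    by (rule linmapI; rule ext) (simp_all add: eps_def pr_add pr_sc algebra_simps)
  from linmap_eqI[OF finite_SG linmap_comp[OF linR linmap_DJ] this _ x[unfolded KG_def]]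
  have "R (DJ x) = sc (eps n x) one"
    by (simp add: R_DJ)
  moreover have "R (DJ x) = (\<Sum>i\<in>I. SJ (b i) \<star> a i)"
    unfolding DJx linmap_sum[OF linR] by (intro sum.cong refl R_tens ab)
  ultimately show ?thesis by simp
qed

text \<open>Since a x S^J(b) = a (x v^-1) S(b) v, the twisted adjoint action is expressed by
  \<open>act\<close>, which is multiplicative in the tensor.\<close>

lemma adjJ_eq: "adjJ n J h x = act n (DJ h) (x \<star> vi) \<star> v"
proof -
  have "act n (DJ h) (x \<star> vi) \<star> v =
     (\<Sum>p\<in>SG n \<times> SG n. sc (DJ h p) (delta (fst p) \<star> (x \<star> vi) \<star> delta (inv (snd p)) \<star> v))"
    by (simp add: act_def lext_def mulG_sum_left mulG_sc_left)
  also have "\<dots> = (\<Sum>p\<in>SG n \<times> SG n. sc (DJ h p) (delta (fst p) \<star> x \<star> SJ (delta (snd p))))"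
    by (intro sum.cong refl) (auto simp: SJ_eq mulG_assoc)
  also have "\<dots> = adjJ n J h x"
    by (rule ext) (simp add: adjJ_def sum_fun_apply DJ_def SJ_def)
  finally show ?thesis by simp
qed

end

section \<open>The integral of a Hopf subalgebra as a trace\<close>

locale hopf_sub = twisted n \<omega>
  for n :: nat and \<omega> :: "(perm \<Rightarrow> 'k::field_char_0) \<Rightarrow> (perm \<Rightarrow> 'k) \<Rightarrow> 'k" +
  fixes B :: "(perm \<Rightarrow> 'k) set"
  assumes hopf: "hopf_subalg n J B"
begin

lemma B_KG: "x \<in> B \<Longrightarrow> x \<in> KG n"
  and B_one: "one \<in> B"
  and B_mul: "x \<in> B \<Longrightarrow> y \<in> B \<Longrightarrow> x \<star> y \<in> B"
  and B_SJ: "x \<in> B \<Longrightarrow> SJ x \<in> B"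
  using hopf by (auto simp: hopf_subalg_def SJ_def)

lemma subsp_B: "subsp B"
proof -
  have sc: "sc c x \<in> B" if "x \<in> B" for c x using hopf that by (auto simp: hopf_subalg_def)
  moreover have "x + y \<in> B" if "x \<in> B" "y \<in> B" for x y
    using hopf that by (auto simp: hopf_subalg_def plus_fun_def)
  moreover have "0 \<in> B" using sc[OF B_one, of 0] by simp
  ultimately show ?thesis by (auto simp: subsp_def)
qed

lemma DJ_decompose:
  assumes "x \<in> B"
  obtains m a b where "DJ x = (\<Sum>i<(m::nat). tens (a i) (b i))" "\<forall>i<m. a i \<in> B \<and> b i \<in> B"
proof -
  have "DJ x \<in> tensor_span B" using hopf assms by (auto simp: hopf_subalg_def DJ_def)
  then obtain m a b where "DJ x = (\<lambda>p. \<Sum>i<(m::nat). tens (a i) (b i) p)" "\<forall>i<m. a i \<in> B \<and> b i \<in> B"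
    unfolding tensor_span_def by auto
  moreover from this(1) have "DJ x = (\<Sum>i<m. tens (a i) (b i))"
    by (simp add: fun_eq_iff sum_fun_apply)
  ultimately show ?thesis using that by blast
qed

lemma slr_DJ_B: "x \<in> B \<Longrightarrow> slr n f (DJ x) \<in> B"
  by (erule DJ_decompose)
     (auto simp: linmap_sum[OF linmap_slr] slr_tens intro!: subsp_sum[OF subsp_B] subspD(3)[OF subsp_B])

lemma sll_DJ_B: "x \<in> B \<Longrightarrow> sll n f (DJ x) \<in> B"
  by (erule DJ_decompose)
     (auto simp: linmap_sum[OF linmap_sll] sll_tens intro!: subsp_sum[OF subsp_B] subspD(3)[OF subsp_B])

text \<open>The functional \<open>f\<close> evaluated at the integral is the trace of \<open>b \<mapsto> f(b\<^sub>1) b\<^sub>2\<close> on \<open>B\<close>. Its counit is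
  the trace of the identity, because the square of \<open>S\<^sup>J\<close> is the identity.\<close>

lemma integral_exists: "\<exists>L\<in>B. eps n L = 1 \<and> (\<forall>x\<in>B. L \<star> x = sc (eps n x) L)"
proof -
  have "B \<subseteq> galg (SG n)" using B_KG by (auto simp: KG_def)
  from echelon_basis[OF finite_SG subsp_B this] obtain S b where
    Sb: "S \<subseteq> SG n \<and> (\<forall>s\<in>S. b s \<in> B) \<and> (\<forall>s\<in>S. \<forall>t\<in>S. b s t = (if s = t then 1 else 0)) \<and>
     (\<forall>x\<in>B. x = (\<Sum>s\<in>S. sc (x s) (b s)))" by (elim exE)
  from Sb have Sb': "S \<subseteq> SG n" "\<forall>s\<in>S. b s \<in> B" "\<forall>s\<in>S. \<forall>t\<in>S. b s t = (if s = t then 1 else 0)"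
    "\<forall>x\<in>B. x = (\<Sum>s\<in>S. sc (x s) (b s))" by (iprover elim: conjE)+
  have S: "s \<in> S \<Longrightarrow> s \<in> SG n" and bB: "s \<in> S \<Longrightarrow> b s \<in> B" and bb: "s \<in> S \<Longrightarrow> b s s = 1" for s
    using Sb'(1-3) by auto
  have exp: "x = (\<Sum>s\<in>S. sc (x s) (b s))" if "x \<in> B" for x
    using Sb'(4) that by (rule bspec)
  have fS: "finite S" using Sb'(1) finite_SG by (rule finite_subset)
  define L where "L = (\<Sum>s\<in>S. slr n (delta s) (DJ (b s)))"
  have LB: "L \<in> B" unfolding L_def by (intro subsp_sum[OF subsp_B] slr_DJ_B bB)
  have epsL: "eps n L = of_nat (card S)"
  proof -
    have "eps n L = (\<Sum>s\<in>S. pr (SG n) (delta s) (sll n (\<lambda>_. 1) (DJ (b s))))"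
      by (simp add: L_def eps_sum) (simp add: eps_def pr_slr_sll)
    also have "\<dots> = (\<Sum>s\<in>S. 1)"
      by (intro sum.cong refl) (simp add: counit_DJ B_KG bB pr_delta_left S bb)
    finally show ?thesis by simp
  qed
  \<comment> \<open>The counit of \<open>L\<close> is dim B, which is invertible in characteristic
    zero as soon as B is nonzero.\<close>
  have "S \<noteq> {}"
  proof
    assume "S = {}"
    with exp[OF B_one] have "one id = 0" by simp
    thus False by (simp add: delta_def)
  qed
  with fS epsL have epsL0: "eps n L \<noteq> 0" by simp
  have "L \<star> x = sc (eps n x) L" if x: "x \<in> B" for x
  proof -
    obtain m y z where DJx: "DJ x = (\<Sum>i<(m::nat). tens (y i) (z i))"
      and yz: "\<forall>i<m. y i \<in> B \<and> z i \<in> B"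
      by (rule DJ_decompose[OF x])
    have yB: "y i \<in> B" and zB: "z i \<in> B" if "i < m" for i
      using yz that by simp_all
    have id1: "tens x one = (\<Sum>i<m. DJ (y i) \<odot> tens one (SJ (z i)))"
      by (rule galois_identity[symmetric, OF B_KG[OF x] DJx]) (auto intro: B_KG yB zB)
    have id2: "(\<Sum>i<m. SJ (z i) \<star> y i) = sc (eps n x) one"
      by (rule antipode_identity[OF B_KG[OF x] DJx]) (auto intro: B_KG yB zB)
    \<comment> \<open>Replacing x \<otimes> 1 by the sum of \<Delta>^J(y_i) (1 \<otimes> S^J(z_i))
      moves \<open>y i\<close> inside the coproduct of the basis vector.\<close>
    have "L \<star> x = (\<Sum>s\<in>S. slr n (delta s) (DJ (b s) \<odot> tens x one))"
      using B_KG[OF x] by (simp add: L_def mulG_sum_left slr_mulGG_tens_right)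
    also have "\<dots> = (\<Sum>s\<in>S. \<Sum>i<m. slr n (delta s) (DJ (b s \<star> y i) \<odot> tens one (SJ (z i))))"
      unfolding id1 mulGG_sum_right linmap_sum[OF linmap_slr]
      by (intro sum.cong refl) (simp add: DJ_mul B_KG bB yB mulGG_assoc)
    finally have Lx: "L \<star> x = (\<Sum>s\<in>S. \<Sum>i<m. slr n (delta s) (DJ (b s \<star> y i) \<odot> tens one (SJ (z i))))" .
    have "(L \<star> x) q = eps n x * L q" if q: "q \<in> SG n" for q
    proof -
      have "(L \<star> x) q = (\<Sum>s\<in>S. \<Sum>i<m. (sll n (delta q) (DJ (b s \<star> y i)) \<star> SJ (z i)) s)"
        unfolding Lx sum_fun_apply
        by (intro sum.cong refl) (simp add: slr_delta S q flip: sll_mulGG_tens_right sll_delta)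
      also have "\<dots> = (\<Sum>i<m. \<Sum>s\<in>S. (sll n (delta q) (DJ (b s \<star> y i)) \<star> SJ (z i)) s)"
        by (rule sum.swap)
      \<comment> \<open>Cyclicity of the trace moves right multiplication by S^J(z_i) inside the
        coproduct, just before \<open>y i\<close>; the sum over i then collapses to \<epsilon>(x) by
        \<open>id2\<close>.\<close>
      also have "\<dots> = (\<Sum>i<m. \<Sum>s\<in>S. sll n (delta q) (DJ (b s \<star> SJ (z i) \<star> y i)) s)"
      proof (rule sum.cong[OF refl])
        fix i assume "i \<in> {..<m}"
        hence i: "y i \<in> B" "SJ (z i) \<in> B" by (simp_all add: yB B_SJ zB)
        show "(\<Sum>s\<in>S. (sll n (delta q) (DJ (b s \<star> y i)) \<star> SJ (z i)) s) =
          (\<Sum>s\<in>S. sll n (delta q) (DJ (b s \<star> SJ (z i) \<star> y i)) s)"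
          by (rule trace_cyclic[of "\<lambda>w. w \<star> SJ (z i)" "\<lambda>w. sll n (delta q) (DJ (w \<star> y i))" S b B])
             (auto intro!: exp linmap_mulG_left linmap_comp[OF linmap_sll] linmap_comp[OF linmap_DJ]
               B_mul sll_DJ_B i bB)
      qed
      also have "\<dots> = (\<Sum>s\<in>S. sll n (delta q) (DJ (b s \<star> (\<Sum>i<m. SJ (z i) \<star> y i))) s)"
        by (subst sum.swap)
           (simp add: mulG_sum_right linmap_sum[OF linmap_DJ] linmap_sum[OF linmap_sll] sum_fun_apply mulG_assoc)
      also have "\<dots> = eps n x * L q"
        unfolding id2 L_def sum_fun_apply sum_distrib_left
        by (intro sum.cong refl) (simp add: mulG_sc_right linmap_sc[OF linmap_DJ] linmap_sc[OF linmap_sll]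
            B_KG bB sll_delta slr_delta S q)
      finally show ?thesis .
    qed
    moreover have "(L \<star> x) q = eps n x * L q" if "q \<notin> SG n" for q
      using that mulG_KG[of n L x] B_KG[OF LB] by (simp add: KG_def galg_def)
    ultimately show ?thesis by (intro ext) (metis sc_apply)
  qed
  hence "sc (1 / eps n L) L \<star> x = sc (eps n x) (sc (1 / eps n L) L)" if "x \<in> B" for x
    using that by (simp add: mulG_sc_left mult.commute)
  moreover have "eps n (sc (1 / eps n L) L) = 1" using epsL0 by (simp add: eps_sc)
  moreover have "sc (1 / eps n L) L \<in> B" using LB by (rule subspD(3)[OF subsp_B])
  ultimately show ?thesis by blast
qed

end

section \<open>The ideal generated by the augmentation ideal of a normal Hopf subalgebra\<close>

text \<open>The functional takes the q-coordinate of x minus its expansion read off at the pivots of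
  V. It kills V, and q is a point where this remainder of y is nonzero.\<close>

lemma separating_functional:
  fixes V :: "('g \<Rightarrow> 'k::field) set"
  assumes X: "finite X" and V: "subsp V" "V \<subseteq> galg X" and y: "y \<in> galg X" "y \<notin> V"
  shows "\<exists>f. (\<forall>x\<in>V. pr X f x = 0) \<and> pr X f y \<noteq> 0"
proof -
  from echelon_basis[OF X V] obtain S b where Sb: "S \<subseteq> X \<and> (\<forall>s\<in>S. b s \<in> V) \<and>
     (\<forall>s\<in>S. \<forall>t\<in>S. b s t = (if s = t then 1 else 0)) \<and> (\<forall>x\<in>V. x = (\<Sum>s\<in>S. sc (x s) (b s)))"
    by (elim exE)
  from Sb have S: "S \<subseteq> X" and bV: "\<forall>s\<in>S. b s \<in> V" and exp: "\<forall>x\<in>V. x = (\<Sum>s\<in>S. sc (x s) (b s))"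
    by (iprover elim: conjE)+
  define z where "z = y - (\<Sum>s\<in>S. sc (y s) (b s))"
  have sV: "(\<Sum>s\<in>S. sc (y s) (b s)) \<in> V"
    using bV by (intro subsp_sum[OF V(1)] subspD(3)[OF V(1)]) auto
  have "z \<noteq> 0" using sV y(2) by (auto simp: z_def)
  then obtain q where q: "z q \<noteq> 0" by (auto simp: fun_eq_iff)
  have "z \<in> galg X" unfolding z_def using sV V(2) y(1) by (intro subspD(4)[OF subsp_galg]) auto
  hence qX: "q \<in> X" using q by (auto simp: galg_def)
  define f where "f = (\<lambda>g. delta q g - (\<Sum>s\<in>S. delta s g * b s q))"
  have pr_f: "pr X f x = x q - (\<Sum>s\<in>S. x s * b s q)" for x
  proof -
    have "pr X f x = (\<Sum>g\<in>X. delta q g * x g) - (\<Sum>g\<in>X. \<Sum>s\<in>S. delta s g * (b s q * x g))"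
      by (simp add: pr_def f_def left_diff_distrib sum_subtractf sum_distrib_right mult.assoc)
    also have "(\<Sum>g\<in>X. \<Sum>s\<in>S. delta s g * (b s q * x g)) = (\<Sum>s\<in>S. b s q * x s)"
      using S X by (subst sum.swap) (intro sum.cong refl, simp add: sum_delta_mult subset_iff)
    finally show ?thesis using X qX by (simp add: sum_delta_mult mult.commute[of "b _ q"])
  qed
  have "pr X f x = 0" if "x \<in> V" for x
  proof -
    have "x = (\<Sum>s\<in>S. sc (x s) (b s))" using exp that by (rule bspec)
    from fun_cong[OF this, of q] show ?thesis unfolding pr_f by (simp add: sum_fun_apply)
  qed
  moreover have "pr X f y \<noteq> 0" using q unfolding pr_f by (simp add: z_def sum_fun_apply)
  ultimately show ?thesis by blast
qed

lemma act_KG [simp]: "act n T y \<in> KG n"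
  unfolding act_def lext_def by (intro subsp_sum subspD(3) subsp_KG mulG_KG)

lemma pr_mulG_left:
  assumes "x \<in> KG n"
  shows "pr (SG n) (\<lambda>p. pr (SG n) f (mulG n a (delta p))) x = pr (SG n) f (mulG n a x)"
  by (subst linmap_expand[OF finite_SG linmap_mulG_right assms[unfolded KG_def]])
     (simp add: pr_sum pr_sc pr_def[of _ _ x] mult.commute)

lemma pr_mulG_right:
  assumes "x \<in> KG n"
  shows "pr (SG n) (\<lambda>p. pr (SG n) f (mulG n (delta p) a)) x = pr (SG n) f (mulG n x a)"
  by (subst linmap_expand[OF finite_SG linmap_mulG_left assms[unfolded KG_def]])
     (simp add: pr_sum pr_sc pr_def[of _ _ x] mult.commute)

text \<open>A factor on the first leg is absorbed into the functional as a translation, while a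
  factor on the second leg comes out of the slice.\<close>

lemma sll_tens_mulGG:
  assumes "a \<in> KG n" "b \<in> KG n" "T \<in> galg (SG n \<times> SG n)"
  shows "sll n f (mulGG n (tens a b) T) = mulG n b (sll n (\<lambda>p. pr (SG n) f (mulG n a (delta p))) T)"
    "sll n f (mulGG n T (tens a b)) = mulG n (sll n (\<lambda>p. pr (SG n) f (mulG n (delta p) a)) T) b"
proof -
  show "sll n f (mulGG n (tens a b) T) = mulG n b (sll n (\<lambda>p. pr (SG n) f (mulG n a (delta p))) T)"
  proof (rule linmap_eqI[OF _ _ _ _ assms(3)])
    fix g assume "g \<in> SG n \<times> SG n"
    thus "sll n f (mulGG n (tens a b) (delta g)) = mulG n b (sll n (\<lambda>p. pr (SG n) f (mulG n a (delta p))) (delta g))"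
      using assms by (cases g) (simp add: delta_pair mulGG_tens sll_tens mulG_sc_right pr_delta)
  qed (auto intro!: linmap_comp[OF linmap_sll linmap_mulGG_right] linmap_comp[OF linmap_mulG_right linmap_sll])
  show "sll n f (mulGG n T (tens a b)) = mulG n (sll n (\<lambda>p. pr (SG n) f (mulG n (delta p) a)) T) b"
  proof (rule linmap_eqI[OF _ _ _ _ assms(3)])
    fix g assume "g \<in> SG n \<times> SG n"
    thus "sll n f (mulGG n (delta g) (tens a b)) = mulG n (sll n (\<lambda>p. pr (SG n) f (mulG n (delta p) a)) (delta g)) b"
      using assms by (cases g) (simp add: delta_pair mulGG_tens sll_tens mulG_sc_left pr_delta)
  qed (auto intro!: linmap_comp[OF linmap_sll linmap_mulGG_left] linmap_comp[OF linmap_mulG_left linmap_sll])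
qed

locale normal_sub = hopf_sub n \<omega> B
  for n :: nat and \<omega> :: "(perm \<Rightarrow> 'k::field_char_0) \<Rightarrow> (perm \<Rightarrow> 'k) \<Rightarrow> 'k" and B +
  fixes L :: "perm \<Rightarrow> 'k"
  assumes normal: "h \<in> KG n \<Longrightarrow> x \<in> B \<Longrightarrow> adjJ n J h x \<in> B"
    and L_B: "L \<in> B" and eps_L: "eps n L = 1" and L_int: "x \<in> B \<Longrightarrow> L \<star> x = sc (eps n x) L"
begin

text \<open>\<open>I\<close> is the ideal \<open>B\<^sup>+ A\<close>, generated by \<open>E = 1 - L\<close>.\<close>

definition E where "E = one - L"
definition I where "I = {x \<in> KG n. L \<star> x = 0}"

lemma L_KG [simp]: "L \<in> KG n" by (rule B_KG[OF L_B])

lemma E_B: "E \<in> B" unfolding E_def by (intro subspD(4)[OF subsp_B] B_one L_B)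

lemma E_KG [simp]: "E \<in> KG n" by (rule B_KG[OF E_B])

lemma eps_E: "eps n E = 0" by (simp add: E_def eps_diff eps_L)

lemma I_KG: "x \<in> I \<Longrightarrow> x \<in> KG n" by (simp add: I_def)

lemma subsp_I: "subsp I"
  using subspD[OF subsp_KG[of n]]
  by (auto simp: subsp_def I_def linmap_zero[OF linmap_mulG_right] linmap_add[OF linmap_mulG_right] mulG_sc_right)

lemma augmentation_I: "x \<in> B \<Longrightarrow> eps n x = 0 \<Longrightarrow> x \<in> I"
  by (simp add: I_def L_int B_KG)

lemma E_I: "E \<in> I" by (rule augmentation_I[OF E_B eps_E])

lemma I_right: "x \<in> I \<Longrightarrow> x \<star> a \<in> I"
  by (simp add: I_def linmap_zero[OF linmap_mulG_left] flip: mulG_assoc)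

text \<open>\<open>L\<close> kills I, so \<open>E\<close> is a left unit on it; together with
  \<open>E_I\<close> this makes I the right ideal generated by \<open>E\<close>.\<close>

lemma E_mul: "x \<in> I \<Longrightarrow> E \<star> x = x"
  by (simp add: E_def I_def linmap_diff[OF linmap_mulG_left])

lemma eps_I: "x \<in> I \<Longrightarrow> eps n x = 0"
  using eps_mulG[of n L x] by (simp add: I_def eps_L) (simp add: eps_def)

text \<open>This is where normality is used: the adjoint action of h sends E into B with counit 0,
  hence into I, and v^-1 on the right removes the trailing v.\<close>

lemma act_DJ_E: "h \<in> KG n \<Longrightarrow> act n (DJ h) (E \<star> vi) \<in> I"
proof -
  assume "h \<in> KG n"
  from normal[OF this E_B] have "act n (DJ h) (E \<star> vi) \<star> v \<in> B" by (simp add: adjJ_eq)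
  moreover have "eps n (act n (DJ h) (E \<star> vi) \<star> v) = 0"
    by (simp add: eps_mulG eps_act eps_E)
  ultimately have "act n (DJ h) (E \<star> vi) \<star> v \<star> vi \<in> I" by (intro I_right augmentation_I)
  thus ?thesis by (simp add: mulG_assoc v_inverse)
qed

text \<open>J lies in the commutative algebra kH \<otimes> kH, so conjugation by it fixes h
  \<otimes> h.\<close>

lemma DJ_HH: "h \<in> HH \<Longrightarrow> DJ (delta h) = tens (delta h) (delta h)"
proof -
  assume h: "h \<in> HH"
  have t: "tens (delta h) (delta h) = D2 (\<lambda>\<alpha> \<beta>. \<alpha> h * \<beta> h :: 'k)"
    by (simp add: delta_D1 h tens_D1)
  have "DJ (delta h) = D2 (\<lambda>\<alpha> \<beta>. 1 / \<omega> \<alpha> \<beta> * (\<alpha> h * \<beta> h) * \<omega> \<alpha> \<beta>)"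
    using HH_SG[OF n4 h] n4 by (simp add: DJ_eq t Ji_def J_D2 D2_mult)
  also have "\<dots> = tens (delta h) (delta h)"
    unfolding t by (rule D2_cong) (simp add: omega_nz)
  finally show ?thesis .
qed

text \<open>By normality h (E v^-1) h^-1 lies in the right ideal I; multiplying it on the right by h
  v x leaves h E x = h x.\<close>

lemma I_left_HH: "h \<in> HH \<Longrightarrow> x \<in> I \<Longrightarrow> delta h \<star> x \<in> I"
proof -
  assume h: "h \<in> HH" and x: "x \<in> I"
  note hG = HH_SG[OF n4 h]
  have "act n (tens (delta h) (delta h)) (E \<star> vi) \<in> I"
    using act_DJ_E[of "delta h"] hG by (simp add: DJ_HH h)
  hence "delta h \<star> (E \<star> vi) \<star> delta (inv h) \<in> I" using hG by (simp add: act_tens)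
  hence "delta h \<star> (E \<star> vi) \<star> delta (inv h) \<star> (delta h \<star> (v \<star> x)) \<in> I" by (rule I_right)
  also have "delta h \<star> (E \<star> vi) \<star> delta (inv h) \<star> (delta h \<star> (v \<star> x))
     = delta h \<star> (E \<star> (vi \<star> ((delta (inv h) \<star> delta h) \<star> (v \<star> x))))"
    by (simp only: mulG_assoc)
  also have "\<dots> = delta h \<star> (E \<star> ((vi \<star> v) \<star> x))" using hG by (simp add: mulG_assoc)
  also have "\<dots> = delta h \<star> x" using x by (simp add: v_inverse I_KG E_mul)
  finally show ?thesis .
qed

lemma I_left_idem: "\<alpha> \<in> chars HH \<Longrightarrow> x \<in> I \<Longrightarrow> idem HH \<alpha> \<star> x \<in> I"
  unfolding idem_expand mulG_sum_left mulG_sc_left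
  by (intro subsp_sum[OF subsp_I] subspD(3)[OF subsp_I] I_left_HH)

lemma act_D2: "act n (D2 F) x = (\<Sum>\<alpha>\<in>chars HH. \<Sum>\<beta>\<in>chars HH. sc (F \<alpha> \<beta>) (idem HH \<alpha> \<star> x \<star> idem HH \<beta>))"
  unfolding D2_def linmap_sum[OF linmap_act(1)] linmap_sc[OF linmap_act(1)]
  using n4 by (intro sum.cong refl) (simp add: act_tens idem_KG antipG_idem)

lemma act_D2_I: "x \<in> I \<Longrightarrow> act n (D2 F) x \<in> I"
  unfolding act_D2
  by (intro subsp_sum[OF subsp_I] subspD(3)[OF subsp_I] I_right I_left_idem)

text \<open>\<open>\<Delta>\<^sup>J(g)\<close> equals \<open>J\<^sup>-\<^sup>1 (g \<otimes> g) J\<close>, and \<open>I\<close> is stable under \<open>J\<close>, so \<open>g Y\<close> lies in \<open>I\<close> for every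
  \<open>g\<close>. The elements with the latter property form a two-sided ideal, so \<open>J\<^sup>-\<^sup>1\<close> may be applied.\<close>

lemma I_left:
  assumes a: "a \<in> KG n" and x: "x \<in> I"
  shows "a \<star> x \<in> I"
proof -
  define Y where "Y = act n J (E \<star> vi)"
  have Y_KG: "Y \<in> KG n" by (simp add: Y_def)
  have gY: "delta g \<star> Y \<in> I" if g: "g \<in> SG n" for g
  proof -
    have "act n J (act n (DJ (delta g)) (E \<star> vi)) \<in> I"
      unfolding J_D2 by (intro act_D2_I act_DJ_E delta_KG g)
    also have "act n J (act n (DJ (delta g)) (E \<star> vi)) = act n (J \<odot> DJ (delta g)) (E \<star> vi)"
      by (simp add: act_mulGG)
    also have "J \<odot> DJ (delta g) = (J \<odot> Ji) \<odot> comultG n (delta g) \<odot> J"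
      by (simp add: DJ_eq mulGG_assoc)
    also have "\<dots> = comultG n (delta g) \<odot> J" by (simp add: J_inverse)
    also have "act n (comultG n (delta g) \<odot> J) (E \<star> vi) = delta g \<star> Y \<star> delta (inv g)"
      using g by (simp add: act_mulGG Y_def act_tens)
    finally have "delta g \<star> Y \<star> delta (inv g) \<star> delta g \<in> I" by (rule I_right)
    thus ?thesis using g by (simp add: mulG_assoc Y_KG)
  qed
  have aY: "b \<star> Y \<in> I" if "b \<in> KG n" for b
    by (rule linmap_in_subsp[OF finite_SG linmap_mulG_left subsp_I gY that[unfolded KG_def]])
  have "E \<star> vi = act n (Ji \<odot> J) (E \<star> vi)"
    by (simp add: J_inverse delta_pair act_tens)
  also have "\<dots> = act n Ji Y" by (simp add: act_mulGG Y_def)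
  finally have "a \<star> (E \<star> vi) = (\<Sum>\<alpha>\<in>chars HH. \<Sum>\<beta>\<in>chars HH.
      sc (1 / \<omega> \<alpha> \<beta>) (a \<star> idem HH \<alpha> \<star> Y \<star> idem HH \<beta>))"
    by (simp add: Ji_def act_D2 mulG_sum_right mulG_sc_right mulG_assoc)
  also have "\<dots> \<in> I"
    by (intro subsp_sum[OF subsp_I] subspD(3)[OF subsp_I] I_right aY mulG_KG)
  finally have "a \<star> (E \<star> vi) \<star> (v \<star> x) \<in> I" by (rule I_right)
  also have "a \<star> (E \<star> vi) \<star> (v \<star> x) = a \<star> (E \<star> ((vi \<star> v) \<star> x))" by (simp only: mulG_assoc)
  also have "\<dots> = a \<star> x" using x by (simp add: v_inverse I_KG E_mul)
  finally show ?thesis .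
qed

section \<open>I as a coideal for the untwisted coproduct\<close>

definition annih where "annih f \<longleftrightarrow> (\<forall>x\<in>I. pr (SG n) f x = 0)"
text \<open>This is I \<otimes> A + A \<otimes> I, described through slices by the functionals that
  annihilate I.\<close>

definition W where "W = {T \<in> galg (SG n \<times> SG n). \<forall>f. annih f \<longrightarrow> sll n f T \<in> I}"

lemma subsp_W: "subsp W"
  using subspD[OF subsp_galg[of "SG n \<times> SG n"]] subspD[OF subsp_I]
  by (auto simp: subsp_def W_def linmap_zero[OF linmap_sll] linmap_add[OF linmap_sll] linmap_sc[OF linmap_sll])

lemma W_left: "S \<in> galg (SG n \<times> SG n) \<Longrightarrow> T \<in> W \<Longrightarrow> S \<odot> T \<in> W"
proof (rule linmap_in_subsp[OF _ linmap_mulGG_left subsp_W])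
  fix g assume T: "T \<in> W" and "g \<in> SG n \<times> SG n"
  then obtain p q where g: "g = (p, q)" "p \<in> SG n" "q \<in> SG n" by auto
  \<comment> \<open>Left stability of I keeps translated functionals in the annihilator.\<close>
  have "annih (\<lambda>r. pr (SG n) f (delta p \<star> delta r))" if "annih f" for f
    using that g by (simp add: annih_def pr_mulG_left I_KG I_left del: mulG_delta_delta)
  thus "delta g \<odot> T \<in> W"
    using T g by (auto simp: W_def delta_pair sll_tens_mulGG I_left simp del: mulG_delta_delta)
qed auto

lemma W_right: "S \<in> galg (SG n \<times> SG n) \<Longrightarrow> T \<in> W \<Longrightarrow> T \<odot> S \<in> W"
proof (rule linmap_in_subsp[OF _ linmap_mulGG_right subsp_W])
  fix g assume T: "T \<in> W" and "g \<in> SG n \<times> SG n"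
  then obtain p q where g: "g = (p, q)" "p \<in> SG n" "q \<in> SG n" by auto
  have "annih (\<lambda>r. pr (SG n) f (delta r \<star> delta p))" if "annih f" for f
    using that g by (simp add: annih_def pr_mulG_right I_KG I_right del: mulG_delta_delta)
  thus "T \<odot> delta g \<in> W"
    using T g by (auto simp: W_def delta_pair sll_tens_mulGG I_right simp del: mulG_delta_delta)
qed auto

text \<open>On B a functional \<open>f\<close> annihilating I is f(1) times the counit, because b -
  \<epsilon>(b) 1 lies in I. The counit axiom then evaluates the slice of \<Delta>^J(E) to f(1)
  E.\<close>

lemma DJ_E_W: "DJ E \<in> W"
proof -
  obtain m a b where DJE: "DJ E = (\<Sum>i<(m::nat). tens (a i) (b i))"
    and ab: "\<forall>i<m. a i \<in> B \<and> b i \<in> B" by (rule DJ_decompose[OF E_B])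
  have "sll n f (DJ E) \<in> I" if f: "annih f" for f
  proof -
    have pra: "pr (SG n) f (a i) = eps n (a i) * pr (SG n) f one" if i: "i < m" for i
    proof -
      have "a i - sc (eps n (a i)) one \<in> I"
        using ab i by (intro augmentation_I subspD(4)[OF subsp_B] subspD(3)[OF subsp_B] B_one)
          (simp_all add: eps_diff eps_sc)
      hence "pr (SG n) f (a i - sc (eps n (a i)) one) = 0" using f by (simp add: annih_def)
      thus ?thesis by (simp add: pr_diff pr_sc)
    qed
    have "sll n f (DJ E) = sc (pr (SG n) f one) (\<Sum>i<m. sc (eps n (a i)) (b i))"
      unfolding DJE linmap_sum[OF linmap_sll] sll_tens sc_sum_right
      by (intro sum.cong refl) (simp add: pra mult.commute)
    also have "(\<Sum>i<m. sc (eps n (a i)) (b i)) = sll n (\<lambda>_. 1) (DJ E)"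
      unfolding DJE linmap_sum[OF linmap_sll] sll_tens eps_def ..
    also have "\<dots> = E" by (simp add: counit_DJ)
    finally have "sll n f (DJ E) = sc (pr (SG n) f one) E" .
    thus ?thesis using subspD(3)[OF subsp_I E_I] by metis
  qed
  thus ?thesis by (simp add: W_def)
qed

text \<open>\<Delta>(E) is conjugate to \<Delta>^J(E) under J, hence in the two-sided ideal
  \<open>W\<close>; then so is \<Delta>(x) = \<Delta>(E) \<Delta>(x), as E x = x.\<close>

lemma coideal: "x \<in> I \<Longrightarrow> annih f \<Longrightarrow> (\<lambda>g. f g * x g) \<in> I"
proof -
  assume x: "x \<in> I" and f: "annih f"
  have "comultG n E \<in> W"
    unfolding comultG_DJ[of E] by (intro W_left W_right DJ_E_W in_alg)
  hence "comultG n E \<odot> comultG n x \<in> W" by (intro W_right comultG_galg)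
  also have "comultG n E \<odot> comultG n x = comultG n x"
    using x by (simp add: comultG_mulG[symmetric] I_KG E_mul)
  finally have "sll n f (comultG n x) \<in> I" using f by (simp add: W_def)
  thus ?thesis using x by (simp add: sll_comultG I_KG)
qed

text \<open>In a nonzero element of \<open>I\<close> with minimal support, functionals vanishing on \<open>I\<close> do not
  separate points of the support.\<close>

lemma I_difference:
  assumes "I \<noteq> {0}"
  shows "\<exists>g0\<in>SG n. \<exists>g1\<in>SG n. g0 \<noteq> g1 \<and> delta g0 - delta g1 \<in> I"
proof -
  let ?supp = "\<lambda>x :: perm \<Rightarrow> 'k. {g. x g \<noteq> 0}"
  obtain x0 where "x0 \<in> I \<and> x0 \<noteq> 0" using assms subspD(1)[OF subsp_I] by auto
  from ex_has_least_nat[of "\<lambda>x. x \<in> I \<and> x \<noteq> 0", OF this, of "\<lambda>x. card (?supp x)"]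
  obtain x where x: "x \<in> I" "x \<noteq> 0" and least: "\<And>y. y \<in> I \<Longrightarrow> y \<noteq> 0 \<Longrightarrow> card (?supp x) \<le> card (?supp y)"
    by blast
  have supp: "?supp x \<subseteq> SG n" using I_KG[OF x(1)] by (auto simp: KG_def galg_def)
  obtain g0 where g0: "x g0 \<noteq> 0" using x(2) by (auto simp: fun_eq_iff)
  have g0G: "g0 \<in> SG n" using supp g0 by auto
  \<comment> \<open>A one-point support is impossible since the counit vanishes on I.\<close>
  have "\<exists>g1. g1 \<noteq> g0 \<and> x g1 \<noteq> 0"
  proof (rule ccontr)
    assume "\<nexists>g1. g1 \<noteq> g0 \<and> x g1 \<noteq> 0"
    hence "x = sc (x g0) (delta g0)" by (intro ext) (auto simp: delta_def)
    hence "eps n x = x g0" using g0G by (metis eps_sc eps_delta mult_1_right)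
    thus False using eps_I[OF x(1)] g0 by simp
  qed
  then obtain g1 where g1: "g1 \<noteq> g0" "x g1 \<noteq> 0" by blast
  have g1G: "g1 \<in> SG n" using supp g1 by auto
  have const: "f g1 = f g0" if f: "annih f" for f
  proof (rule ccontr)
    assume ne: "f g1 \<noteq> f g0"
    \<comment> \<open>Again an element of I, nonzero at \<open>g1\<close>, but with
      \<open>g0\<close> removed from the support of \<open>x\<close>.\<close>
    let ?y = "(\<lambda>g. f g * x g) - sc (f g0) x"
    have "?y \<in> I" by (intro subspD(3,4)[OF subsp_I] coideal x f)
    moreover have "?y g1 \<noteq> 0" using ne g1 by (simp flip: left_diff_distrib)
    hence "?y \<noteq> 0" by (metis zero_fun_apply)
    ultimately have "card (?supp x) \<le> card (?supp ?y)" by (intro least)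
    also have "\<dots> < card (?supp x)"
      using g0 by (intro psubset_card_mono finite_subset[OF supp]) auto
    finally show False by simp
  qed
  have "delta g0 - delta g1 \<in> I"
  proof (rule ccontr)
    assume nI: "delta g0 - delta g1 \<notin> I"
    have "delta g0 - delta g1 \<in> galg (SG n)"
      by (intro subspD(4)[OF subsp_galg] delta_galg g0G g1G)
    moreover have "I \<subseteq> galg (SG n)" using I_KG by (auto simp: KG_def)
    ultimately have "\<exists>f. (\<forall>x\<in>I. pr (SG n) f x = 0) \<and> pr (SG n) f (delta g0 - delta g1) \<noteq> 0"
      by (intro separating_functional[OF finite_SG subsp_I _ _ nI])
    then obtain f where "(\<forall>x\<in>I. pr (SG n) f x = 0) \<and> pr (SG n) f (delta g0 - delta g1) \<noteq> 0" ..
    thus False using const[of f] by (simp add: annih_def pr_diff pr_delta g0G g1G)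
  qed
  with not_sym[OF g1(1)] show ?thesis by (intro bexI[OF _ g0G] bexI[OF _ g1G] conjI)
qed

lemma B_trivial:
  assumes "I = {0}"
  shows "B = {sc c one | c. True}"
proof -
  have "L = one" using E_I assms by (simp add: E_def)
  have "x \<in> {sc c one | c. True}" if "x \<in> B" for x
  proof -
    have "x = L \<star> x" using that \<open>L = one\<close> by (simp add: B_KG)
    also have "\<dots> = sc (eps n x) one" using L_int[OF that] \<open>L = one\<close> by simp
    finally show ?thesis by blast
  qed
  moreover have "sc c one \<in> B" for c by (rule subspD(3)[OF subsp_B B_one])
  ultimately show ?thesis by blast
qed

end

section \<open>Normal subgroups of the symmetric group\<close>

lemma transpose_SG: "a \<in> {1..n} \<Longrightarrow> b \<in> {1..n} \<Longrightarrow> transpose a b \<in> SG n"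
  by (simp add: SG_def permutes_swap_id)

lemma conj_transpose:
  assumes "s \<in> SG n"
  shows "s \<circ> transpose a b \<circ> inv s = transpose (s a) (s b)"
proof -
  have b: "bij s" using assms by (auto simp: SG_def permutes_bij)
  show ?thesis
  proof
    fix x
    show "(s \<circ> transpose a b \<circ> inv s) x = transpose (s a) (s b) x"
      using b by (auto simp: transpose_def bij_inv_eq_iff bij_is_inj inv_f_f bij_is_surj surj_f_inv_f)
  qed
qed

lemma transpose_conj_left:
  assumes "s \<in> SG n"
  shows "s \<circ> transpose a b = transpose (s a) (s b) \<circ> s"
proof -
  have "transpose (s a) (s b) \<circ> s = s \<circ> transpose a b \<circ> (inv s \<circ> s)"
    unfolding conj_transpose[OF assms, symmetric] by (simp only: comp_assoc)
  thus ?thesis using assms by simp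
qed

lemma ex_triple_perm:
  assumes "{a, b, c, a', b', c'} \<subseteq> {1..n}" "a \<noteq> b" "a \<noteq> c" "b \<noteq> c" "a' \<noteq> b'" "a' \<noteq> c'" "b' \<noteq> c'"
  shows "\<exists>s\<in>SG n. s a = a' \<and> s b = b' \<and> s c = c'"
proof -
  have tr: "transpose p q r \<in> {1..n}" if "p \<in> {1..n}" "q \<in> {1..n}" "r \<in> {1..n}" for p q r
    using that by (auto simp: transpose_def)
  define s1 where "s1 = transpose a a'"
  define s2 where "s2 = transpose (s1 b) b'"
  define s3 where "s3 = transpose (s2 (s1 c)) c'"
  have i: "s1 b \<noteq> a'" "s1 c \<noteq> a'" "s1 b \<noteq> s1 c" "s1 a = a'"
    using assms(2-4) by (auto simp: s1_def transpose_def)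
  have j: "s2 a' = a'" "s2 (s1 b) = b'" "s2 (s1 c) \<noteq> a'" "s2 (s1 c) \<noteq> b'"
    using i assms(5) by (auto simp: s2_def transpose_def)
  have k: "s3 a' = a'" "s3 b' = b'" "s3 (s2 (s1 c)) = c'"
    using j assms(5-7) unfolding s3_def by (simp_all add: transpose_apply_other not_sym)
  have m: "s1 b \<in> {1..n}" "s1 c \<in> {1..n}" unfolding s1_def using assms by (intro tr; simp)+
  hence m2: "s2 (s1 c) \<in> {1..n}" unfolding s2_def using assms by (intro tr) simp_all
  have "s1 \<in> SG n" unfolding s1_def using assms(1) by (intro transpose_SG) simp_all
  moreover have "s2 \<in> SG n" unfolding s2_def using assms(1) m by (intro transpose_SG) simp_all
  moreover have "s3 \<in> SG n" unfolding s3_def using assms(1) m2 by (intro transpose_SG) simp_all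
  ultimately have "s3 \<circ> s2 \<circ> s1 \<in> SG n" by (intro comp_SG)
  thus ?thesis using i j k by (intro bexI[of _ "s3 \<circ> s2 \<circ> s1"]) simp_all
qed

locale normal_subgroup =
  fixes n :: nat and N :: "perm set"
  assumes n5: "n \<ge> 5" and N_SG: "N \<subseteq> SG n" and N_id: "id \<in> N"
    and N_comp: "x \<in> N \<Longrightarrow> y \<in> N \<Longrightarrow> x \<circ> y \<in> N"
    and N_inv: "x \<in> N \<Longrightarrow> inv x \<in> N"
    and N_conj: "x \<in> N \<Longrightarrow> s \<in> SG n \<Longrightarrow> s \<circ> x \<circ> inv s \<in> N"
begin

lemma ex_other: "finite T \<Longrightarrow> card T \<le> 4 \<Longrightarrow> \<exists>e\<in>{1..n}. e \<notin> T"
proof (rule ccontr)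
  assume T: "finite T" "card T \<le> 4" and "\<not> (\<exists>e\<in>{1..n}. e \<notin> T)"
  hence "{1..n} \<subseteq> T" by auto
  from card_mono[OF T(1) this] T(2) n5 show False by simp
qed

text \<open>The commutator of g with (a c) is (b d)(a c), where b = g a and d = g c. If d is a or c
  it is a 3-cycle; otherwise multiplying by its conjugate under (d e), with a fifth point e, cancels
  (a c) and leaves (b d)(b e).\<close>

lemma ex_three_cycle:
  assumes g: "g \<in> N" "g \<noteq> id"
  shows "\<exists>a b c. {a, b, c} \<subseteq> {1..n} \<and> a \<noteq> b \<and> a \<noteq> c \<and> b \<noteq> c \<and> transpose a b \<circ> transpose a c \<in> N"
proof -
  have gS: "g \<in> SG n" using g N_SG by auto
  have gp: "g permutes {1..n}" using gS by (simp add: SG_def)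
  have ginj: "g x = g y \<longleftrightarrow> x = y" for x y using permutes_inj[OF gp] by (auto dest: injD)
  obtain a where a: "g a \<noteq> a" using g(2) by (auto simp: fun_eq_iff)
  have an: "a \<in> {1..n}" using a permutes_not_in[OF gp] by auto
  define b where "b = g a"
  have bn: "b \<in> {1..n}" unfolding b_def using permutes_in_image[OF gp] an by blast
  have "card {a, b} \<le> 4" using card_insert_le_m1[of 4 "{b}" a] by (simp add: card_insert_if)
  then obtain c where c: "c \<in> {1..n}" "c \<noteq> a" "c \<noteq> b" using ex_other[of "{a, b}"] by auto
  define d where "d = g c"
  have dn: "d \<in> {1..n}" unfolding d_def using permutes_in_image[OF gp] c by blast
  have db: "d \<noteq> b" unfolding d_def b_def using c by (simp add: ginj)
  have ab: "a \<noteq> b" using a by (simp add: b_def)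
  let ?t = "transpose a c"
  have t: "?t \<in> SG n" using an c by (intro transpose_SG)
  have "?t \<circ> inv g \<circ> inv ?t \<in> N" by (intro N_conj N_inv g t)
  hence "g \<circ> (?t \<circ> inv g \<circ> inv ?t) \<in> N" by (rule N_comp[OF g(1)])
  also have "g \<circ> (?t \<circ> inv g \<circ> inv ?t) = (g \<circ> ?t \<circ> inv g) \<circ> ?t" by (simp add: comp_assoc)
  also have "\<dots> = transpose b d \<circ> ?t" unfolding conj_transpose[OF gS] by (simp add: b_def d_def)
  finally have x: "transpose b d \<circ> transpose a c \<in> N" .
  consider "d = a" | "d = c" | "d \<noteq> a" "d \<noteq> c" by blast
  thus ?thesis
  proof cases
    case 1
    hence "transpose a b \<circ> transpose a c \<in> N" using x by (simp add: transpose_commute)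
    thus ?thesis using an bn c ab by (intro exI[of _ a] exI[of _ b] exI[of _ c]) auto
  next
    case 2
    hence "transpose c b \<circ> transpose c a \<in> N" using x by (simp add: transpose_commute)
    thus ?thesis using an bn c ab by (intro exI[of _ c] exI[of _ b] exI[of _ a]) auto
  next
    case 3
    have "card {a, b, c, d} \<le> 4" by (simp add: card_insert_if)
    then obtain e where e: "e \<in> {1..n}" "e \<noteq> a" "e \<noteq> b" "e \<noteq> c" "e \<noteq> d"
      using ex_other[of "{a, b, c, d}"] by auto
    let ?s = "transpose d e"
    have s: "?s \<in> SG n" using dn e by (intro transpose_SG)
    have "?s \<circ> (transpose b d \<circ> transpose a c) \<circ> inv ?s \<in> N" by (rule N_conj[OF x s])
    hence "(transpose b d \<circ> transpose a c) \<circ> (?s \<circ> (transpose b d \<circ> transpose a c) \<circ> inv ?s) \<in> N"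
      by (rule N_comp[OF x])
    also have "(transpose b d \<circ> transpose a c) \<circ> (?s \<circ> (transpose b d \<circ> transpose a c) \<circ> inv ?s)
      = transpose b d \<circ> transpose b e"
    proof -
      have "?s \<circ> (transpose b d \<circ> transpose a c) \<circ> inv ?s = transpose b e \<circ> transpose a c"
        using e 3 ab c db by (auto simp: fun_eq_iff transpose_def)
      thus ?thesis using e 3 ab c db by (auto simp: fun_eq_iff transpose_def)
    qed
    finally have "transpose b d \<circ> transpose b e \<in> N" .
    moreover have "{b, d, e} \<subseteq> {1..n}" "b \<noteq> d" "b \<noteq> e" "d \<noteq> e" using bn dn e db by auto
    ultimately show ?thesis by blast
  qed
qed

lemma three_cycles:
  assumes "g \<in> N" "g \<noteq> id" "{a, b, c} \<subseteq> {1..n}" "a \<noteq> b" "a \<noteq> c" "b \<noteq> c"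
  shows "transpose a b \<circ> transpose a c \<in> N"
proof -
  obtain p q r where pqr: "{p, q, r} \<subseteq> {1..n}" "p \<noteq> q" "p \<noteq> r" "q \<noteq> r" "transpose p q \<circ> transpose p r \<in> N"
    using ex_three_cycle[OF assms(1,2)] by blast
  obtain s where s: "s \<in> SG n" "s p = a" "s q = b" "s r = c"
    using ex_triple_perm[of p q r a b c n] pqr assms by auto
  have "s \<circ> (transpose p q \<circ> transpose p r) \<circ> inv s \<in> N" by (rule N_conj[OF pqr(5) s(1)])
  also have "s \<circ> (transpose p q \<circ> transpose p r) \<circ> inv s = s \<circ> transpose p q \<circ> (transpose p r \<circ> inv s)"
    by (simp only: comp_assoc)
  also have "\<dots> = transpose (s p) (s q) \<circ> (s \<circ> transpose p r \<circ> inv s)"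
    unfolding transpose_conj_left[OF s(1), of p q] by (simp only: comp_assoc)
  also have "\<dots> = transpose a b \<circ> transpose a c"
    unfolding conj_transpose[OF s(1)] by (simp add: s)
  finally show ?thesis .
qed

text \<open>Two transpositions sharing a point give a 3-cycle or the identity. In the disjoint case,
  inserting (a c)(c a) in the middle splits the product into two such pairs.\<close>

lemma double_transpositions:
  assumes "g \<in> N" "g \<noteq> id" "{a, b, c, d} \<subseteq> {1..n}" "a \<noteq> b" "c \<noteq> d"
  shows "transpose a b \<circ> transpose c d \<in> N"
proof -
  note tc = three_cycles[OF assms(1,2)]
  have share: "transpose x y \<circ> transpose x z \<in> N" if "{x, y, z} \<subseteq> {1..n}" "x \<noteq> y" "x \<noteq> z" for x y z
    using tc[of x y z] that N_id by (cases "y = z") auto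
  consider "a = c" | "a = d" | "b = c" | "b = d" | "a \<notin> {c, d}" "b \<notin> {c, d}" by blast
  thus ?thesis
  proof cases
    case 5
    have "transpose a b \<circ> transpose a c \<in> N" "transpose c a \<circ> transpose c d \<in> N"
      using 5 assms by (auto intro!: share)
    hence "(transpose a b \<circ> transpose a c) \<circ> (transpose c a \<circ> transpose c d) \<in> N" by (rule N_comp)
    also have "(transpose a b \<circ> transpose a c) \<circ> (transpose c a \<circ> transpose c d)
       = transpose a b \<circ> (transpose a c \<circ> transpose a c) \<circ> transpose c d"
      by (simp only: comp_assoc transpose_commute[of c a])
    also have "\<dots> = transpose a b \<circ> transpose c d" by simp
    finally show ?thesis .
  qed (use share[of a b d] share[of a b c] share[of b a d] share[of b a c] assms
      in \<open>auto simp: transpose_commute\<close>)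
qed

lemma even_in_N:
  assumes g: "g \<in> N" "g \<noteq> id" and p: "p \<in> SG n" "evenperm p"
  shows "p \<in> N"
proof -
  note dt = double_transpositions[OF g]
  have "p permutes {1..n}" using p(1) by (simp add: SG_def)
  \<comment> \<open>The odd case is strengthened to all transpositions: an even p then passes to the
    next step through a double transposition, and an odd p by direct use of the hypothesis.\<close>
  from this finite_atLeastAtMost have "(evenperm p \<longrightarrow> p \<in> N) \<and>
     (\<not> evenperm p \<longrightarrow> (\<forall>a\<in>{1..n}. \<forall>b\<in>{1..n}. a \<noteq> b \<longrightarrow> transpose a b \<circ> p \<in> N))"
  proof (induction p rule: permutes_induct)
    case (swap a b p)
    have pp: "permutation p" using swap.hyps by (auto simp: permutation_permutes)
    have ev: "evenperm (transpose a b \<circ> p) \<longleftrightarrow> \<not> evenperm p"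
      using swap.hyps(3) pp by (simp add: evenperm_comp permutation_swap_id evenperm_swap)
    have "transpose c d \<circ> (transpose a b \<circ> p) \<in> N"
      if "evenperm p" "c \<in> {1..n}" "d \<in> {1..n}" "c \<noteq> d" for c d
    proof -
      have "transpose c d \<circ> transpose a b \<in> N" using swap.hyps that by (intro dt) simp_all
      from N_comp[OF this, of p] show ?thesis using swap.IH that(1) by (simp add: comp_assoc)
    qed
    thus ?case using ev swap by blast
  next
    case id
    show ?case using N_id evenperm_id by blast
  qed
  thus ?thesis using p(2) by blast
qed

end

section \<open>Simplicity\<close>

definition sg :: "perm \<Rightarrow> 'k::field_char_0" where
  "sg p = of_int (sign p)"

lemma SG_permutation: "x \<in> SG n \<Longrightarrow> permutation x"
  by (auto simp: SG_def permutation_permutes)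

lemma sg_comp: "x \<in> SG n \<Longrightarrow> y \<in> SG n \<Longrightarrow> sg (x \<circ> y) = sg x * sg y"
  by (simp add: sg_def sign_compose SG_permutation)

lemma sg_id: "sg id = 1"
  by (simp add: sg_def sign_id)

lemma sg_square: "sg x * sg x = 1"
  by (simp add: sg_def sign_def)

lemma resH_sg: "resH sg = (chv (-1) (-1) :: perm \<Rightarrow> 'k::field_char_0)"
proof -
  have "resH sg \<in> (chars HH :: (perm \<Rightarrow> 'k) set)"
    by (rule resH_chars[of 4]) (simp_all add: sg_comp[where n = 4] sg_id)
  from char_eq_chv[OF this] show ?thesis
    by (simp add: resH_def) (simp add: sg_def t12_def t34_def sign_swap_id)
qed

lemma sum_sg:
  assumes "n \<ge> 4"
  shows "(\<Sum>g\<in>SG n. sg g) = (0 :: 'k::field_char_0)"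
proof -
  have t: "t12 \<in> SG n" by (rule HH_SG[OF assms HH_mem(2)])
  have "(\<Sum>g\<in>SG n. sg g) = (\<Sum>g\<in>SG n. sg (t12 \<circ> g) :: 'k)"
    by (rule sum.reindex_bij_witness[of _ "(\<circ>) t12" "(\<circ>) t12"]) (auto simp: t t12_t34_comp)
  also have "\<dots> = (\<Sum>g\<in>SG n. - sg g)"
    by (intro sum.cong refl) (simp add: sg_comp[OF t], simp add: sg_def t12_def sign_swap_id)
  finally show ?thesis by (simp add: sum_negf eq_neg_iff_add_eq_0 flip: mult_2)
qed

lemma D1_galg_HH: "D1 f \<in> galg HH"
  unfolding D1_def by (intro subsp_sum subspD(3) subsp_galg) (simp add: idem_def galg_def)

lemma slr_mulGG_tens_left:
  assumes "T \<in> galg (SG n \<times> SG n)" "a \<in> KG n"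
  shows "slr n f (mulGG n (tens a (delta id)) T) = mulG n a (slr n f T)"
proof (rule linmap_eqI[OF _ _ _ _ assms(1)])
  fix g assume "g \<in> SG n \<times> SG n"
  thus "slr n f (mulGG n (tens a (delta id)) (delta g)) = mulG n a (slr n f (delta g))"
    using assms(2) by (cases g) (simp add: delta_pair mulGG_tens slr_tens mulG_sc_right)
qed (auto intro!: linmap_comp[OF linmap_slr linmap_mulGG_right] linmap_comp[OF linmap_mulG_right linmap_slr])

text \<open>Reindexing g as g x^-1 turns right multiplication by x \<otimes> y into that by 1
  \<otimes> x^-1 y. For \<open>T\<close> = J the resulting second leg is v.\<close>

lemma sum_diag_mulGG:
  fixes T :: "perm \<times> perm \<Rightarrow> 'k::field"
  assumes "T \<in> galg (SG n \<times> SG n)"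
  shows "mulGG n (\<Sum>g\<in>SG n. tens (delta g) (delta g)) T =
    mulGG n (\<Sum>g\<in>SG n. tens (delta g) (delta g)) (tens (delta id) (mSid n T))"
proof (rule linmap_eqI[OF _ _ _ _ assms])
  fix p assume "p \<in> SG n \<times> SG n"
  then obtain x y where p: "p = (x, y)" "x \<in> SG n" "y \<in> SG n" by auto
  have "mulGG n (\<Sum>g\<in>SG n. tens (delta g) (delta g)) (delta p)
      = (\<Sum>g\<in>SG n. tens (delta (g \<circ> x)) (delta (g \<circ> y)) :: perm \<times> perm \<Rightarrow> 'k)"
    unfolding mulGG_sum_left p(1) delta_pair using p
    by (intro sum.cong refl) (simp add: mulGG_tens)
  also have "\<dots> = (\<Sum>g\<in>SG n. tens (delta g) (delta (g \<circ> (inv x \<circ> y))))"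
  proof (rule sum.reindex_bij_witness[of _ "\<lambda>g. g \<circ> inv x" "\<lambda>g. g \<circ> x"])
    fix g assume g: "g \<in> SG n"
    have "g \<circ> x \<circ> inv x = g \<circ> (x \<circ> inv x)" "g \<circ> inv x \<circ> x = g \<circ> (inv x \<circ> x)"
      "g \<circ> x \<circ> (inv x \<circ> y) = g \<circ> (x \<circ> inv x) \<circ> y"
      by (simp_all only: comp_assoc)
    thus "g \<circ> x \<circ> inv x = g" "g \<circ> inv x \<circ> x = g"
      "tens (delta (g \<circ> x)) (delta (g \<circ> x \<circ> (inv x \<circ> y))) = tens (delta (g \<circ> x)) (delta (g \<circ> y))"
      using p g by simp_all
  qed (use p in auto)
  also have "\<dots> = mulGG n (\<Sum>g\<in>SG n. tens (delta g) (delta g)) (tens (delta id) (mSid n (delta p)))"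
    unfolding mulGG_sum_left p(1) using p
    by (intro sum.cong refl) (simp add: mulGG_tens mSid_delta)
  finally show "mulGG n (\<Sum>g\<in>SG n. tens (delta g) (delta g)) (delta p :: perm \<times> perm \<Rightarrow> 'k) =
    mulGG n (\<Sum>g\<in>SG n. tens (delta g) (delta g)) (tens (delta id) (mSid n (delta p)))" .
qed (auto intro!: linmap_mulGG_right linmap_comp[OF linmap_mulGG_right] linmap_comp[OF linmap_tens_right linmap_mSid])

lemma tens_mulGG_sum_diag:
  fixes a b :: "perm \<Rightarrow> 'k::field"
  assumes "a \<in> KG n" "b \<in> KG n"
  shows "mulGG n (tens a b) (\<Sum>g\<in>SG n. tens (delta g) (delta g)) =
    mulGG n (tens (delta id) (mulG n b (antipG n a))) (\<Sum>g\<in>SG n. tens (delta g) (delta g))"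
proof (rule tens_eqI[OF _ _ _ assms])
  fix x y assume p: "x \<in> SG n" "y \<in> SG n"
  have "mulGG n (delta (x, y)) (\<Sum>g\<in>SG n. tens (delta g) (delta g))
      = (\<Sum>g\<in>SG n. tens (delta (x \<circ> g)) (delta (y \<circ> g)) :: perm \<times> perm \<Rightarrow> 'k)"
    unfolding mulGG_sum_right delta_pair using p
    by (intro sum.cong refl) (simp add: mulGG_tens)
  also have "\<dots> = (\<Sum>g\<in>SG n. tens (delta g) (delta (y \<circ> inv x \<circ> g)))"
  proof (rule sum.reindex_bij_witness[of _ "\<lambda>g. inv x \<circ> g" "\<lambda>g. x \<circ> g"])
    fix g assume g: "g \<in> SG n"
    have "inv x \<circ> (x \<circ> g) = inv x \<circ> x \<circ> g" "x \<circ> (inv x \<circ> g) = x \<circ> inv x \<circ> g"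
      "y \<circ> inv x \<circ> (x \<circ> g) = y \<circ> (inv x \<circ> x) \<circ> g"
      by (simp_all only: comp_assoc)
    thus "inv x \<circ> (x \<circ> g) = g" "x \<circ> (inv x \<circ> g) = g"
      "tens (delta (x \<circ> g)) (delta (y \<circ> inv x \<circ> (x \<circ> g))) = tens (delta (x \<circ> g)) (delta (y \<circ> g))"
      using p g by simp_all
  qed (use p in auto)
  also have "\<dots> = mulGG n (tens (delta id) (mulG n (delta y) (antipG n (delta x)))) (\<Sum>g\<in>SG n. tens (delta g) (delta g))"
    unfolding mulGG_sum_right using p
    by (intro sum.cong refl) (simp add: mulGG_tens)
  finally show "mulGG n (delta (x, y) :: perm \<times> perm \<Rightarrow> 'k) (\<Sum>g\<in>SG n. tens (delta g) (delta g)) =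
    mulGG n (tens (delta id) (mulG n (delta y) (antipG n (delta x)))) (\<Sum>g\<in>SG n. tens (delta g) (delta g))" .
qed (auto intro!: linmap_mulGG_left linmap_comp[OF linmap_mulGG_left] linmap_comp[OF linmap_tens_right]
     linmap_mulG_left linmap_comp[OF linmap_mulG_right linmap_antipG])

text \<open>With symmetry against s, the identities \<open>e1\<close> to \<open>e4\<close> express
  all nontrivial values of \<omega> through those at (s,s), (a,a) and (s,a). Matching these three
  values determines the cochain.\<close>

lemma (in twisted) coboundary_if_symmetric:
  assumes alg_closed: "\<forall>p :: 'k poly. degree p > 0 \<longrightarrow> (\<exists>x. poly p x = 0)"
    and sym: "\<And>\<alpha>. \<alpha> \<in> chars HH \<Longrightarrow> \<omega> (chv (-1) (-1)) \<alpha> = \<omega> \<alpha> (chv (-1) (-1))"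
  shows "coboundary2 (chars HH) \<omega>"
proof -
  have root: "\<exists>x. x * x = z" for z :: 'k
  proof -
    have "degree [:- z, 0, 1:] > 0" by simp
    then obtain x where "poly [:- z, 0, 1:] x = 0" using alg_closed by blast
    thus ?thesis by (auto simp: algebra_simps)
  qed
  define i1 where "i1 = (chv 1 1 :: perm \<Rightarrow> 'k)"
  define s where "s = (chv (-1) (-1) :: perm \<Rightarrow> 'k)"
  define a where "a = (chv (-1) 1 :: perm \<Rightarrow> 'k)"
  define b where "b = (chv 1 (-1) :: perm \<Rightarrow> 'k)"
  note defs = i1_def s_def a_def b_def
  have C: "chars HH = {i1, s, a, b}" by (auto simp: chars_eq defs)
  have mem: "i1 \<in> chars HH" "s \<in> chars HH" "a \<in> chars HH" "b \<in> chars HH" by (auto simp: C)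
  have dist: "s \<noteq> i1" "a \<noteq> i1" "b \<noteq> i1" "a \<noteq> s" "b \<noteq> s" "b \<noteq> a" by (simp_all add: defs chv_eq_iff)
  have mult: "chmul s s = i1" "chmul a a = i1" "chmul b b = i1" "chmul s a = b" "chmul a s = b"
    "chmul s b = a" "chmul b s = a" "chmul a b = s" "chmul b a = s"
    "chmul i1 \<alpha> = \<alpha>" "chmul \<alpha> i1 = \<alpha>" if "\<alpha> \<in> chars HH" for \<alpha>
    using that by (simp_all add: defs chmul_chv)
  note mult = mult(1-9)[OF mem(1)] mult(10,11)
  note nz = omega_nz[OF mem(2) mem(3)] omega_nz[OF mem(2) mem(2)] omega_nz[OF mem(3) mem(3)]
  have one: "\<omega> \<alpha> i1 = c0" "\<omega> i1 \<alpha> = c0" if "\<alpha> \<in> chars HH" for \<alpha>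
    using omega_one that by (simp_all add: defs)
  have sy: "\<omega> a s = \<omega> s a" "\<omega> b s = \<omega> s b" using sym mem by (simp_all add: defs)
  have e1: "\<omega> s a * \<omega> s b = c0 * \<omega> s s"
    using omega_cocycle[OF mem(2,2,3)] by (simp add: mult one mem mult.commute)
  have e2: "\<omega> s a * \<omega> a b = c0 * \<omega> a a"
    using omega_cocycle[OF mem(3,3,2)] by (simp add: mult one mem sy mult.commute)
  have e3: "\<omega> s a * \<omega> b a = c0 * \<omega> a a"
    using omega_cocycle[OF mem(2,3,3)] by (simp add: mult one mem mult.commute)
  have e4: "\<omega> s a * \<omega> b b = \<omega> a b * \<omega> s s"
    using omega_cocycle[OF mem(2,3,4)] by (simp add: mult mem)
  \<comment> \<open>The equations f(s)^2 / f(1) = \<omega>(s,s) and f(a)^2 / f(1) = \<omega>(a,a)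
    with f(1) = \<open>c0\<close> call for square roots; \<open>fb\<close> is then solved from the
    value at (s,a).\<close>
  obtain fs fa where fs: "fs * fs = c0 * \<omega> s s" and fa: "fa * fa = c0 * \<omega> a a" using root by metis
  have fnz: "fs \<noteq> 0" "fa \<noteq> 0" using fs fa nz c0_nz by auto
  define fb where "fb = fs * fa / \<omega> s a"
  define f where "f = (\<lambda>\<alpha>. if \<alpha> = i1 then c0 else if \<alpha> = s then fs else if \<alpha> = a then fa else fb)"
  have f: "f i1 = c0" "f s = fs" "f a = fa" "f b = fb" using dist by (simp_all add: f_def)
  have fbnz: "fb \<noteq> 0" using fnz nz by (simp add: fb_def)
  have w: "\<omega> s s = fs * fs / c0" "\<omega> a a = fa * fa / c0" "\<omega> s a = fs * fa / fb"
    using fs fa c0_nz fnz nz by (simp_all add: fb_def)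
  have ab: "\<omega> a b = fa * fb / fs"
  proof -
    have "\<omega> a b = c0 * \<omega> a a / \<omega> s a" using e2 nz by (simp add: field_simps)
    thus ?thesis using fnz fbnz c0_nz by (simp add: w)
  qed
  have ba: "\<omega> b a = fb * fa / fs"
  proof -
    have "\<omega> b a = c0 * \<omega> a a / \<omega> s a" using e3 nz by (simp add: field_simps)
    thus ?thesis using fnz fbnz c0_nz by (simp add: w)
  qed
  have sb: "\<omega> s b = fs * fb / fa"
  proof -
    have "\<omega> s b = c0 * \<omega> s s / \<omega> s a" using e1 nz by (simp add: field_simps)
    thus ?thesis using fnz fbnz c0_nz by (simp add: w)
  qed
  have bb: "\<omega> b b = fb * fb / c0"
  proof -
    have "\<omega> b b = \<omega> a b * \<omega> s s / \<omega> s a" using e4 nz by (simp add: field_simps)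
    thus ?thesis using fnz fbnz c0_nz by (simp add: w ab)
  qed
  have fnz': "f \<alpha> \<noteq> 0" if "\<alpha> \<in> chars HH" for \<alpha>
    using that c0_nz fnz fbnz by (auto simp: f_def)
  have "\<omega> \<alpha> \<beta> = f \<alpha> * f \<beta> / f (chmul \<alpha> \<beta>)" if "\<alpha> \<in> chars HH" "\<beta> \<in> chars HH" for \<alpha> \<beta>
  proof (cases "\<alpha> = i1 \<or> \<beta> = i1")
    case True
    thus ?thesis using that fnz' by (auto simp: mult one f)
  next
    case False
    hence "\<alpha> \<in> {s, a, b}" "\<beta> \<in> {s, a, b}" using that by (auto simp: C)
    thus ?thesis
      by (elim insertE emptyE; hypsubst) (simp_all add: mult f w ab ba sb bb sy)
  qed
  thus ?thesis using fnz' unfolding coboundary2_def by blast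
qed

context normal_sub
begin

text \<open>The group elements that become 1 in the quotient A/I; the two-sidedness of I makes this
  a normal subgroup.\<close>

definition N where "N = {g \<in> SG n. delta g - one \<in> I}"

lemma normal_subgroup_N: "normal_subgroup n N"
proof
  show "5 \<le> n" by (rule n5)
  show "N \<subseteq> SG n" by (auto simp: N_def)
  show "id \<in> N" using subspD(1)[OF subsp_I] by (simp add: N_def)
  show "x \<circ> y \<in> N" if "x \<in> N" "y \<in> N" for x y
  proof -
    have "(delta x - one) \<star> delta y + (delta y - one) \<in> I"
      using that by (intro subspD(2)[OF subsp_I] I_right) (auto simp: N_def)
    moreover have "(delta x - one) \<star> delta y + (delta y - one) = delta (x \<circ> y) - one"
      using that by (simp add: N_def linmap_diff[OF linmap_mulG_left])
    ultimately show ?thesis using that by (simp add: N_def)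
  qed
  show "inv x \<in> N" if "x \<in> N" for x
  proof -
    have xG: "x \<in> SG n" using that by (simp add: N_def)
    have "sc (-1) (delta (inv x) \<star> (delta x - one)) \<in> I"
      using that by (intro subspD(3)[OF subsp_I] I_left) (auto simp: N_def)
    moreover have "sc (-1) (delta (inv x) \<star> (delta x - one)) = delta (inv x) - one"
      using xG by (simp add: linmap_diff[OF linmap_mulG_right] sc_minus_one)
    ultimately show ?thesis using that by (simp add: N_def)
  qed
  show "s \<circ> x \<circ> inv s \<in> N" if "x \<in> N" "s \<in> SG n" for x s
  proof -
    have "delta s \<star> (delta x - one) \<star> delta (inv s) \<in> I"
      using that by (intro I_left I_right) (auto simp: N_def)
    moreover have "delta s \<star> (delta x - one) \<star> delta (inv s) = delta (s \<circ> x \<circ> inv s) - one"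
      using that by (simp add: N_def linmap_diff[OF linmap_mulG_right] linmap_diff[OF linmap_mulG_left])
    ultimately show ?thesis using that by (simp add: N_def)
  qed
qed

text \<open>\<open>L\<close> kills p - 1 for every even p, so it is invariant under right
  translation by even permutations and takes one value per parity; \<open>u\<close> and
  \<open>w\<close> are their half sum and half difference.\<close>

lemma L_affine_sign:
  assumes "I \<noteq> {0}"
  shows "\<exists>u w. \<forall>g\<in>SG n. L g = u + w * sg g"
proof -
  obtain g0 g1 where g: "g0 \<in> SG n" "g1 \<in> SG n" "g0 \<noteq> g1" "delta g0 - delta g1 \<in> I"
    using I_difference[OF assms] by (elim bexE conjE)
  have "(delta g0 - delta g1) \<star> delta (inv g1) \<in> I" by (rule I_right[OF g(4)])
  hence "g0 \<circ> inv g1 \<in> N" using g by (simp add: N_def linmap_diff[OF linmap_mulG_left])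
  moreover have "g0 \<circ> inv g1 \<noteq> id"
  proof
    assume "g0 \<circ> inv g1 = id"
    hence "g0 \<circ> (inv g1 \<circ> g1) = g1" by (simp flip: comp_assoc)
    thus False using g by simp
  qed
  ultimately have even: "p \<in> N" if "p \<in> SG n" "evenperm p" for p
    using normal_subgroup.even_in_N[OF normal_subgroup_N] that by blast
  have inv: "L (x \<circ> inv p) = L x" if "x \<in> SG n" "p \<in> SG n" "evenperm p" for x p
  proof -
    have "L \<star> (delta p - one) = 0" using even[OF that(2,3)] by (simp add: N_def I_def)
    hence "L \<star> delta p = L" by (simp add: linmap_diff[OF linmap_mulG_right])
    thus ?thesis using mulG_delta_right[OF that(2,1), of L] by simp
  qed
  have t: "t12 \<in> SG n" by (rule HH_SG[OF n4 HH_mem(2)])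
  have L1: "L p = L id" if "p \<in> SG n" "evenperm p" for p
    using inv[of p p] that by simp
  have L2: "L p = L t12" if "p \<in> SG n" "\<not> evenperm p" for p
  proof -
    have "evenperm (t12 \<circ> p)"
      using that t by (simp add: evenperm_comp SG_permutation) (simp add: t12_def evenperm_swap)
    hence "L (p \<circ> inv (t12 \<circ> p)) = L p" using that t by (intro inv) auto
    moreover have "p \<circ> inv (t12 \<circ> p) = p \<circ> inv p \<circ> inv t12"
      unfolding inv_comp_SG[OF t that(1)] by (simp only: comp_assoc)
    ultimately show ?thesis using that by (simp add: HH_inv)
  qed
  have "L p = (L id + L t12) / 2 + (L id - L t12) / 2 * sg p" if "p \<in> SG n" for p
    using L1[OF that] L2[OF that] by (cases "evenperm p") (simp_all add: sg_def sign_def field_simps)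
  thus ?thesis by blast
qed

lemma pr_L_affine:
  assumes "\<forall>g\<in>SG n. L g = u + w * sg g"
  shows "u * of_nat (card (SG n)) = 1" "pr (SG n) sg L = w * of_nat (card (SG n))"
proof -
  have "eps n L = (\<Sum>g\<in>SG n. u + w * sg g)"
    using assms by (simp add: eps_def pr_def)
  thus "u * of_nat (card (SG n)) = 1"
    by (simp add: eps_L sum.distrib sum_sg n4 mult.commute flip: sum_distrib_left)
  have "pr (SG n) sg L = (\<Sum>g\<in>SG n. u * sg g + w)"
    unfolding pr_def by (intro sum.cong refl) (simp add: assms ring_distribs mult.left_commute sg_square)
  thus "pr (SG n) sg L = w * of_nat (card (SG n))"
    by (simp add: sum.distrib sum_sg n4 mult.commute flip: sum_distrib_left)
qed

text \<open>If the integral of \<open>B\<close> is that of the whole group algebra, then its twisted coproduct is a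
  multiple of the sum of all \<open>g \<otimes> v\<^sup>-\<^sup>1 g v\<close>, which has full rank.\<close>

lemma B_full:
  assumes L: "\<And>g. g \<in> SG n \<Longrightarrow> L g = u" and u: "u \<noteq> 0"
  shows "B = KG n"
proof -
  define T0 where "T0 = (\<Sum>g\<in>SG n. tens (delta g) (delta g) :: perm \<times> perm \<Rightarrow> 'k)"
  have "L = (\<Sum>g\<in>SG n. sc (L g) (delta g))"
    using galg_expand[OF finite_SG L_KG[unfolded KG_def]] .
  hence "L = sc u (\<Sum>g\<in>SG n. delta g)" by (simp add: L sc_sum_right)
  hence "comultG n L = sc u (\<Sum>g\<in>SG n. comultG n (delta g))"
    by (metis linmap_sc[OF linmap_comultG] linmap_sum[OF linmap_comultG])
  hence DL: "comultG n L = sc u T0" by (simp add: T0_def)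
  have left: "Ji \<odot> T0 = tens one vi \<odot> T0"
  proof -
    have "Ji \<odot> T0 = (\<Sum>\<alpha>\<in>chars HH. \<Sum>\<beta>\<in>chars HH. sc (1 / \<omega> \<alpha> \<beta>)
       (tens one (if \<beta> = \<alpha> then idem HH \<beta> else 0) \<odot> T0))"
      unfolding Ji_def D2_def mulGG_sum_left mulGG_sc_left T0_def
      using n4 by (intro sum.cong refl) (simp add: tens_mulGG_sum_diag idem_KG antipG_idem idem_mult)
    also have "\<dots> = (\<Sum>\<alpha>\<in>chars HH. \<Sum>\<beta>\<in>chars HH. if \<beta> = \<alpha> then sc (1 / \<omega> \<beta> \<beta>) (tens one (idem HH \<beta>) \<odot> T0) else 0)"
      by (intro sum.cong refl) (auto simp: linmap_zero[OF linmap_tens_right] linmap_zero[OF linmap_mulGG_left])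
    also have "\<dots> = tens one vi \<odot> T0"
      by (simp add: vi_def D1_def tens_sum_right tens_sc mulGG_sum_left mulGG_sc_left)
    finally show ?thesis .
  qed
  have "DJ L = sc u (Ji \<odot> T0 \<odot> J)" by (simp add: DJ_eq DL mulGG_sc_left mulGG_sc_right)
  also have "Ji \<odot> T0 \<odot> J = tens one vi \<odot> (T0 \<odot> J)" by (simp add: left mulGG_assoc)
  also have "T0 \<odot> J = T0 \<odot> tens one v"
    unfolding T0_def by (subst sum_diag_mulGG) (simp_all add: mSid_J)
  also have "tens one vi \<odot> (T0 \<odot> tens one v) = (\<Sum>g\<in>SG n. tens (delta g) (vi \<star> delta g \<star> v))"
    unfolding T0_def mulGG_sum_left mulGG_sum_right
    by (intro sum.cong refl) (simp add: mulGG_tens mulG_assoc)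
  finally have DJL: "DJ L = sc u (\<Sum>g\<in>SG n. tens (delta g) (vi \<star> delta g \<star> v))" .
  have "delta h \<in> B" if h: "h \<in> SG n" for h
  proof -
    \<comment> \<open>This functional undoes the conjugation by v and reads the coefficient at
      \<open>h\<close>, so slicing \<Delta>^J(L) by it isolates \<open>delta h\<close> up to the
      factor \<open>u\<close>.\<close>
    define f where "f q = (v \<star> delta q \<star> vi) h" for q
    have pr_f: "pr (SG n) f y = (v \<star> y \<star> vi) h" if "y \<in> KG n" for y
    proof -
      have "linmap (\<lambda>y. v \<star> y \<star> vi)" by (rule linmap_comp[OF linmap_mulG_left linmap_mulG_right])
      from fun_cong[OF linmap_expand[OF finite_SG this that[unfolded KG_def]], of h]
      show ?thesis by (simp add: pr_def f_def sum_fun_apply mult.commute)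
    qed
    have "pr (SG n) f (vi \<star> delta g \<star> v) = delta h g" if g: "g \<in> SG n" for g
    proof -
      have "v \<star> (vi \<star> delta g \<star> v) \<star> vi = (v \<star> vi) \<star> delta g \<star> (v \<star> vi)" by (simp only: mulG_assoc)
      also have "\<dots> = delta g" using g by (simp add: v_inverse)
      finally show ?thesis by (simp add: pr_f delta_def)
    qed
    hence "slr n f (DJ L) = sc u (\<Sum>g\<in>SG n. sc (delta h g) (delta g))"
      unfolding DJL by (simp add: linmap_sc[OF linmap_slr] linmap_sum[OF linmap_slr] slr_tens)
    also have "(\<Sum>g\<in>SG n. sc (delta h g) (delta g)) = delta h"
      by (rule galg_expand[OF finite_SG delta_galg[OF h], symmetric])
    finally have "sc u (delta h) \<in> B" using slr_DJ_B[OF L_B, of f] by metis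
    hence "sc (1 / u) (sc u (delta h)) \<in> B" by (rule subspD(3)[OF subsp_B])
    thus ?thesis using u by simp
  qed
  hence "x \<in> B" if "x \<in> KG n" for x
    using linmap_in_subsp[OF finite_SG _ subsp_B _ that[unfolded KG_def], of "\<lambda>x. x"]
    by (simp add: linmap_def)
  thus ?thesis using B_KG by blast
qed

text \<open>If the sign character is trivial on \<open>B\<close>, then evaluating it on one leg of \<open>\<Delta>\<^sup>J(b)\<close> shows that
  \<open>t = r\<^sup>-\<^sup>1 l\<close>, with \<open>r = (id \<otimes> sg)(J)\<close> and \<open>l = (sg \<otimes> id)(J)\<close>, commutes with \<open>B\<close>, hence with the legs of \<open>\<Delta>\<^sup>J(L)\<close> and with all even permutations.\<close>

lemma omega_symmetric:
  assumes sgI: "\<And>x. x \<in> I \<Longrightarrow> pr (SG n) sg x = 0" and Lev: "\<And>g. g \<in> SG n \<Longrightarrow> evenperm g \<Longrightarrow> L g \<noteq> 0"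
    and a: "\<alpha> \<in> chars HH"
  shows "\<omega> (chv (-1) (-1)) \<alpha> = \<omega> \<alpha> (chv (-1) (-1))"
proof -
  define s where "s = (chv (-1) (-1) :: perm \<Rightarrow> 'k)"
  have s: "s \<in> chars HH" by (simp add: s_def chars_eq)
  have res: "resH sg = s" by (simp add: s_def resH_sg)
  define r where "r = D1 (\<lambda>\<alpha>. \<omega> \<alpha> s)"
  define ri where "ri = D1 (\<lambda>\<alpha>. 1 / \<omega> \<alpha> s)"
  define l where "l = D1 (\<lambda>\<alpha>. \<omega> s \<alpha>)"
  define li where "li = D1 (\<lambda>\<alpha>. 1 / \<omega> s \<alpha>)"
  define \<rho> where "\<rho> \<alpha> = \<omega> s \<alpha> / \<omega> \<alpha> s" for \<alpha>
  define t where "t = D1 \<rho>"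
  have KGs: "r \<in> KG n" "ri \<in> KG n" "l \<in> KG n" "li \<in> KG n" "t \<in> KG n"
    using n4 by (simp_all add: r_def ri_def l_def li_def t_def)
  have "D1 (\<lambda>\<alpha>. \<omega> \<alpha> s * (1 / \<omega> \<alpha> s)) = D1 (\<lambda>_. 1)" "D1 (\<lambda>\<alpha>. \<omega> s \<alpha> * (1 / \<omega> s \<alpha>)) = D1 (\<lambda>_. 1)"
    by (rule D1_cong; simp add: omega_nz s)+
  hence rri: "r \<star> ri = one" and lli: "l \<star> li = one"
    using n4 by (simp_all add: r_def ri_def l_def li_def D1_mult D1_const)
  have t_eq: "t = ri \<star> l"
    using n4 by (simp add: ri_def l_def D1_mult t_def \<rho>_def[abs_def])
  have sgB: "pr (SG n) sg b = eps n b" if "b \<in> B" for b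
  proof -
    have "b - sc (eps n b) one \<in> I"
      using that by (intro augmentation_I subspD(3,4)[OF subsp_B] B_one) (simp_all add: eps_diff eps_sc)
    from sgI[OF this] show ?thesis by (simp add: pr_diff pr_sc pr_delta sg_id)
  qed
  have tb: "t \<star> b = b \<star> t" if b: "b \<in> B" for b
  proof -
    obtain m x y where DJb: "DJ b = (\<Sum>i<(m::nat). tens (x i) (y i))"
      and xy: "\<forall>i<m. x i \<in> B \<and> y i \<in> B" by (rule DJ_decompose[OF b])
    have "slr n sg (DJ b) = slr n (\<lambda>_. 1) (DJ b)" "sll n sg (DJ b) = sll n (\<lambda>_. 1) (DJ b)"
      unfolding DJb linmap_sum[OF linmap_slr] linmap_sum[OF linmap_sll] slr_tens sll_tens
      using xy by (simp_all add: sgB) (simp_all add: eps_def)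
    hence e: "slr n sg (DJ b) = b" "sll n sg (DJ b) = b" by (simp_all add: counit_DJ B_KG b)
    define \<sigma> where "\<sigma> = (\<lambda>g. sg g * b g)"
    \<comment> \<open>Both sign slices of \<Delta>^J(b) return b, so \<sigma> equals r b r^-1 as
      well as l b l^-1; comparing the two yields the commutation with t.\<close>
    have br: "ri \<star> \<sigma> \<star> r = b"
      using e(1) slr_DJ_char(1)[OF B_KG[OF b], of sg] slr_J[of sg] s
      by (simp add: sg_comp[where n = n] res r_def ri_def \<sigma>_def)
    have bl: "li \<star> \<sigma> \<star> l = b"
      using e(2) slr_DJ_char(2)[OF B_KG[OF b], of sg] slr_J[of sg] s
      by (simp add: sg_comp[where n = n] res l_def li_def \<sigma>_def)
    have "t \<star> b = ri \<star> ((l \<star> li) \<star> (\<sigma> \<star> l))" unfolding t_eq bl[symmetric] by (simp only: mulG_assoc)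
    also have "\<dots> = ri \<star> \<sigma> \<star> l" by (simp add: lli mulG_assoc)
    also have "\<dots> = ri \<star> (\<sigma> \<star> ((r \<star> ri) \<star> l))" by (simp add: rri KGs mulG_assoc)
    also have "\<dots> = b \<star> t" unfolding t_eq br[symmetric] by (simp only: mulG_assoc)
    finally show ?thesis .
  qed
  let ?t = "tens t one"
  have tJ: "?t \<odot> D2 F = D2 F \<odot> ?t" for F
    using tens_D1[of \<rho> "\<lambda>_. 1"] n4 by (simp add: D1_const t_def D2_mult mult.commute)
  have tDJ: "?t \<odot> DJ L = DJ L \<odot> ?t"
  proof -
    obtain m x y where DJL: "DJ L = (\<Sum>i<(m::nat). tens (x i) (y i))"
      and xy: "\<forall>i<m. x i \<in> B \<and> y i \<in> B" by (rule DJ_decompose[OF L_B])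
    show ?thesis unfolding DJL mulGG_sum_left mulGG_sum_right
      using xy by (intro sum.cong refl) (simp add: mulGG_tens KGs B_KG tb)
  qed
  \<comment> \<open>t \<otimes> 1 commutes with J, both being diagonal, so commutation passes from
    \<Delta>^J(L) to \<Delta>(L), the sum of all L(g) g \<otimes> g, from which single g can be
    sliced off.\<close>
  have tD: "?t \<odot> comultG n L = comultG n L \<odot> ?t"
  proof -
    have "?t \<odot> comultG n L = (?t \<odot> J) \<odot> DJ L \<odot> Ji" by (simp add: comultG_DJ mulGG_assoc)
    also have "\<dots> = J \<odot> (?t \<odot> DJ L) \<odot> Ji" by (simp add: J_D2 tJ mulGG_assoc)
    also have "\<dots> = J \<odot> DJ L \<odot> (?t \<odot> Ji)" by (simp add: tDJ mulGG_assoc)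
    also have "\<dots> = comultG n L \<odot> ?t" by (simp add: Ji_def tJ comultG_DJ mulGG_assoc)
    finally show ?thesis .
  qed
  have tg: "t \<star> delta g = delta g \<star> t" if g: "g \<in> SG n" "evenperm g" for g
  proof -
    have "slr n (delta g) (comultG n L) = sc (L g) (delta g)"
      by (intro ext) (simp add: slr_comultG delta_def)
    hence "sc (L g) (t \<star> delta g) = sc (L g) (delta g \<star> t)"
      using arg_cong[OF tD, of "slr n (delta g)"]
      by (simp add: slr_mulGG_tens_left slr_mulGG_tens_right KGs mulG_sc_left mulG_sc_right)
    from arg_cong[OF this, of "sc (1 / L g)"] show ?thesis using Lev[OF g] by simp
  qed
  have tH: "t h = 0" if h: "h \<in> HH" "h \<noteq> id" for h
  proof -
    have hG: "h \<in> SG n" by (rule HH_SG[OF n4 h(1)])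
    have "h 1 \<noteq> 1 \<or> h 3 \<noteq> 3"
      using h unfolding HH_def by (auto simp: transpose_def)
    then obtain k :: nat where k: "h k \<noteq> k" "k = 1 \<or> k = 3" by blast
    \<comment> \<open>\<open>g\<close> sends 5 to a point \<open>k\<close> moved by
      \<open>h\<close>, so the conjugate of \<open>h\<close> by \<open>inv g\<close> moves 5 and
      leaves H, which fixes 5. The second transposition only makes \<open>g\<close> even.\<close>
    define g where "g = transpose 5 k \<circ> transpose k 2"
    have g: "g \<in> SG n" unfolding g_def using k n5 by (intro comp_SG transpose_SG) auto
    have ge: "evenperm g" unfolding g_def
      using k by (auto simp: evenperm_comp permutation_swap_id evenperm_swap)
    have g5: "g 5 = k" using k by (auto simp: g_def transpose_def)
    have ginj: "inv g (g x) = x" "g (inv g x) = x" for x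
      using fun_cong[OF comp_inv_SG(2)[OF g], of x] fun_cong[OF comp_inv_SG(1)[OF g], of x] by simp_all
    have "inv g \<circ> h \<circ> g \<notin> HH"
    proof
      assume "inv g \<circ> h \<circ> g \<in> HH"
      from HH_fixes[OF this, of 5] have "inv g (h k) = 5" by (simp add: g5)
      hence "h k = g 5" using ginj(2)[of "h k"] by simp
      thus False using k g5 by simp
    qed
    hence "t (inv g \<circ> h \<circ> g) = 0" using D1_galg_HH[of \<rho>] by (simp add: t_def galg_def)
    moreover have "(t \<star> delta g) (h \<circ> g) = t h"
      using mulG_delta_right[OF g comp_SG[OF hG g], of t] g by (simp add: comp_assoc)
    moreover have "(delta g \<star> t) (h \<circ> g) = t (inv g \<circ> h \<circ> g)"
      using mulG_delta_left[OF g comp_SG[OF hG g], of t] by (simp add: comp_assoc)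
    ultimately show ?thesis using tg[OF g ge] by simp
  qed
  have "t = sc (t id) one"
  proof
    fix x
    show "t x = sc (t id) one x"
      using tH[of x] D1_galg_HH[of \<rho>] by (cases "x \<in> HH") (auto simp: delta_def t_def galg_def)
  qed
  hence "t \<star> idem HH \<beta> = sc (t id) (idem HH \<beta>)" for \<beta>
    using n4 by (metis mulG_sc_left mulG_unit_left idem_KG)
  \<comment> \<open>Evaluation at \<open>id\<close>, where each idempotent has the value 1/4,
    extracts an equality of scalars.\<close>
  hence "sc (\<rho> \<beta>) (idem HH \<beta>) id = sc (t id) (idem HH \<beta>) id" if "\<beta> \<in> chars HH" for \<beta>
    using D1_idem_right[OF n4 that, of \<rho>] by (simp add: t_def del: sc_apply)
  hence "\<rho> \<beta> = t id" if "\<beta> \<in> chars HH" for \<beta>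
    using that by (simp add: idem_def char_id)
  hence "\<rho> \<alpha> = \<rho> (chv 1 1)" using a by simp
  also have "\<dots> = 1" by (simp add: \<rho>_def omega_one s c0_nz)
  finally show ?thesis using a omega_nz[OF a s] by (simp add: \<rho>_def s_def)
qed

end

theorem theorem3p5:
  fixes n :: nat and \<omega> :: "(perm \<Rightarrow> 'k::field_char_0) \<Rightarrow> (perm \<Rightarrow> 'k) \<Rightarrow> 'k"
  assumes alg_closed: "\<forall>p :: 'k poly. degree p > 0 \<longrightarrow> (\<exists>x. poly p x = 0)"
    and n5: "n \<ge> 5"
    and cocyc: "cocycle2 (chars HH) \<omega>"
    and nontriv: "\<not> coboundary2 (chars HH) \<omega>"
  shows "simple_twisted n (twistJ HH \<omega>)"
  unfolding simple_twisted_def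
proof (intro allI impI)
  fix B :: "(perm \<Rightarrow> 'k) set"
  assume B: "normal_hopf_subalg n (twistJ HH \<omega>) B"
  interpret twisted n \<omega> by unfold_locales (fact n5 cocyc)+
  interpret hopf_sub n \<omega> B
    by unfold_locales (use B in \<open>simp add: normal_hopf_subalg_def J_def\<close>)
  obtain L where "L \<in> B" "eps n L = 1" "\<forall>x\<in>B. L \<star> x = sc (eps n x) L"
    using integral_exists by (elim bexE conjE)
  then interpret normal_sub n \<omega> B L
    by unfold_locales (use B in \<open>auto simp: normal_hopf_subalg_def J_def\<close>)
  show "B = {sc c (delta id) | c. True} \<or> B = KG n"
  proof (cases "I = {0}")
    case True
    thus ?thesis using B_trivial by blast
  next
    case False
    from L_affine_sign[OF this] obtain u w where uw: "\<forall>g\<in>SG n. L g = u + w * sg g" by (elim exE)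
    note pL = pr_L_affine[OF uw]
    have G0: "of_nat (card (SG n)) \<noteq> (0 :: 'k)" using pL(1) by auto
    show ?thesis
    proof (cases "\<exists>x\<in>I. pr (SG n) sg x \<noteq> 0")
      case True
      then obtain x where x: "x \<in> I" "pr (SG n) sg x \<noteq> 0" by (elim bexE)
      \<comment> \<open>The left side vanishes as L x = 0, while the sign of x does not; hence the
        sign of L is 0 and \<open>L\<close> is constant.\<close>
      have "pr (SG n) sg (L \<star> x) = pr (SG n) sg L * pr (SG n) sg x"
        unfolding mulG_def by (rule G.pr_conv) (rule sg_comp)
      hence "pr (SG n) sg L = 0" using x by (simp add: I_def)
      hence "w = 0" using pL(2) G0 by simp
      hence "B = KG n" using uw pL(1) by (intro B_full[of u]) auto
      thus ?thesis ..
    next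
      case False
      hence sgI: "pr (SG n) sg x = 0" if "x \<in> I" for x using that by auto
      from sgI[OF E_I] have "pr (SG n) sg L = 1" by (simp add: E_def pr_diff pr_delta sg_id)
      hence "(w - u) * of_nat (card (SG n)) = 0" using pL by (simp add: left_diff_distrib)
      hence "w = u" using G0 by simp
      \<comment> \<open>With \<open>w\<close> = \<open>u\<close> the integral takes the value 2u on
        even permutations and 0 on odd ones.\<close>
      have Lev: "L g \<noteq> 0" if "g \<in> SG n" "evenperm g" for g
        using uw that pL(1) \<open>w = u\<close> by (auto simp: sg_def sign_def simp flip: mult_2)
      have "coboundary2 (chars HH) \<omega>"
        by (rule coboundary_if_symmetric[OF alg_closed]) (rule omega_symmetric[OF sgI Lev])
      with nontriv show ?thesis by contradiction
    qed
  qed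
qed

end
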